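(* Assume the Markov semigroup $(P_t)$ on the Polish space $(E,\rho)$ is Feller, and that: (1) there exist a measurable $V:E\to[0,\infty)$ and constants $\gamma>0$, $K>0$ such that $P_tV(x)\le V(x)-\gamma\int_0^tP_sV(x)\,ds+Kt$ for all $t\ge0$, $x\in E$; (2) $\rho\wedge1\le\theta$ for a premetric $\theta$; (3) Assumption A holds (with this $\theta$) for some functions $r,L$; (4* ) Assumption B2 holds (with this $\theta$) for some function $R$, the set $B=\{V\le 4K/\gamma\}$ and some $\varepsilon>0$. Then $(P_t)$ has a unique invariant probability measure $\pi$, and for any $\delta\in(0,1)$ there exist constants $C_1,C_2>0$ such that for all $x\in E$, $t\ge0$, $$W_{\rho\wedge1}(P_t(x,\cdot),\pi)\le\frac{C_1(1+\phi(V(x))^\delta)}{\phi(H_\phi^{-1}(C_2t))^\delta},\qquad \phi(u)=\gamma u,\quad H_\phi(x)=\int_1^x\frac{du}{\phi(u)}.$$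
   Context: $(E,\rho)$ Polish, $(P_t)$ a Markov transition function with semigroup $P_t\phi(x)=\int\phi(y)P_t(x,dy)$, $\mathbb P_x$ the law of the Markov process started at $x$. Feller: $P_t$ maps bounded continuous functions to bounded continuous functions. A premetric is a lower semicontinuous $\theta:E\times E\to\mathbb R_+$ with $\theta(x,y)=0\iff x=y$. $W_d(\mu,\nu):=\inf\int d\,d\lambda$ over couplings $\lambda$ of $\mu,\nu$; $d_{TV}(\mu,\nu)=\sup_A|\mu(A)-\nu(A)|$. Assumption A: there exist a non-increasing $r:\mathbb R_+\to\mathbb R_+$ with $r(t)\to0$ and a locally bounded $L:\mathbb R_+\to\mathbb R_+$ such that for any $x,y\in E$ there exist random processes $X^{x,y},Y^{x,y}$ on a common probability space with (1) $\mathrm{Law}(X^{x,y})=\mathbb P_x$ and $d_{TV}(\mathrm{Law}(Y^{x,y}_t),P_t(y,\cdot))\le L(t)\theta(x,y)$, $t\ge0$; (2) $\mathbb E\theta(X^{x,y}_t,Y^{x,y}_t)\le r(t)\theta(x,y)$, $t\ge0$. Assumption B2 (for a set $B$, a non-increasing $R:\mathbb R_+\to\mathbb R_+$ with $R(t)\to0$, and $\varepsilon>0$): for any $x,y\in B$ there exist random processes $X^{x,y},Y^{x,y}$ on a common probability space with (1) $\mathrm{Law}(X^{x,y})=\mathbb P_x$ and $d_{TV}(\mathrm{Law}(Y^{x,y}_t),P_t(y,\cdot))\le1-\varepsilon$, $t\ge0$; (2) $\mathbb E\theta(X^{x,y}_t,Y^{x,y}_t)\le R(t)$, $t\ge0$.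 *)

theory Defs
  imports "HOL-Probability.Probability"
begin

definition markov_transition :: "(real \<Rightarrow> 'a::polish_space \<Rightarrow> 'a measure) \<Rightarrow> bool" where
  "markov_transition P \<longleftrightarrow>
     (\<forall>t\<ge>0. \<forall>x. prob_space (P t x) \<and> sets (P t x) = sets borel) \<and>
     (\<forall>t\<ge>0. \<forall>A\<in>sets borel. (\<lambda>x. emeasure (P t x) A) \<in> borel_measurable borel) \<and>
     (\<forall>x. P 0 x = return borel x) \<and>
     (\<forall>s\<ge>0. \<forall>t\<ge>0. \<forall>x. \<forall>A\<in>sets borel.
        emeasure (P (s + t) x) A = (\<integral>\<^sup>+ y. emeasure (P t y) A \<partial>P s x))"

definition semigroup :: "(real \<Rightarrow> 'a \<Rightarrow> 'a measure) \<Rightarrow> real \<Rightarrow> ('a \<Rightarrow> real) \<Rightarrow> 'a \<Rightarrow> real" where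
  "semigroup P t f x = (\<integral> y. f y \<partial>P t x)"

definition feller :: "(real \<Rightarrow> 'a::polish_space \<Rightarrow> 'a measure) \<Rightarrow> bool" where
  "feller P \<longleftrightarrow> (\<forall>t\<ge>0. \<forall>f::'a \<Rightarrow> real. continuous_on UNIV f \<and> bounded (range f) \<longrightarrow>
      continuous_on UNIV (semigroup P t f) \<and> bounded (range (semigroup P t f)))"

text \<open>Finite-dimensional cylinder probabilities of the Markov process:
  the list consists of (time increment, set) pairs.\<close>
fun markov_cyl :: "(real \<Rightarrow> 'a \<Rightarrow> 'a measure) \<Rightarrow> (real \<times> 'a set) list \<Rightarrow> 'a \<Rightarrow> ennreal" where
  "markov_cyl P [] x = 1"
| "markov_cyl P ((s, A) # rest) x = (\<integral>\<^sup>+ y. indicator A y * markov_cyl P rest y \<partial>P s x)"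

text \<open>\<open>Law(X) = \<P>_x\<close>: X is a process on the probability space M whose finite-dimensional
  distributions are those of the Markov process with transition function P started at x
  (these determine the law on path space).\<close>
definition law_is_markov :: "(real \<Rightarrow> 'a::polish_space \<Rightarrow> 'a measure) \<Rightarrow> 'a \<Rightarrow> 'b measure \<Rightarrow> (real \<Rightarrow> 'b \<Rightarrow> 'a) \<Rightarrow> bool" where
  "law_is_markov P x M X \<longleftrightarrow>
     (\<forall>t\<ge>0. X t \<in> measurable M borel) \<and>
     (\<forall>l::(real \<times> 'a set) list. (\<forall>p\<in>set l. fst p \<ge> 0 \<and> snd p \<in> sets borel) \<longrightarrow>
        emeasure M {\<omega>\<in>space M. \<forall>i<length l. X (\<Sum>j\<le>i. fst (l ! j)) \<omega> \<in> snd (l ! i)}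
          = markov_cyl P l x)"

definition tv_dist :: "'a measure \<Rightarrow> 'a measure \<Rightarrow> real" where
  "tv_dist \<mu> \<nu> = (SUP A\<in>sets \<mu>. \<bar>measure \<mu> A - measure \<nu> A\<bar>)"

definition premetric :: "('a::topological_space \<Rightarrow> 'a \<Rightarrow> real) \<Rightarrow> bool" where
  "premetric \<theta> \<longleftrightarrow> (\<forall>c. closed {p::'a \<times> 'a. \<theta> (fst p) (snd p) \<le> c}) \<and>
     (\<forall>x y. \<theta> x y \<ge> 0) \<and> (\<forall>x y. \<theta> x y = 0 \<longleftrightarrow> x = y)"

definition coupling :: "'a::topological_space measure \<Rightarrow> 'a measure \<Rightarrow> ('a \<times> 'a) measure \<Rightarrow> bool" where
  "coupling \<mu> \<nu> cpl \<longleftrightarrow> prob_space cpl \<and> sets cpl = sets (borel \<Otimes>\<^sub>M borel) \<and>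
     distr cpl borel fst = \<mu> \<and> distr cpl borel snd = \<nu>"

definition wasserstein :: "('a::topological_space \<Rightarrow> 'a \<Rightarrow> real) \<Rightarrow> 'a measure \<Rightarrow> 'a measure \<Rightarrow> ennreal" where
  "wasserstein d \<mu> \<nu> = (INF cpl\<in>{cpl. coupling \<mu> \<nu> cpl}. \<integral>\<^sup>+ p. ennreal (d (fst p) (snd p)) \<partial>cpl)"

definition assumption_A :: "(real \<Rightarrow> 'a::polish_space \<Rightarrow> 'a measure) \<Rightarrow> ('a \<Rightarrow> 'a \<Rightarrow> real)
    \<Rightarrow> (real \<Rightarrow> real) \<Rightarrow> (real \<Rightarrow> real) \<Rightarrow> 'b itself \<Rightarrow> bool" where
  "assumption_A P \<theta> r L _ \<longleftrightarrow>
     (\<forall>t\<ge>0. r t \<ge> 0) \<and> antimono_on {0..} r \<and> (r \<longlongrightarrow> 0) at_top \<and>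
     (\<forall>t\<ge>0. L t \<ge> 0) \<and> (\<forall>T\<ge>0. bounded (L ` {0..T})) \<and>
     (\<forall>x y. \<exists>(M::'b measure) X Y. prob_space M \<and> law_is_markov P x M X \<and>
        (\<forall>t\<ge>0. Y t \<in> measurable M borel) \<and>
        (\<forall>t\<ge>0. tv_dist (distr M borel (Y t)) (P t y) \<le> L t * \<theta> x y) \<and>
        (\<forall>t\<ge>0. (\<integral>\<^sup>+ \<omega>. ennreal (\<theta> (X t \<omega>) (Y t \<omega>)) \<partial>M) \<le> ennreal (r t * \<theta> x y)))"

definition assumption_B2 :: "(real \<Rightarrow> 'a::polish_space \<Rightarrow> 'a measure) \<Rightarrow> ('a \<Rightarrow> 'a \<Rightarrow> real)
    \<Rightarrow> 'a set \<Rightarrow> (real \<Rightarrow> real) \<Rightarrow> real \<Rightarrow> 'b itself \<Rightarrow> bool" where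
  "assumption_B2 P \<theta> B R \<epsilon> _ \<longleftrightarrow>
     (\<forall>t\<ge>0. R t \<ge> 0) \<and> antimono_on {0..} R \<and> (R \<longlongrightarrow> 0) at_top \<and>
     (\<forall>x\<in>B. \<forall>y\<in>B. \<exists>(M::'b measure) X Y. prob_space M \<and> law_is_markov P x M X \<and>
        (\<forall>t\<ge>0. Y t \<in> measurable M borel) \<and>
        (\<forall>t\<ge>0. tv_dist (distr M borel (Y t)) (P t y) \<le> 1 - \<epsilon>) \<and>
        (\<forall>t\<ge>0. (\<integral>\<^sup>+ \<omega>. ennreal (\<theta> (X t \<omega>) (Y t \<omega>)) \<partial>M) \<le> ennreal (R t)))"

definition invariant_measure :: "(real \<Rightarrow> 'a::topological_space \<Rightarrow> 'a measure) \<Rightarrow> 'a measure \<Rightarrow> bool" where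
  "invariant_measure P \<pi> \<longleftrightarrow> prob_space \<pi> \<and> sets \<pi> = sets borel \<and>
     (\<forall>t\<ge>0. \<forall>A\<in>sets borel. emeasure \<pi> A = (\<integral>\<^sup>+ x. emeasure (P t x) A \<partial>\<pi>))"

definition phi :: "real \<Rightarrow> real \<Rightarrow> real" where
  "phi \<gamma> u = \<gamma> * u"

definition H_phi :: "real \<Rightarrow> real \<Rightarrow> real" where
  "H_phi \<gamma> x = (LBINT u=ereal 1..ereal x. 1 / phi \<gamma> u)"

definition H_phi_inv :: "real \<Rightarrow> real \<Rightarrow> real" where
  "H_phi_inv \<gamma> y = (THE x. x > 0 \<and> H_phi \<gamma> x = y)"

end

theory Submission
  imports Defs
begin

text \<open>
  The convergence is proved on the dual side, by contracting a Lipschitz-type seminorm of test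
  functions, so that one coupling per pair of points suffices and no measurable selection of
  couplings is needed. A generalized coupling becomes a genuine one by redrawing its second
  coordinate on the part of mass at most the total variation error. For \<open>d = min (N \<theta>) 1\<close> with
  large \<open>N\<close>, Assumption A then contracts points with \<open>d < 1\<close>, Assumption B2 makes the sublevel set
  of \<open>V\<close> small for \<open>d\<close>, and the seminorm with respect to \<open>sqrt (d (1 + \<beta> V + \<beta> V))\<close> is
  contracted by \<open>P T\<close> as in the weak form of Harris' theorem.

  Kantorovich-Rubinstein duality for \<open>min dist 1\<close>, obtained from Farkas' lemma on finite
  partitions, turns the dual estimates back into couplings. Applied to \<open>P (n T) x\<close> these couplings
  are kernels, and the Ionescu-Tulcea theorem produces an almost surely convergent chain whose
  limit law is the invariant measure. The exponent \<open>\<delta>\<close> is reached by interpolating the exponential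
  bound, which is linear in \<open>V\<close>, with the trivial bound 1.
\<close>

section \<open>Finite transport duality\<close>

text \<open>The order of the choices keeps the parameters consistent. In Assumption A the total
  variation defect may grow in time through \<open>L\<close>, so the near contraction is set up at
  one time \<open>t1\<close>; this fixes \<open>N\<close>, because \<open>N * \<theta>\<close> has
  to absorb the defect \<open>L t1 * \<theta>\<close>. The time \<open>T\<close> must come later,
  since \<open>R T\<close> has to be small relative to \<open>1 / N\<close>. Contracting near points
  directly at \<open>T\<close> would make \<open>N\<close> depend on \<open>T\<close> and close a
  circle; hence \<open>T\<close> is a multiple of \<open>t1\<close>. The weight
  \<open>\<beta>\<close> is chosen last, small in terms of the number \<open>k\<close> of steps.

  The square root in the seminorm is adapted to Cauchy-Schwarz: the mean of
  \<open>sqrt (d * U)\<close> is at most the square root of the mean of \<open>d\<close> times the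
  mean of the weight \<open>U\<close>. It suffices that one factor shrinks by more than the other
  grows.

  The threshold \<open>4 * K / \<gamma>\<close> leaves room for crude drift constants: in units of
  \<open>\<beta> * K / \<gamma>\<close>, a pair at the threshold exceeds weight 1 by 4, and after
  time \<open>T\<close> by at most \<open>4 / 8 + 2 * 5 / 4 = 3\<close>.\<close>

text \<open>Induction on the constraints. If the constraint \<open>m\<close> cannot be dropped, some
  \<open>x\<close> satisfies all others and has positive \<open>b\<close>-value, so
  \<open>a m\<close> is positive on \<open>x\<close>; projecting along \<open>x\<close> onto the
  kernel of \<open>a m\<close> leaves an instance without \<open>m\<close>. No closedness of cones
  is invoked.\<close>

lemma farkas:
  fixes a :: "'i \<Rightarrow> 'j \<Rightarrow> real" and b :: "'j \<Rightarrow> real"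
  assumes "finite I" and J: "finite J"
    and "\<And>x. (\<And>i. i \<in> I \<Longrightarrow> (\<Sum>j\<in>J. a i j * x j) \<le> 0) \<Longrightarrow> (\<Sum>j\<in>J. b j * x j) \<le> 0"
  shows "\<exists>l. (\<forall>i\<in>I. 0 \<le> l i) \<and> (\<forall>j\<in>J. b j = (\<Sum>i\<in>I. l i * a i j))"
  using assms(1,3)
proof (induction I arbitrary: a b rule: finite_induct)
  case empty
  \<comment> \<open>Without constraints \<open>b\<close> itself is an admissible test point.\<close>
  have "(\<Sum>j\<in>J. b j * b j) \<le> 0"
    using empty by simp
  then have "(\<Sum>j\<in>J. b j * b j) = 0"
    by (simp add: sum_nonneg antisym)
  with J show ?case
    by (simp add: sum_nonneg_eq_0_iff)
next
  case (insert m I)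
  show ?case
  proof (cases "\<forall>x. (\<forall>i\<in>I. (\<Sum>j\<in>J. a i j * x j) \<le> 0) \<longrightarrow> (\<Sum>j\<in>J. b j * x j) \<le> 0")
    case True
    then obtain l where l: "\<forall>i\<in>I. 0 \<le> l i" "\<forall>j\<in>J. b j = (\<Sum>i\<in>I. l i * a i j)"
      using insert.IH[of a b] by blast
    have "(\<Sum>i\<in>I. (l(m := 0)) i * a i j) = (\<Sum>i\<in>I. l i * a i j)" for j
      using insert.hyps by (intro sum.cong) auto
    with l insert.hyps show ?thesis
      by (intro exI[of _ "l(m := 0)"]) auto
  next
    case False
    then obtain x where x: "\<And>i. i \<in> I \<Longrightarrow> (\<Sum>j\<in>J. a i j * x j) \<le> 0" "(\<Sum>j\<in>J. b j * x j) > 0"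
      by force
    define y where "y = (\<Sum>j\<in>J. a m j * x j)"
    have y: "y > 0"
      using insert.prems[of x] x unfolding y_def by force
    define x0 where "x0 j = x j / y" for j
    define A where "A i = (\<Sum>j\<in>J. a i j * x0 j)" for i
    define B where "B = (\<Sum>j\<in>J. b j * x0 j)"
    have A_eq: "A i = (\<Sum>j\<in>J. a i j * x j) / y" for i
      by (simp add: A_def x0_def sum_divide_distrib)
    have A: "A i \<le> 0" if "i \<in> I" for i
      unfolding A_eq using x(1)[OF that] y by (simp add: divide_le_0_iff)
    have Am: "A m = 1"
      unfolding A_eq using y by (simp add: y_def)
    have B: "B > 0"
      using x(2) y by (simp add: B_def x0_def flip: sum_divide_distrib)
    \<comment> \<open>The projection \<open>z - (a m z) x0\<close> acts on points and its adjoint on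
      functionals; this identity passes from one form to the other.\<close>
    have red: "(\<Sum>j\<in>J. (c j - a m j * (\<Sum>j\<in>J. c j * x0 j)) * z j)
        = (\<Sum>j\<in>J. c j * (z j - (\<Sum>j\<in>J. a m j * z j) * x0 j))" for c z
    proof -
      have "(\<Sum>j\<in>J. a m j * (\<Sum>j\<in>J. c j * x0 j) * z j) = (\<Sum>j\<in>J. c j * ((\<Sum>j\<in>J. a m j * z j) * x0 j))"
        unfolding sum_distrib_left sum_distrib_right by (subst sum.swap) (simp add: mult_ac)
      then show ?thesis
        by (simp add: left_diff_distrib right_diff_distrib sum_subtractf)
    qed
    have "\<exists>l. (\<forall>i\<in>I. 0 \<le> l i) \<and> (\<forall>j\<in>J. b j - a m j * B = (\<Sum>i\<in>I. l i * (a i j - a m j * A i)))"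
    proof (rule insert.IH)
      fix z assume z: "\<And>i. i \<in> I \<Longrightarrow> (\<Sum>j\<in>J. (a i j - a m j * A i) * z j) \<le> 0"
      define z0 where "z0 = (\<Sum>j\<in>J. a m j * z j)"
      define z' where "z' j = z j - z0 * x0 j" for j
      have "(\<Sum>j\<in>J. a m j * z' j) = z0 - z0 * A m"
        by (simp add: z'_def A_def right_diff_distrib sum_subtractf sum_distrib_left mult.left_commute flip: z0_def)
      then have "(\<Sum>j\<in>J. a m j * z' j) = 0"
        by (simp add: Am)
      moreover have "(\<Sum>j\<in>J. a i j * z' j) \<le> 0" if "i \<in> I" for i
        using z[OF that] unfolding A_def red z'_def z0_def .
      ultimately have "(\<Sum>j\<in>J. b j * z' j) \<le> 0"
        by (intro insert.prems) auto
      then show "(\<Sum>j\<in>J. (b j - a m j * B) * z j) \<le> 0"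
        unfolding B_def red z'_def z0_def .
    qed
    then obtain l where l: "\<And>i. i \<in> I \<Longrightarrow> 0 \<le> l i"
      "\<And>j. j \<in> J \<Longrightarrow> b j - a m j * B = (\<Sum>i\<in>I. l i * (a i j - a m j * A i))"
      by blast
    \<comment> \<open>The coefficient of \<open>a m\<close> left over when the reduced identity is
      expanded. It is nonnegative because every \<open>A i \<le> 0\<close> and
      \<open>B > 0\<close>.\<close>
    define l' where "l' = l(m := B - (\<Sum>i\<in>I. l i * A i))"
    have "0 \<le> - (\<Sum>i\<in>I. l i * A i)"
      using l(1) A by (simp add: sum_nonpos mult_nonneg_nonpos)
    then have "0 \<le> l' i" if "i \<in> insert m I" for i
      using that l(1) B by (auto simp: l'_def)
    moreover have "b j = (\<Sum>i\<in>insert m I. l' i * a i j)" if "j \<in> J" for j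
    proof -
      have "(\<Sum>i\<in>I. l' i * a i j) = (\<Sum>i\<in>I. l i * a i j)"
        using insert.hyps by (intro sum.cong) (auto simp: l'_def)
      then have "(\<Sum>i\<in>insert m I. l' i * a i j) = (B - (\<Sum>i\<in>I. l i * A i)) * a m j + (\<Sum>i\<in>I. l i * a i j)"
        using insert.hyps by (simp add: l'_def)
      moreover have "b j = a m j * B + (\<Sum>i\<in>I. l i * a i j) - a m j * (\<Sum>i\<in>I. l i * A i)"
        using l(2)[OF that] by (simp add: algebra_simps sum_subtractf sum_distrib_left)
      ultimately show ?thesis
        by (simp add: algebra_simps)
    qed
    ultimately show ?thesis by blast
  qed
qed

text \<open>Existence of the plan is the solvable side of \<open>farkas\<close>. An obstruction
  would be a pair of potentials together with a price for the cost; the pair collapses to the single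
  Lipschitz potential of \<open>dual\<close> because \<open>c\<close> vanishes on the diagonal and
  satisfies the triangle inequality.\<close>

lemma finite_kantorovich:
  fixes c :: "'i \<Rightarrow> 'i \<Rightarrow> real"
  assumes I: "finite I" "I \<noteq> {}"
    and c0: "\<And>i. i \<in> I \<Longrightarrow> c i i = 0"
    and ctri: "\<And>i j k. i \<in> I \<Longrightarrow> j \<in> I \<Longrightarrow> k \<in> I \<Longrightarrow> c i k \<le> c i j + c j k"
    and p: "\<And>i. i \<in> I \<Longrightarrow> 0 \<le> p i" and q: "\<And>i. i \<in> I \<Longrightarrow> 0 \<le> q i"
    and pq: "sum p I = sum q I"
    and dual: "\<And>f. (\<And>i j. i \<in> I \<Longrightarrow> j \<in> I \<Longrightarrow> f i - f j \<le> c i j) \<Longrightarrow> (\<Sum>i\<in>I. f i * (p i - q i)) \<le> C"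
  obtains l where "\<And>i j. i \<in> I \<Longrightarrow> j \<in> I \<Longrightarrow> 0 \<le> l i j"
    and "\<And>i. i \<in> I \<Longrightarrow> (\<Sum>j\<in>I. l i j) = p i" and "\<And>j. j \<in> I \<Longrightarrow> (\<Sum>i\<in>I. l i j) = q j"
    and "(\<Sum>i\<in>I. \<Sum>j\<in>I. l i j * c i j) \<le> C"
proof -
  \<comment> \<open>Rows \<open>J\<close>: the two marginal constraints and the cost. Columns
    \<open>S\<close>: one for each pair of cells, and \<open>None\<close> for the slack that turns
    the cost equation into an inequality.\<close>
  define J :: "('i + 'i + unit) set" where "J = I <+> I <+> {()}"
  define a :: "('i \<times> 'i) option \<Rightarrow> ('i + 'i + unit) \<Rightarrow> real" where
    "a s = (case s of None \<Rightarrow> (\<lambda>t. case t of Inr (Inr _) \<Rightarrow> -1 | _ \<Rightarrow> 0)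
      | Some (i, j) \<Rightarrow> (\<lambda>t. case t of Inl i' \<Rightarrow> if i' = i then 1 else 0
          | Inr (Inl j') \<Rightarrow> if j' = j then 1 else 0 | Inr (Inr _) \<Rightarrow> - c i j))" for s
  define b :: "('i + 'i + unit) \<Rightarrow> real" where
    "b t = (case t of Inl i \<Rightarrow> p i | Inr (Inl j) \<Rightarrow> q j | Inr (Inr _) \<Rightarrow> - C)" for t
  define S where "S = insert None (Some ` (I \<times> I))"
  have sumJ: "(\<Sum>t\<in>J. g t) = (\<Sum>i\<in>I. g (Inl i)) + (\<Sum>i\<in>I. g (Inr (Inl i))) + g (Inr (Inr ()))"
    for g :: "_ \<Rightarrow> real"
    using I by (simp add: J_def sum.Plus)
  have "\<exists>l. (\<forall>s\<in>S. 0 \<le> l s) \<and> (\<forall>t\<in>J. b t = (\<Sum>s\<in>S. l s * a s t))"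
  proof (rule farkas)
    show "finite S" "finite J"
      using I by (auto simp: S_def J_def)
    fix x assume x: "\<And>s. s \<in> S \<Longrightarrow> (\<Sum>t\<in>J. a s t * x t) \<le> 0"
    define f where "f i = x (Inl i)" for i
    define g where "g i = x (Inr (Inl i))" for i
    define s where "s = x (Inr (Inr ()))"
    have s: "s \<ge> 0"
      using x[of None] by (simp add: S_def a_def sumJ s_def)
    have fg: "f i + g j \<le> s * c i j" if "i \<in> I" "j \<in> I" for i j
      using x[of "Some (i, j)"] that I
      by (simp add: S_def a_def sumJ s_def f_def g_def if_distrib[of "\<lambda>z. z * _"] mult.commute[of "x (Inr (Inr ()))"] cong: if_cong)
    \<comment> \<open>The \<open>c\<close>-transform of \<open>g\<close>: the largest function with
      \<open>F i + g j \<le> s * c i j\<close>. It therefore dominates \<open>f\<close>, and its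
      negative dominates \<open>g\<close>.\<close>
    define F where "F i = Min ((\<lambda>j. s * c i j - g j) ` I)" for i
    have F_le: "F i \<le> s * c i j - g j" if "j \<in> I" for i j
      unfolding F_def using that I by (intro Min_le) auto
    have F_ex: "\<exists>j\<in>I. F i = s * c i j - g j" for i
      using I Min_in[of "(\<lambda>j. s * c i j - g j) ` I"] unfolding F_def[symmetric] by auto
    have fF: "f i \<le> F i" if i: "i \<in> I" for i
      using F_ex[of i] fg[OF i] by force
    have gF: "g i \<le> - F i" if i: "i \<in> I" for i
      using F_le[OF i, of i] c0[OF i] by simp
    have FF: "F i - F j \<le> s * c i j" if ij: "i \<in> I" "j \<in> I" for i j
    proof -
      obtain k where k: "k \<in> I" "F j = s * c j k - g k"
        using F_ex by blast
      have "F i \<le> s * c i k - g k"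
        by (rule F_le) fact
      also have "\<dots> \<le> s * (c i j + c j k) - g k"
        using ctri[of i j k] ij k s by (intro diff_right_mono mult_left_mono) auto
      finally show ?thesis
        using k by (simp add: algebra_simps)
    qed
    have "(\<Sum>i\<in>I. F i * (p i - q i)) \<le> C * s"
    \<comment> \<open>At price 0 the potential is constant and equal total masses make the sum
      vanish; otherwise \<open>F / s\<close> is admissible in \<open>dual\<close>.\<close>
    proof (cases "s = 0")
      case True
      obtain i0 where i0: "i0 \<in> I" using I by blast
      have "F i = F i0" if "i \<in> I" for i
        using FF[OF that i0] FF[OF i0 that] True by simp
      then have "(\<Sum>i\<in>I. F i * (p i - q i)) = (\<Sum>i\<in>I. F i0 * (p i - q i))"
        by (intro sum.cong) auto
      also have "\<dots> = 0"
        using pq by (simp add: sum_subtractf flip: sum_distrib_left)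
      finally show ?thesis using True by simp
    next
      case False
      with s have s: "s > 0" by simp
      have "(\<Sum>i\<in>I. F i / s * (p i - q i)) \<le> C"
        using FF s by (intro dual) (simp add: field_simps)
      then have "(\<Sum>i\<in>I. F i * (p i - q i)) / s \<le> C"
        by (simp add: sum_divide_distrib)
      with s show ?thesis
        by (simp add: field_simps)
    qed
    moreover have "(\<Sum>i\<in>I. p i * f i) + (\<Sum>i\<in>I. q i * g i) \<le> (\<Sum>i\<in>I. p i * F i) + (\<Sum>i\<in>I. q i * - F i)"
      by (intro add_mono sum_mono mult_left_mono fF gF p q)
    ultimately show "(\<Sum>t\<in>J. b t * x t) \<le> 0"
      by (simp add: sumJ b_def sum_negf algebra_simps sum_subtractf f_def[symmetric] g_def[symmetric] s_def[symmetric])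
  qed
  then obtain l where l: "\<And>s. s \<in> S \<Longrightarrow> 0 \<le> l s" "\<And>t. t \<in> J \<Longrightarrow> b t = (\<Sum>s\<in>S. l s * a s t)"
    by blast
  have sumS: "(\<Sum>s\<in>S. g s) = g None + (\<Sum>i\<in>I. \<Sum>j\<in>I. g (Some (i, j)))" for g :: "_ \<Rightarrow> real"
    using I by (simp add: S_def sum.reindex sum.cartesian_product)
  show ?thesis
  proof (rule that[of "\<lambda>i j. l (Some (i, j))"])
    show "0 \<le> l (Some (i, j))" if "i \<in> I" "j \<in> I" for i j
      using that l(1) by (auto simp: S_def)
    show "(\<Sum>j\<in>I. l (Some (i, j))) = p i" if "i \<in> I" for i
    proof -
      have "p i = (\<Sum>i'\<in>I. \<Sum>j\<in>I. l (Some (i', j)) * (if i = i' then 1 else 0))"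
        using l(2)[of "Inl i"] that by (simp add: J_def InlI b_def sumS a_def)
      also have "\<dots> = (\<Sum>j\<in>I. \<Sum>i'\<in>I. if i = i' then l (Some (i', j)) else 0)"
        by (subst sum.swap) (auto intro!: sum.cong)
      finally show ?thesis
        using that I by simp
    qed
    show "(\<Sum>i\<in>I. l (Some (i, j))) = q j" if "j \<in> I" for j
    proof -
      have "q j = (\<Sum>i\<in>I. \<Sum>j'\<in>I. l (Some (i, j')) * (if j = j' then 1 else 0))"
        using l(2)[of "Inr (Inl j)"] that by (simp add: J_def InlI InrI b_def sumS a_def)
      also have "\<dots> = (\<Sum>i\<in>I. \<Sum>j'\<in>I. if j = j' then l (Some (i, j')) else 0)"
        by (auto intro!: sum.cong)
      finally show ?thesis
        using that I by simp
    qed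
    show "(\<Sum>i\<in>I. \<Sum>j\<in>I. l (Some (i, j)) * c i j) \<le> C"
    proof -
      \<comment> \<open>The slack multiplier equals \<open>C\<close> minus the cost of the
        plan.\<close>
      have "None \<in> S" by (simp add: S_def)
      from l(1)[OF this] show ?thesis
        using l(2)[of "Inr (Inr ())"] by (simp add: J_def InrI b_def sumS a_def sum_negf)
    qed
  qed
qed

section \<open>Kantorovich-Rubinstein duality\<close>

abbreviation (input) bdist :: "'a::metric_space \<Rightarrow> 'a \<Rightarrow> real" where
  "bdist x y \<equiv> min (dist x y) 1"

lemma bdist_triangle: "bdist x z \<le> bdist x y + bdist y z"
  using dist_triangle[of x z y] zero_le_dist[of x y] zero_le_dist[of y z] by linarith

text \<open>Such functions are 1-Lipschitz and oscillate by at most 1; they are the test functions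
  dual to the truncated metric as a cost.\<close>

definition bdist_lipschitz :: "('a::metric_space \<Rightarrow> real) \<Rightarrow> bool" where
  "bdist_lipschitz f \<longleftrightarrow> (\<forall>x y. \<bar>f x - f y\<bar> \<le> bdist x y)"

lemma bdist_lipschitz_continuous:
  assumes "bdist_lipschitz f"
  shows "continuous_on UNIV f"
proof -
  have "dist (f x) (f y) \<le> 1 * dist x y" for x y
    using assms[unfolded bdist_lipschitz_def, rule_format, of x y] by (simp add: dist_real_def)
  then have "1-lipschitz_on UNIV f"
    by (intro lipschitz_onI) auto
  then show ?thesis
    by (rule lipschitz_on_continuous_on)
qed

text \<open>The oscillation is at most 1; \<open>undefined\<close> serves as an arbitrary base
  point.\<close>

lemma bdist_lipschitz_bounded:
  assumes "bdist_lipschitz f"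
  shows "\<bar>f x\<bar> \<le> \<bar>f undefined\<bar> + 1"
  using assms[unfolded bdist_lipschitz_def, rule_format, of x undefined] by linarith

lemma bdist_lipschitz_measurable:
  "bdist_lipschitz f \<Longrightarrow> f \<in> borel_measurable borel"
  by (intro borel_measurable_continuous_onI bdist_lipschitz_continuous)

section \<open>Discretization by finite measurable partitions\<close>

lemma integrable_bounded_borel:
  fixes f :: "'a::topological_space \<Rightarrow> real"
  assumes "prob_space M" "sets M = sets borel" "f \<in> borel_measurable borel" "\<And>x. \<bar>f x\<bar> \<le> B"
  shows "integrable M f"
proof -
  interpret prob_space M by fact
  have [measurable]: "f \<in> borel_measurable M"
    using assms(2,3) by (simp cong: measurable_cong_sets)
  show ?thesis
    by (rule integrable_const_bound[of _ B]) (use assms(4) in auto)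
qed

lemma nn_integral_finite_index:
  assumes [measurable]: "\<iota> \<in> measurable M (count_space UNIV)"
    and I: "finite I" "\<And>x. x \<in> space M \<Longrightarrow> \<iota> x \<in> I"
  shows "(\<integral>\<^sup>+x. g (\<iota> x) \<partial>M) = (\<Sum>i\<in>I. g i * emeasure M {x\<in>space M. \<iota> x = i})"
proof -
  have "(\<integral>\<^sup>+x. g (\<iota> x) \<partial>M) = (\<integral>\<^sup>+x. (\<Sum>i\<in>I. g i * indicator {x\<in>space M. \<iota> x = i} x) \<partial>M)"
    using I by (intro nn_integral_cong) (simp add: indicator_def if_distrib sum.delta' cong: if_cong)
  also have "\<dots> = (\<Sum>i\<in>I. g i * emeasure M {x\<in>space M. \<iota> x = i})"
    by (subst nn_integral_sum) (auto intro!: sum.cong nn_integral_cmult_indicator)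
  finally show ?thesis .
qed

lemma integral_finite_index:
  fixes g :: "_ \<Rightarrow> real"
  assumes "finite_measure M" and [measurable]: "\<iota> \<in> measurable M (count_space UNIV)"
    and I: "finite I" "\<And>x. x \<in> space M \<Longrightarrow> \<iota> x \<in> I"
  shows "(\<integral>x. g (\<iota> x) \<partial>M) = (\<Sum>i\<in>I. g i * measure M {x\<in>space M. \<iota> x = i})"
proof -
  interpret finite_measure M by fact
  have "(\<integral>x. g (\<iota> x) \<partial>M) = (\<integral>x. (\<Sum>i\<in>I. g i * indicator {x\<in>space M. \<iota> x = i} x) \<partial>M)"
    using I by (intro Bochner_Integration.integral_cong) (simp_all add: indicator_def if_distrib sum.delta' cong: if_cong)
  also have "\<dots> = (\<Sum>i\<in>I. g i * measure M {x\<in>space M. \<iota> x = i})"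
  proof (subst Bochner_Integration.integral_sum)
    have "{x\<in>space M. \<iota> x = i} \<inter> space M = {x\<in>space M. \<iota> x = i}" for i
      by auto
    then show "(\<Sum>i\<in>I. \<integral>x. g i * indicator {x\<in>space M. \<iota> x = i} x \<partial>M) = (\<Sum>i\<in>I. g i * measure M {x\<in>space M. \<iota> x = i})"
      by simp
  qed (auto intro!: integrable_mult_right integrable_real_indicator simp: emeasure_eq_measure)
  finally show ?thesis .
qed

text \<open>Separability supplies countably many balls of radius \<open>e / 2\<close> covering the
  space; each point is sent to the first ball containing it.\<close>

lemma small_diameter_index:
  fixes e :: real
  assumes "e > 0"
  obtains \<iota> :: "'a::{metric_space, second_countable_topology} \<Rightarrow> nat"
  where "\<iota> \<in> measurable borel (count_space UNIV)" "\<And>x y. \<iota> x = \<iota> y \<Longrightarrow> dist x y \<le> e"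
proof -
  obtain D :: "'a set" where D: "countable D" "\<And>X. open X \<Longrightarrow> X \<noteq> {} \<Longrightarrow> \<exists>d\<in>D. d \<in> X"
    using countable_dense_setE by blast
  have "D \<noteq> {}"
    using D(2)[of UNIV] by auto
  define d where "d = from_nat_into D"
  define \<iota> where "\<iota> x = (LEAST n. dist x (d n) < e / 2)" for x
  have ex: "\<exists>n. dist x (d n) < e / 2" for x
  proof -
    obtain z where z: "z \<in> D" "z \<in> ball x (e / 2)"
      using D(2)[of "ball x (e / 2)"] assms by auto
    moreover obtain n where "z = d n"
      using z(1) D(1) \<open>D \<noteq> {}\<close> by (metis d_def from_nat_into_surj)
    ultimately show ?thesis by auto
  qed
  have \<iota>: "dist x (d (\<iota> x)) < e / 2" for x
    unfolding \<iota>_def by (rule LeastI_ex[OF ex])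
  show ?thesis
  proof
    show "\<iota> \<in> measurable borel (count_space UNIV)"
      unfolding \<iota>_def by measurable
    show "dist x y \<le> e" if "\<iota> x = \<iota> y" for x y
      using \<iota>[of x] \<iota>[of y] that dist_triangle2[of x y "d (\<iota> x)"] by simp
  qed
qed

text \<open>Only densities with respect to the product measure are needed: they arise by spreading a
  coupling of the cell weights of a fine finite partition uniformly over the cells.\<close>
lemma kantorovich_rubinstein_density:
  fixes \<mu> \<nu> :: "'a::{metric_space, second_countable_topology} measure"
  assumes \<mu>: "prob_space \<mu>" "sets \<mu> = sets borel" and \<nu>: "prob_space \<nu>" "sets \<nu> = sets borel"
    and dual: "\<And>f. bdist_lipschitz f \<Longrightarrow> (\<integral>x. f x \<partial>\<mu>) - (\<integral>x. f x \<partial>\<nu>) \<le> c"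
    and e: "e > 0"
  obtains k :: "'a \<Rightarrow> 'a \<Rightarrow> ennreal"
  where "case_prod k \<in> borel_measurable (borel \<Otimes>\<^sub>M borel)"
    and "\<And>x. (\<integral>\<^sup>+y. k x y \<partial>\<nu>) = 1" and "AE y in \<nu>. (\<integral>\<^sup>+x. k x y \<partial>\<mu>) = 1"
    and "(\<integral>\<^sup>+x. \<integral>\<^sup>+y. k x y * ennreal (bdist x y) \<partial>\<nu> \<partial>\<mu>) \<le> ennreal (c + e)"
proof -
  interpret \<mu>: prob_space \<mu> by fact
  interpret \<nu>: prob_space \<nu> by fact
  interpret \<mu>\<nu>: pair_sigma_finite \<mu> \<nu> ..
  note [measurable_cong] = \<mu>(2) \<nu>(2)
  have [simp]: "space \<mu> = UNIV" "space \<nu> = UNIV"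
    using \<mu>(2) \<nu>(2) by (auto dest: sets_eq_imp_space_eq)
  have c: "c \<ge> 0"
    using dual[of "\<lambda>_. 0"] by (simp add: bdist_lipschitz_def)
  \<comment> \<open>Budget: \<open>4 * e'\<close> is lost in the finite dual problem and
    \<open>2 * e'\<close> for each marginal when representatives are replaced by points,
    \<open>8 * e'\<close> in all.\<close>
  define e' where "e' = e / 8"
  have e': "e' > 0" using e by (simp add: e'_def)
  obtain \<iota>0 :: "'a \<Rightarrow> nat" where [measurable]: "\<iota>0 \<in> measurable borel (count_space UNIV)"
    and \<iota>0: "\<And>x y. \<iota>0 x = \<iota>0 y \<Longrightarrow> dist x y \<le> e'"
    using small_diameter_index[OF e'] by blast
  have tail: "\<forall>\<^sub>F n in sequentially. measure M {x. n \<le> \<iota>0 x} < e'"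
    if "prob_space M" "sets M = sets borel" for M :: "'a measure"
  proof -
    interpret prob_space M by fact
    note [measurable_cong] = that(2)
    have [simp]: "space M = UNIV" using that(2) by (auto dest: sets_eq_imp_space_eq)
    have sets: "{x. n \<le> \<iota>0 x} \<in> sets M" for n
    proof -
      have "{x\<in>space M. n \<le> \<iota>0 x} \<in> sets M" by measurable
      then show ?thesis by simp
    qed
    have "(\<lambda>n. measure M {x. n \<le> \<iota>0 x}) \<longlonglongrightarrow> measure M (\<Inter>n. {x. n \<le> \<iota>0 x})"
      by (rule finite_Lim_measure_decseq) (auto simp: sets decseq_def)
    also have "(\<Inter>n. {x. n \<le> \<iota>0 x}) = {}"
      by auto (meson Suc_n_not_le_n)
    finally show ?thesis
      using e' by (simp add: order_tendstoD)
  qed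
  obtain n where n: "measure \<mu> {x. n \<le> \<iota>0 x} < e'" "measure \<nu> {x. n \<le> \<iota>0 x} < e'"
    using eventually_conj[OF tail[OF \<mu>] tail[OF \<nu>]] by (auto simp: eventually_sequentially)
  \<comment> \<open>All cells from index \<open>n\<close> on are merged into one. It may have large
    diameter, but both measures give it mass below \<open>e'\<close>.\<close>
  define \<iota> where "\<iota> x = min (\<iota>0 x) n" for x
  have [measurable]: "\<iota> \<in> measurable borel (count_space UNIV)"
    unfolding \<iota>_def by measurable
  have \<iota>: "\<iota> x \<in> {..n}" for x
    by (simp add: \<iota>_def)
  \<comment> \<open>A representative of each cell. For an empty cell it is an arbitrary point, which
    is harmless because the cell has weight 0.\<close>
  define a where "a i = (SOME x. \<iota> x = i)" for i
  have a: "\<iota> (a (\<iota> x)) = \<iota> x" for x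
    unfolding a_def by (rule someI) (rule refl)
  define err where "err x = bdist x (a (\<iota> x))" for x
  have [measurable]: "err \<in> borel_measurable borel"
  proof -
    have [measurable]: "a \<in> measurable (count_space UNIV) borel" by simp
    show ?thesis unfolding err_def by measurable
  qed
  have err_le: "err x \<le> e' + indicator {x. n \<le> \<iota>0 x} x" for x
  proof (cases "n \<le> \<iota>0 x")
    case False
    then have "\<iota>0 (a (\<iota> x)) = \<iota>0 x"
      using a[of x] by (auto simp: \<iota>_def min_def split: if_splits)
    then show ?thesis
      using \<iota>0[of x "a (\<iota> x)"] False by (simp add: err_def min.coboundedI1)
  qed (use e' in \<open>auto simp: err_def\<close>)
  have err01: "0 \<le> err x" "err x \<le> 1" for x
    by (auto simp: err_def)
  have err: "integrable M err" "(\<integral>x. err x \<partial>M) \<le> 2 * e'"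
    if M: "prob_space M" "sets M = sets borel" "measure M {x. n \<le> \<iota>0 x} < e'" for M
  proof -
    interpret prob_space M by fact
    note [measurable_cong] = M(2)
    show *: "integrable M err"
      using M by (intro integrable_bounded_borel[of _ _ 1]) (use err01 in \<open>auto simp: abs_le_iff intro: order_trans[of _ 0]\<close>)
    have sp: "space M = UNIV" using M(2) by (auto dest: sets_eq_imp_space_eq)
    have "{x\<in>space M. n \<le> \<iota>0 x} \<in> sets M" by measurable
    then have S: "{x. n \<le> \<iota>0 x} \<in> sets M" by (simp add: sp)
    have "(\<integral>x. err x \<partial>M) \<le> (\<integral>x. e' + indicator {x. n \<le> \<iota>0 x} x \<partial>M)"
      using S by (intro integral_mono * Bochner_Integration.integrable_add integrable_real_indicator err_le)
        (auto simp: emeasure_eq_measure)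
    also have "\<dots> = e' + measure M {x. n \<le> \<iota>0 x}"
      using S by (subst Bochner_Integration.integral_add) (auto simp: prob_space[unfolded sp] emeasure_eq_measure sp intro!: integrable_real_indicator)
    finally show "(\<integral>x. err x \<partial>M) \<le> 2 * e'"
      using M(3) by simp
  qed
  define p where "p i = measure \<mu> {x. \<iota> x = i}" for i
  define q where "q i = measure \<nu> {x. \<iota> x = i}" for i
  have p: "(\<integral>x. g (\<iota> x) \<partial>\<mu>) = (\<Sum>i\<le>n. g i * p i)" for g :: "nat \<Rightarrow> real"
    using \<iota> by (subst integral_finite_index[where I="{..n}"]) (auto simp: p_def \<mu>.finite_measure_axioms)
  have q: "(\<integral>x. g (\<iota> x) \<partial>\<nu>) = (\<Sum>i\<le>n. g i * q i)" for g :: "nat \<Rightarrow> real"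
    using \<iota> by (subst integral_finite_index[where I="{..n}"]) (auto simp: q_def \<nu>.finite_measure_axioms)
  have pn: "(\<integral>\<^sup>+x. g (\<iota> x) \<partial>\<mu>) = (\<Sum>i\<le>n. g i * ennreal (p i))" for g
    using \<iota> by (subst nn_integral_finite_index[where I="{..n}"]) (auto simp: p_def \<mu>.emeasure_eq_measure)
  have qn: "(\<integral>\<^sup>+x. g (\<iota> x) \<partial>\<nu>) = (\<Sum>i\<le>n. g i * ennreal (q i))" for g
    using \<iota> by (subst nn_integral_finite_index[where I="{..n}"]) (auto simp: q_def \<nu>.emeasure_eq_measure)
  have p1: "(\<Sum>i\<le>n. p i) = 1" and q1: "(\<Sum>i\<le>n. q i) = 1"
    using p[of "\<lambda>_. 1"] q[of "\<lambda>_. 1"] \<mu>.prob_space \<nu>.prob_space by simp_all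
  have p0: "0 \<le> p i" and q0: "0 \<le> q i" for i
    by (simp_all add: p_def q_def)
  obtain l where l: "\<And>i j. i \<in> {..n} \<Longrightarrow> j \<in> {..n} \<Longrightarrow> 0 \<le> l i j"
    and lp: "\<And>i. i \<in> {..n} \<Longrightarrow> (\<Sum>j\<le>n. l i j) = p i" and lq: "\<And>j. j \<in> {..n} \<Longrightarrow> (\<Sum>i\<le>n. l i j) = q j"
    and lc: "(\<Sum>i\<le>n. \<Sum>j\<le>n. l i j * bdist (a i) (a j)) \<le> c + 4 * e'"
  proof (rule finite_kantorovich[of "{..n}" "\<lambda>i j. bdist (a i) (a j)" p q "c + 4 * e'"])
    show "bdist (a i) (a k) \<le> bdist (a i) (a j) + bdist (a j) (a k)" for i j k
      by (rule bdist_triangle)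
    fix f :: "nat \<Rightarrow> real" assume f: "\<And>i j. i \<in> {..n} \<Longrightarrow> j \<in> {..n} \<Longrightarrow> f i - f j \<le> bdist (a i) (a j)"
    \<comment> \<open>McShane extension of \<open>f\<close> from the representatives to the whole
      space; it agrees with \<open>f (\<iota> x)\<close> up to \<open>err x\<close>.\<close>
    define F where "F x = Min ((\<lambda>j. f j + bdist x (a j)) ` {..n})" for x
    have F_le: "F x \<le> f j + bdist x (a j)" if "j \<in> {..n}" for x j
      unfolding F_def using that by (intro Min_le) auto
    have F_ex: "\<exists>j\<in>{..n}. F x = f j + bdist x (a j)" for x
      using Min_in[of "(\<lambda>j. f j + bdist x (a j)) ` {..n}"] unfolding F_def[symmetric] by auto
    have FF: "F x - F y \<le> bdist x y" for x y
    proof -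
      obtain j where "j \<in> {..n}" "F y = f j + bdist y (a j)"
        using F_ex by blast
      then show ?thesis
        using F_le[of j x] bdist_triangle[of x "a j" y] by linarith
    qed
    have lipF: "bdist_lipschitz F"
      unfolding bdist_lipschitz_def
    proof (intro allI)
      fix x y show "\<bar>F x - F y\<bar> \<le> bdist x y"
        using FF[of x y] FF[of y x] by (simp add: abs_le_iff dist_commute)
    qed
    have Fa: "f i \<le> F (a i)" if "i \<in> {..n}" for i
    proof -
      obtain j where "j \<in> {..n}" "F (a i) = f j + bdist (a i) (a j)"
        using F_ex by blast
      then show ?thesis using f[OF that, of j] by linarith
    qed
    have F1: "f (\<iota> x) \<le> F x + err x" for x
      using Fa[OF \<iota>, of x] FF[of "a (\<iota> x)" x] unfolding err_def dist_commute[of x] by linarith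
    have F2: "F x \<le> f (\<iota> x) + err x" for x
      using F_le[OF \<iota>, of x x] by (simp add: err_def)
    have intF: "integrable M F" if "prob_space M" "sets M = sets borel" for M
      by (rule integrable_bounded_borel[OF that bdist_lipschitz_measurable[OF lipF] bdist_lipschitz_bounded[OF lipF]])
    have intf: "integrable M (\<lambda>x. f (\<iota> x))" if "prob_space M" "sets M = sets borel" for M
    proof (rule integrable_bounded_borel[OF that])
      show "\<bar>f (\<iota> x)\<bar> \<le> Max ((\<lambda>i. \<bar>f i\<bar>) ` {..n})" for x
        using \<iota>[of x] by (intro Max_ge) auto
    qed measurable
    have "(\<Sum>i\<le>n. f i * (p i - q i)) = (\<integral>x. f (\<iota> x) \<partial>\<mu>) - (\<integral>x. f (\<iota> x) \<partial>\<nu>)"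
      by (simp add: p q right_diff_distrib sum_subtractf)
    also have "(\<integral>x. f (\<iota> x) \<partial>\<mu>) \<le> (\<integral>x. F x + err x \<partial>\<mu>)"
      using \<mu> n by (intro integral_mono F1 Bochner_Integration.integrable_add intF intf err)
    also have "\<dots> = (\<integral>x. F x \<partial>\<mu>) + (\<integral>x. err x \<partial>\<mu>)"
      using \<mu> n by (intro Bochner_Integration.integral_add intF err)
    also have "(\<integral>x. err x \<partial>\<mu>) \<le> 2 * e'"
      using \<mu> n by (intro err)
    finally have 1: "(\<Sum>i\<le>n. f i * (p i - q i)) \<le> (\<integral>x. F x \<partial>\<mu>) + 2 * e' - (\<integral>x. f (\<iota> x) \<partial>\<nu>)"
      by simp
    have "(\<integral>x. F x \<partial>\<nu>) \<le> (\<integral>x. f (\<iota> x) + err x \<partial>\<nu>)"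
      using \<nu> n by (intro integral_mono F2 Bochner_Integration.integrable_add intF intf err)
    also have "\<dots> = (\<integral>x. f (\<iota> x) \<partial>\<nu>) + (\<integral>x. err x \<partial>\<nu>)"
      using \<nu> n by (intro Bochner_Integration.integral_add intf err)
    also have "(\<integral>x. err x \<partial>\<nu>) \<le> 2 * e'"
      using \<nu> n by (intro err)
    finally show "(\<Sum>i\<in>{..n}. f i * (p i - q i)) \<le> c + 4 * e'"
      using 1 dual[OF lipF] by simp
  qed (auto simp: p0 q0 p1 q1)
  have lq0: "l i j = 0" if "i \<in> {..n}" "j \<in> {..n}" "q j = 0" for i j
    using lq[OF that(2)] that l[of _ j] sum_nonneg_eq_0_iff[of "{..n}" "\<lambda>i. l i j"] by auto
  have lp0: "l i j = 0" if "i \<in> {..n}" "j \<in> {..n}" "p i = 0" for i j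
    using lp[OF that(1)] that l[of i] sum_nonneg_eq_0_iff[of "{..n}" "\<lambda>j. l i j"] by auto
  \<comment> \<open>Density of the spread plan with respect to the product measure. The value 1 on
    cells null for \<open>\<mu>\<close> makes every row integrate to 1, as a Markov kernel requires.
    Columns are normalized only almost everywhere: a column null for \<open>\<nu>\<close> integrates
    to 0.\<close>
  define kk where "kk i j = (if p i = 0 then 1 else l i j / (p i * q j))" for i j
  define k where "k x y = ennreal (kk (\<iota> x) (\<iota> y))" for x y
  have kk0: "0 \<le> kk i j" if "i \<in> {..n}" "j \<in> {..n}" for i j
    using l[OF that] p0[of i] q0[of j] by (simp add: kk_def)
  have kkq: "kk i j * q j = l i j / p i" if "i \<in> {..n}" "j \<in> {..n}" "p i \<noteq> 0" for i j
    using lq0[OF that(1,2)] that(3) by (auto simp: kk_def)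
  have kkpq: "kk i j * q j * p i = l i j" if "i \<in> {..n}" "j \<in> {..n}" for i j
    using lp0[OF that] kkq[OF that] by (cases "p i = 0") auto
  have k_meas: "case_prod k \<in> borel_measurable (borel \<Otimes>\<^sub>M borel)"
    unfolding k_def by measurable
  then have [measurable]: "(\<lambda>x. k (f x) (g x)) \<in> borel_measurable N"
    if [measurable]: "f \<in> measurable N borel" "g \<in> measurable N borel" for f g and N :: "'z measure"
    using measurable_compose[OF measurable_Pair[OF that] k_meas] by simp
  have kx: "(\<integral>\<^sup>+y. k x y \<partial>\<nu>) = 1" for x
  proof -
    have "(\<integral>\<^sup>+y. k x y \<partial>\<nu>) = (\<Sum>j\<le>n. ennreal (kk (\<iota> x) j) * ennreal (q j))"
      unfolding k_def by (rule qn)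
    also have "\<dots> = ennreal (\<Sum>j\<le>n. kk (\<iota> x) j * q j)"
      using kk0[OF \<iota>] q0 by (subst sum_ennreal[symmetric]) (auto intro!: sum.cong simp: ennreal_mult)
    also have "(\<Sum>j\<le>n. kk (\<iota> x) j * q j) = 1"
    proof (cases "p (\<iota> x) = 0")
      case True
      then show ?thesis using q1 by (simp add: kk_def)
    next
      case False
      then have "(\<Sum>j\<le>n. kk (\<iota> x) j * q j) = (\<Sum>j\<le>n. l (\<iota> x) j / p (\<iota> x))"
        using \<iota> by (intro sum.cong kkq) auto
      also have "\<dots> = 1"
        using False lp[OF \<iota>, of x] by (simp flip: sum_divide_distrib)
      finally show ?thesis .
    qed
    finally show ?thesis by simp
  qed
  have "AE y in \<nu>. q (\<iota> y) \<noteq> 0"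
  proof -
    have "(\<integral>\<^sup>+y. (if q (\<iota> y) = 0 then 1 else 0) \<partial>\<nu>) = (\<Sum>j\<le>n. (if q j = 0 then 1 else 0) * ennreal (q j))"
      by (rule qn)
    also have "\<dots> = 0"
      by (auto intro!: sum.neutral)
    finally have "AE y in \<nu>. (if q (\<iota> y) = 0 then 1 else 0::ennreal) = 0"
      by (subst (asm) nn_integral_0_iff_AE) auto
    then show ?thesis
      by eventually_elim (auto split: if_splits)
  qed
  then have ky: "AE y in \<nu>. (\<integral>\<^sup>+x. k x y \<partial>\<mu>) = 1"
  proof eventually_elim
    case (elim y)
    have "(\<integral>\<^sup>+x. k x y \<partial>\<mu>) = (\<Sum>i\<le>n. ennreal (kk i (\<iota> y)) * ennreal (p i))"
      unfolding k_def by (rule pn)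
    also have "\<dots> = ennreal (\<Sum>i\<le>n. kk i (\<iota> y) * p i)"
      using kk0[OF _ \<iota>] p0 by (subst sum_ennreal[symmetric]) (auto intro!: sum.cong simp: ennreal_mult)
    also have "(\<Sum>i\<le>n. kk i (\<iota> y) * p i) = (\<Sum>i\<le>n. l i (\<iota> y) / q (\<iota> y))"
      using elim kkpq[OF _ \<iota>, of _ y] by (intro sum.cong) (auto simp: field_simps)
    also have "\<dots> = 1"
      using elim lq[OF \<iota>, of y] by (simp flip: sum_divide_distrib)
    finally show ?case by simp
  qed
  have "(\<integral>\<^sup>+x. \<integral>\<^sup>+y. k x y * ennreal (bdist x y) \<partial>\<nu> \<partial>\<mu>)
      \<le> (\<integral>\<^sup>+x. \<integral>\<^sup>+y. (k x y * ennreal (bdist (a (\<iota> x)) (a (\<iota> y))) + ennreal (err x) * k x y) + k x y * ennreal (err y) \<partial>\<nu> \<partial>\<mu>)"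
  \<comment> \<open>The cost is compared with its value at the representatives; the two errors are
    later integrated against the two marginals.\<close>
  proof (intro nn_integral_mono)
    fix x y
    have "bdist x y \<le> bdist (a (\<iota> x)) (a (\<iota> y)) + err x + err y"
      using bdist_triangle[of x y "a (\<iota> x)"] bdist_triangle[of "a (\<iota> x)" y "a (\<iota> y)"]
      by (simp add: err_def dist_commute)
    then have "k x y * ennreal (bdist x y) \<le> k x y * ennreal (bdist (a (\<iota> x)) (a (\<iota> y)) + err x + err y)"
      by (intro mult_left_mono ennreal_leI) auto
    also have "\<dots> = (k x y * ennreal (bdist (a (\<iota> x)) (a (\<iota> y))) + ennreal (err x) * k x y) + k x y * ennreal (err y)"
      using err01 by (simp add: ennreal_plus distrib_left mult.commute)
    finally show "k x y * ennreal (bdist x y) \<le> \<dots>" .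
  qed
  also have "\<dots> = (\<integral>\<^sup>+x. (\<integral>\<^sup>+y. k x y * ennreal (bdist (a (\<iota> x)) (a (\<iota> y))) \<partial>\<nu>) + ennreal (err x) + (\<integral>\<^sup>+y. k x y * ennreal (err y) \<partial>\<nu>) \<partial>\<mu>)"
  proof -
    have [measurable]: "a \<in> measurable (count_space UNIV) borel" by simp
    show ?thesis
      by (intro nn_integral_cong) (simp add: nn_integral_add nn_integral_cmult kx)
  qed
  also have "\<dots> = (\<integral>\<^sup>+x. \<integral>\<^sup>+y. k x y * ennreal (bdist (a (\<iota> x)) (a (\<iota> y))) \<partial>\<nu> \<partial>\<mu>) + (\<integral>\<^sup>+x. ennreal (err x) \<partial>\<mu>)
      + (\<integral>\<^sup>+x. \<integral>\<^sup>+y. k x y * ennreal (err y) \<partial>\<nu> \<partial>\<mu>)"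
  proof -
    have [measurable]: "a \<in> measurable (count_space UNIV) borel" by simp
    show ?thesis
      by (simp add: nn_integral_add)
  qed
  also have "(\<integral>\<^sup>+x. \<integral>\<^sup>+y. k x y * ennreal (err y) \<partial>\<nu> \<partial>\<mu>) = (\<integral>\<^sup>+y. \<integral>\<^sup>+x. k x y * ennreal (err y) \<partial>\<mu> \<partial>\<nu>)"
    by (intro \<mu>\<nu>.Fubini'[symmetric]) measurable
  also have "\<dots> = (\<integral>\<^sup>+y. (\<integral>\<^sup>+x. k x y \<partial>\<mu>) * ennreal (err y) \<partial>\<nu>)"
    by (intro nn_integral_cong nn_integral_multc) measurable
  also have "\<dots> = (\<integral>\<^sup>+y. ennreal (err y) \<partial>\<nu>)"
    by (intro nn_integral_cong_AE) (use ky in auto)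
  also have "(\<integral>\<^sup>+x. \<integral>\<^sup>+y. k x y * ennreal (bdist (a (\<iota> x)) (a (\<iota> y))) \<partial>\<nu> \<partial>\<mu>)
      = (\<Sum>i\<le>n. (\<Sum>j\<le>n. ennreal (kk i j) * ennreal (bdist (a i) (a j)) * ennreal (q j)) * ennreal (p i))"
    unfolding k_def qn[of "\<lambda>j. ennreal (kk _ j) * ennreal (bdist (a _) (a j))"] by (rule pn)
  also have "\<dots> = ennreal (\<Sum>i\<le>n. \<Sum>j\<le>n. l i j * bdist (a i) (a j))"
  proof -
    have "(\<Sum>j\<le>n. ennreal (kk i j) * ennreal (bdist (a i) (a j)) * ennreal (q j)) * ennreal (p i)
        = ennreal (\<Sum>j\<le>n. l i j * bdist (a i) (a j))" if i: "i \<in> {..n}" for i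
    proof -
      have "ennreal (kk i j) * ennreal (bdist (a i) (a j)) * ennreal (q j) * ennreal (p i)
        = ennreal (l i j * bdist (a i) (a j))" if j: "j \<in> {..n}" for j
      proof -
        have "ennreal (kk i j) * ennreal (bdist (a i) (a j)) * ennreal (q j) * ennreal (p i)
            = ennreal (kk i j * bdist (a i) (a j) * q j * p i)"
          using kk0[OF i j] p0 q0 by (simp add: ennreal_mult)
        also have "kk i j * bdist (a i) (a j) * q j * p i = l i j * bdist (a i) (a j)"
          using kkpq[OF i j] by (simp add: mult_ac)
        finally show ?thesis .
      qed
      then show ?thesis
        using l[OF i] by (subst sum_ennreal[symmetric]) (auto simp: sum_distrib_right)
    qed
    then show ?thesis
      using l by (subst sum_ennreal[symmetric]) (auto intro!: sum_nonneg mult_nonneg_nonneg)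
  qed
  also have "(\<integral>\<^sup>+x. ennreal (err x) \<partial>\<mu>) = ennreal (\<integral>x. err x \<partial>\<mu>)"
    using \<mu> n err01 by (intro nn_integral_eq_integral err) auto
  also have "(\<integral>\<^sup>+x. ennreal (err x) \<partial>\<nu>) = ennreal (\<integral>x. err x \<partial>\<nu>)"
    using \<nu> n err01 by (intro nn_integral_eq_integral err) auto
  also have "ennreal (\<Sum>i\<le>n. \<Sum>j\<le>n. l i j * bdist (a i) (a j)) + ennreal (\<integral>x. err x \<partial>\<mu>) + ennreal (\<integral>x. err x \<partial>\<nu>)
      \<le> ennreal (c + 4 * e') + ennreal (2 * e') + ennreal (2 * e')"
    using err(2)[OF \<mu> n(1)] err(2)[OF \<nu> n(2)] lc by (intro add_mono ennreal_leI)
  also have "\<dots> = ennreal (c + e)"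
    using c e by (simp add: ennreal_plus[symmetric] e'_def del: ennreal_plus)
  finally show ?thesis
    using that k_meas kx ky by blast
qed

section \<open>Generalized couplings\<close>

lemma emeasure_distr_eq_nn_integral:
  assumes "f \<in> measurable M N" "A \<in> sets N"
  shows "emeasure (distr M N f) A = (\<integral>\<^sup>+x. indicator A (f x) \<partial>M)"
  using nn_integral_distr[OF assms(1), of "indicator A"] assms(2) by simp

lemma tv_dist_upper:
  assumes "prob_space \<mu>" "prob_space \<nu>" "A \<in> sets \<mu>"
  shows "\<bar>measure \<mu> A - measure \<nu> A\<bar> \<le> tv_dist \<mu> \<nu>"
  unfolding tv_dist_def
proof (rule cSUP_upper[OF assms(3)])
  have "\<bar>measure \<mu> B - measure \<nu> B\<bar> \<le> 1" for B
    using prob_space.prob_le_1[OF assms(1), of B] prob_space.prob_le_1[OF assms(2), of B]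
      measure_nonneg[of \<mu> B] measure_nonneg[of \<nu> B] by linarith
  then show "bdd_above ((\<lambda>A. \<bar>measure \<mu> A - measure \<nu> A\<bar>) ` sets \<mu>)"
    by (auto simp: bdd_above_def)
qed

section \<open>The common part of two laws\<close>

text \<open>The Radon-Nikodym derivative of \<open>\<mu>\<close> restricted to \<open>A\<close> is
  at most 1 almost everywhere because \<open>\<mu>\<close> lies below \<open>\<nu>\<close> there.
  The bounds are wanted at every point, since such densities later act as acceptance
  probabilities.\<close>

lemma dominated_restriction_density:
  assumes "finite_measure \<mu>" "finite_measure \<nu>" and sets: "sets \<mu> = sets \<nu>" and A: "A \<in> sets \<nu>"
    and le: "\<And>B. B \<in> sets \<nu> \<Longrightarrow> B \<subseteq> A \<Longrightarrow> emeasure \<mu> B \<le> emeasure \<nu> B"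
  obtains g :: "_ \<Rightarrow> ennreal" where "g \<in> borel_measurable \<nu>" "\<And>x. g x \<le> 1" "\<And>x. x \<notin> A \<Longrightarrow> g x = 0"
    "\<And>B. B \<in> sets \<nu> \<Longrightarrow> emeasure (density \<nu> g) B = emeasure \<mu> (B \<inter> A)"
proof -
  interpret \<mu>: finite_measure \<mu> by fact
  interpret \<nu>: finite_measure \<nu> by fact
  note [measurable_cong] = sets
  note [measurable] = A
  have sp: "space \<mu> = space \<nu>" using sets by (rule sets_eq_imp_space_eq)
  define \<mu>A where "\<mu>A = density \<mu> (indicator A)"
  have \<mu>A: "emeasure \<mu>A B = emeasure \<mu> (B \<inter> A)" if "B \<in> sets \<nu>" for B
  proof -
    have "indicator A x * indicator B x = (indicator (B \<inter> A) x :: ennreal)" for x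
      by (auto split: split_indicator)
    then show ?thesis
      unfolding \<mu>A_def using that A sets by (subst emeasure_density) auto
  qed
  have sets_A: "sets \<mu>A = sets \<nu>" by (simp add: \<mu>A_def sets)
  have ac: "absolutely_continuous \<nu> \<mu>A"
    unfolding absolutely_continuous_def
  proof (intro subsetI)
    fix N assume N: "N \<in> null_sets \<nu>"
    then have "emeasure \<mu> (N \<inter> A) \<le> emeasure \<nu> (N \<inter> A)"
      using A by (intro le) auto
    also have "\<dots> \<le> emeasure \<nu> N"
      using N by (intro emeasure_mono) auto
    finally show "N \<in> null_sets \<mu>A"
      using N by (auto simp: null_sets_def \<mu>A sets_A)
  qed
  define h where "h = RN_deriv \<nu> \<mu>A"
  have h[measurable]: "h \<in> borel_measurable \<nu>" by (simp add: h_def)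
  have hd: "density \<nu> h = \<mu>A"
    unfolding h_def by (rule \<nu>.density_RN_deriv[OF ac sets_A])
  have "AE x in \<nu>. h x \<le> indicator A x"
  proof -
    \<comment> \<open>On the set where \<open>h\<close> exceeds the indicator, domination gives the
      opposite inequality of integrals, and finiteness permits subtraction.\<close>
    define S where "S = {x\<in>space \<nu>. indicator A x < h x}"
    have S[measurable]: "S \<in> sets \<nu>" unfolding S_def by measurable
    have "(\<integral>\<^sup>+x. h x * indicator S x \<partial>\<nu>) = emeasure \<mu>A S"
      by (subst hd[symmetric]) (simp add: emeasure_density)
    also have "\<dots> \<le> emeasure \<nu> (S \<inter> A)"
      unfolding \<mu>A[OF S] by (intro le) auto
    also have "\<dots> = (\<integral>\<^sup>+x. indicator A x * indicator S x \<partial>\<nu>)"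
    proof -
      have "indicator A x * indicator S x = (indicator (S \<inter> A) x :: ennreal)" for x
        by (auto split: split_indicator)
      then show ?thesis by simp
    qed
    finally have le': "(\<integral>\<^sup>+x. h x * indicator S x \<partial>\<nu>) \<le> (\<integral>\<^sup>+x. indicator A x * indicator S x \<partial>\<nu>)" .
    have fin: "(\<integral>\<^sup>+x. indicator A x * indicator S x \<partial>\<nu>) \<noteq> \<infinity>"
    proof -
      have "(\<integral>\<^sup>+x. indicator A x * indicator S x \<partial>\<nu>) \<le> (\<integral>\<^sup>+x. 1 \<partial>\<nu>)"
        by (intro nn_integral_mono) (auto split: split_indicator)
      then show ?thesis
        using \<nu>.emeasure_finite[of "space \<nu>"] by (auto simp: top_unique)
    qed
    have "(\<integral>\<^sup>+x. h x * indicator S x - indicator A x * indicator S x \<partial>\<nu>) = 0"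
    proof (subst nn_integral_diff)
      show "AE x in \<nu>. indicator A x * indicator S x \<le> h x * indicator S x"
        by (auto simp: S_def split: split_indicator)
      show "(\<integral>\<^sup>+x. h x * indicator S x \<partial>\<nu>) - (\<integral>\<^sup>+x. indicator A x * indicator S x \<partial>\<nu>) = 0"
        using le' fin by (simp add: diff_eq_0_iff_ennreal top.not_eq_extremum)
    qed (use fin in auto)
    then have "AE x in \<nu>. h x * indicator S x - indicator A x * indicator S x = 0"
      by (subst (asm) nn_integral_0_iff_AE) auto
    then show ?thesis
    proof (rule AE_mp, intro AE_I2 impI)
      fix x assume "x \<in> space \<nu>" and eq: "h x * indicator S x - indicator A x * indicator S x = 0"
      show "h x \<le> indicator A x"
      proof (rule ccontr)
        assume "\<not> h x \<le> indicator A x"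
        then have "x \<in> S" "indicator A x < h x"
          using \<open>x \<in> space \<nu>\<close> by (auto simp: S_def)
        then show False
          using eq by (auto simp: diff_eq_0_iff_ennreal split: split_indicator_asm)
      qed
    qed
  qed
  \<comment> \<open>Cutting \<open>h\<close> off at the indicator alters it on a null set only and
    makes the bounds hold everywhere.\<close>
  then have "AE x in \<nu>. min (h x) (indicator A x) = h x"
    by eventually_elim (simp add: min_absorb1)
  then have eq: "density \<nu> (\<lambda>x. min (h x) (indicator A x)) = \<mu>A"
    unfolding hd[symmetric] by (intro density_cong) auto
  show ?thesis
  proof (rule that[of "\<lambda>x. min (h x) (indicator A x)"])
    show "emeasure (density \<nu> (\<lambda>x. min (h x) (indicator A x))) B = emeasure \<mu> (B \<inter> A)"
      if "B \<in> sets \<nu>" for B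
      using that unfolding eq by (rule \<mu>A)
  qed (auto simp: min_def split: split_indicator)
qed

text \<open>The common measure is the minimum of \<open>\<mu>\<close> and \<open>\<nu>\<close>: on
  the Hahn set \<open>A\<close>, where \<open>\<mu>\<close> is the smaller, it is
  \<open>\<mu>\<close>, and off \<open>A\<close> it is \<open>\<nu>\<close>. The mass of
  \<open>\<nu>\<close> that it misses is the difference of \<open>\<nu>\<close> and
  \<open>\<mu>\<close> on \<open>A\<close>, one of the values in the supremum.\<close>

lemma tv_dist_common_part:
  fixes \<mu> \<nu> :: "'a measure"
  assumes \<mu>: "prob_space \<mu>" and \<nu>: "prob_space \<nu>" and sets: "sets \<mu> = sets \<nu>"
  obtains a b :: "'a \<Rightarrow> ennreal" where "a \<in> borel_measurable \<mu>" "b \<in> borel_measurable \<nu>"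
    "\<And>x. a x \<le> 1" "\<And>x. b x \<le> 1" "density \<mu> a = density \<nu> b"
    "(\<integral>\<^sup>+x. 1 - b x \<partial>\<nu>) \<le> ennreal (tv_dist \<mu> \<nu>)"
proof -
  interpret \<mu>: prob_space \<mu> by fact
  interpret \<nu>: prob_space \<nu> by fact
  note [measurable_cong] = sets
  have sp: "space \<mu> = space \<nu>" using sets by (rule sets_eq_imp_space_eq)
  obtain A where A[measurable]: "A \<in> sets \<nu>"
    and A_le: "\<forall>B\<in>sets \<nu>. B \<subseteq> A \<longrightarrow> emeasure \<mu> B \<le> emeasure \<nu> B"
      "\<forall>B\<in>sets \<nu>. B \<inter> A = {} \<longrightarrow> emeasure \<nu> B \<le> emeasure \<mu> B"
    using finite_unsigned_Hahn_decomposition[OF \<nu>.finite_measure_axioms \<mu>.finite_measure_axioms sets]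
    by (elim bexE conjE)
  have le1: "emeasure \<mu> B \<le> emeasure \<nu> B" if "B \<in> sets \<nu>" "B \<subseteq> A" for B
    using A_le(1) that by simp
  have le2: "emeasure \<nu> B \<le> emeasure \<mu> B" if "B \<in> sets \<nu>" "B \<inter> A = {}" for B
    using A_le(2) that by simp
  obtain g where g[measurable]: "g \<in> borel_measurable \<nu>" and g1: "\<And>x. g x \<le> 1" "\<And>x. x \<notin> A \<Longrightarrow> g x = 0"
    and gd: "\<And>B. B \<in> sets \<nu> \<Longrightarrow> emeasure (density \<nu> g) B = emeasure \<mu> (B \<inter> A)"
    using dominated_restriction_density[OF \<mu>.finite_measure_axioms \<nu>.finite_measure_axioms sets A le1] by metis
  define A' where "A' = space \<nu> - A"
  have A'[measurable]: "A' \<in> sets \<nu>" by (simp add: A'_def)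
  obtain h where h[measurable]: "h \<in> borel_measurable \<mu>" and h1: "\<And>x. h x \<le> 1" "\<And>x. x \<notin> A' \<Longrightarrow> h x = 0"
    and hd: "\<And>B. B \<in> sets \<mu> \<Longrightarrow> emeasure (density \<mu> h) B = emeasure \<nu> (B \<inter> A')"
  proof (rule dominated_restriction_density[OF \<nu>.finite_measure_axioms \<mu>.finite_measure_axioms sets[symmetric], of A'])
    show "A' \<in> sets \<mu>" by (simp add: sets)
    show "emeasure \<nu> B \<le> emeasure \<mu> B" if "B \<in> sets \<mu>" "B \<subseteq> A'" for B
      using that by (intro le2) (auto simp: sets A'_def)
  qed blast
  define a where "a x = indicator A x + h x" for x
  define b where "b x = indicator A' x + g x" for x
  have [measurable]: "a \<in> borel_measurable \<mu>" "b \<in> borel_measurable \<nu>"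
    unfolding a_def b_def by measurable
  have a1: "a x \<le> 1" for x
    using h1[of x] by (auto simp: a_def A'_def split: split_indicator)
  have b1: "b x \<le> 1" for x
    using g1[of x] by (auto simp: b_def A'_def split: split_indicator)
  have da: "emeasure (density \<mu> a) B = emeasure \<mu> (B \<inter> A) + emeasure \<nu> (B \<inter> A')" if B[measurable]: "B \<in> sets \<mu>" for B
  proof -
    have "emeasure (density \<mu> a) B = (\<integral>\<^sup>+x. indicator (B \<inter> A) x + h x * indicator B x \<partial>\<mu>)"
      by (subst emeasure_density) (auto intro!: nn_integral_cong simp: a_def distrib_right split: split_indicator)
    also have "\<dots> = emeasure \<mu> (B \<inter> A) + emeasure (density \<mu> h) B"
      using B A sets by (subst nn_integral_add) (auto simp: emeasure_density)
    finally show ?thesis using hd[OF B] by simp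
  qed
  have db: "emeasure (density \<nu> b) B = emeasure \<nu> (B \<inter> A') + emeasure \<mu> (B \<inter> A)" if B[measurable]: "B \<in> sets \<nu>" for B
  proof -
    have "emeasure (density \<nu> b) B = (\<integral>\<^sup>+x. indicator (B \<inter> A') x + g x * indicator B x \<partial>\<nu>)"
      by (subst emeasure_density) (auto intro!: nn_integral_cong simp: b_def distrib_right split: split_indicator)
    also have "\<dots> = emeasure \<nu> (B \<inter> A') + emeasure (density \<nu> g) B"
      using B A' by (subst nn_integral_add) (auto simp: emeasure_density)
    finally show ?thesis using gd[OF B] by simp
  qed
  have "density \<mu> a = density \<nu> b"
    by (rule measure_eqI) (auto simp: sets da db add.commute)
  moreover have "(\<integral>\<^sup>+x. 1 - b x \<partial>\<nu>) \<le> ennreal (tv_dist \<mu> \<nu>)"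
  proof -
    have "(\<integral>\<^sup>+x. b x \<partial>\<nu>) = emeasure (density \<nu> b) (space \<nu>)"
      by (subst emeasure_density) (auto intro!: nn_integral_cong)
    also have "\<dots> = emeasure \<nu> A' + emeasure \<mu> A"
      using A A' by (subst db) (auto simp: Int_absorb1 dest: sets.sets_into_space)
    also have "\<dots> = ennreal (measure \<nu> A' + measure \<mu> A)"
      by (simp add: \<mu>.emeasure_eq_measure \<nu>.emeasure_eq_measure)
    also have "measure \<nu> A' = 1 - measure \<nu> A"
      unfolding A'_def by (rule \<nu>.prob_compl[OF A])
    finally have b: "(\<integral>\<^sup>+x. b x \<partial>\<nu>) = ennreal (1 - measure \<nu> A + measure \<mu> A)" .
    have "(\<integral>\<^sup>+x. 1 - b x \<partial>\<nu>) = 1 - ennreal (1 - measure \<nu> A + measure \<mu> A)"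
      by (subst nn_integral_diff) (auto simp: b b1 \<nu>.emeasure_space_1)
    also have "\<dots> = ennreal (1 - (1 - measure \<nu> A + measure \<mu> A))"
      by (subst ennreal_minus[symmetric]) (auto intro!: add_nonneg_nonneg)
    also have "\<dots> \<le> ennreal (tv_dist \<mu> \<nu>)"
      using tv_dist_upper[OF \<mu> \<nu>, of A] A by (intro ennreal_leI) (auto simp: sets)
    finally show ?thesis .
  qed
  ultimately show ?thesis
    using a1 b1 by (intro that[of a b]) auto
qed

lemma nn_integral_count_space_bool:
  "(\<integral>\<^sup>+c. f c \<partial>count_space (UNIV::bool set)) = f True + f False"
  by (simp add: nn_integral_count_space_finite UNIV_bool add.commute)

text \<open>The coupling keeps the generalized one where the law of \<open>Y\<close> agrees with \<open>\<nu>\<close>, and redraws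
  the second coordinate independently from the remaining part of \<open>\<nu>\<close> elsewhere.\<close>
lemma coupling_of_generalized_coupling:
  fixes X Y :: "'b \<Rightarrow> 'a::polish_space" and d :: "'a \<Rightarrow> 'a \<Rightarrow> real"
  assumes M: "prob_space M" and X[measurable]: "X \<in> measurable M borel" and Y[measurable]: "Y \<in> measurable M borel"
    and \<nu>: "prob_space \<nu>" "sets \<nu> = sets borel"
    and d: "case_prod d \<in> borel_measurable (borel \<Otimes>\<^sub>M borel)" "\<And>x y. 0 \<le> d x y" "\<And>x y. d x y \<le> 1"
  obtains cpl where "coupling (distr M borel X) \<nu> cpl"
    and "(\<integral>\<^sup>+p. ennreal (d (fst p) (snd p)) \<partial>cpl)
      \<le> (\<integral>\<^sup>+\<omega>. ennreal (d (X \<omega>) (Y \<omega>)) \<partial>M) + ennreal (tv_dist (distr M borel Y) \<nu>)"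
proof -
  interpret M: prob_space M by fact
  interpret \<nu>: prob_space \<nu> by fact
  note [measurable_cong] = \<nu>(2)
  have [simp]: "space \<nu> = UNIV"
    using \<nu>(2) by (auto dest: sets_eq_imp_space_eq)
  define \<mu> where "\<mu> = distr M borel Y"
  have \<mu>: "prob_space \<mu>" "sets \<mu> = sets \<nu>"
    unfolding \<mu>_def by (auto intro!: M.prob_space_distr simp: \<nu>)
  interpret \<mu>: prob_space \<mu> by fact
  obtain a b where "a \<in> borel_measurable \<mu>" "b \<in> borel_measurable \<nu>"
    and a1: "\<And>x. a x \<le> 1" and b1: "\<And>x. b x \<le> 1" and ab: "density \<mu> a = density \<nu> b"
    and tv: "(\<integral>\<^sup>+x. 1 - b x \<partial>\<nu>) \<le> ennreal (tv_dist \<mu> \<nu>)"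
    using tv_dist_common_part[OF \<mu>(1) \<nu>(1) \<mu>(2)] by metis
  then have [measurable]: "a \<in> borel_measurable borel" "b \<in> borel_measurable borel"
    using \<mu>(2) \<nu>(2) by (simp_all cong: measurable_cong_sets)
  have ab_int: "(\<integral>\<^sup>+\<omega>. a (Y \<omega>) * f (Y \<omega>) \<partial>M) = (\<integral>\<^sup>+x. b x * f x \<partial>\<nu>)"
    if [measurable]: "f \<in> borel_measurable borel" for f
  proof -
    have "(\<integral>\<^sup>+\<omega>. a (Y \<omega>) * f (Y \<omega>) \<partial>M) = (\<integral>\<^sup>+x. f x \<partial>density \<mu> a)"
      by (simp add: \<mu>_def nn_integral_distr nn_integral_density)
    also have "\<dots> = (\<integral>\<^sup>+x. b x * f x \<partial>\<nu>)"
      unfolding ab by (simp add: nn_integral_density)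
    finally show ?thesis .
  qed
  \<comment> \<open>Mass of \<open>\<nu>\<close> outside the common part; by \<open>m_a\<close> it
    is also the probability that \<open>Y\<close> is rejected.\<close>
  define m where "m = (\<integral>\<^sup>+x. 1 - b x \<partial>\<nu>)"
  have m_le: "m \<le> 1"
  proof -
    have "m \<le> (\<integral>\<^sup>+x. 1 \<partial>\<nu>)"
      unfolding m_def by (intro nn_integral_mono) (simp add: diff_le_self_ennreal)
    then show ?thesis by (simp add: \<nu>.emeasure_space_1[simplified])
  qed
  then have m_fin: "m < \<infinity>"
    by (auto simp: less_top[symmetric] top_unique)
  have m_a: "(\<integral>\<^sup>+\<omega>. 1 - a (Y \<omega>) \<partial>M) = m"
  proof -
    have b_fin: "(\<integral>\<^sup>+x. b x \<partial>\<nu>) \<noteq> \<infinity>"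
    proof -
      have "(\<integral>\<^sup>+x. b x \<partial>\<nu>) \<le> (\<integral>\<^sup>+x. 1 \<partial>\<nu>)"
        by (intro nn_integral_mono b1)
      then show ?thesis by (auto simp: \<nu>.emeasure_space_1[simplified] top_unique)
    qed
    have eq: "(\<integral>\<^sup>+\<omega>. a (Y \<omega>) \<partial>M) = (\<integral>\<^sup>+x. b x \<partial>\<nu>)"
      using ab_int[of "\<lambda>_. 1"] by simp
    have "(\<integral>\<^sup>+\<omega>. 1 - a (Y \<omega>) \<partial>M) = 1 - (\<integral>\<^sup>+\<omega>. a (Y \<omega>) \<partial>M)"
      using b_fin by (subst nn_integral_diff) (auto simp: eq a1 M.emeasure_space_1)
    also have "\<dots> = m"
      unfolding m_def eq using b_fin
      by (subst nn_integral_diff) (auto simp: b1 \<nu>.emeasure_space_1[simplified])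
    finally show ?thesis .
  qed
  \<comment> \<open>The normalized uncovered part of \<open>\<nu>\<close>. If \<open>m = 0\<close>,
    redrawing has probability 0 and \<open>\<nu>\<close> merely fills in as some probability
    measure.\<close>
  define R where "R = (if m = 0 then \<nu> else density \<nu> (\<lambda>x. (1 - b x) / m))"
  have sets_R[measurable_cong]: "sets R = sets borel"
    by (simp add: R_def \<nu>)
  have R_int: "(\<integral>\<^sup>+x. f x \<partial>R) * m = (\<integral>\<^sup>+x. (1 - b x) * f x \<partial>\<nu>)"
    if [measurable]: "f \<in> borel_measurable borel" for f
  proof (cases "m = 0")
    case True
    then have "AE x in \<nu>. 1 - b x = 0"
      unfolding m_def by (subst (asm) nn_integral_0_iff_AE) auto
    then have "AE x in \<nu>. (1 - b x) * f x = 0"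
      by eventually_elim simp
    then show ?thesis
      using True by (simp add: nn_integral_0_iff_AE)
  next
    case False
    then have "(\<integral>\<^sup>+x. f x \<partial>R) * m = (\<integral>\<^sup>+x. (1 - b x) / m * f x * m \<partial>\<nu>)"
      by (simp add: R_def nn_integral_density nn_integral_multc)
    also have "\<dots> = (\<integral>\<^sup>+x. (1 - b x) * f x \<partial>\<nu>)"
    proof (intro nn_integral_cong)
      fix x
      have "(1 - b x) / m * f x * m = (1 - b x) * f x * (m / m)"
        by (simp add: divide_ennreal_def mult_ac)
      also have "m / m = 1"
        using False m_fin by (simp add: ennreal_divide_self)
      finally show "(1 - b x) / m * f x * m = (1 - b x) * f x" by simp
    qed
    finally show ?thesis .
  qed
  have "emeasure R (space R) = 1"
  proof (cases "m = 0")
    case True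
    then show ?thesis by (simp add: R_def \<nu>.emeasure_space_1[simplified])
  next
    case False
    have "emeasure R (space R) * m = m"
      using R_int[of "\<lambda>_. 1"] by (simp add: m_def)
    then have "emeasure R (space R) * m / m = m / m" by simp
    then show ?thesis
      using False m_fin by (simp add: ennreal_mult_divide_eq ennreal_divide_self)
  qed
  then interpret R: prob_space R ..
  interpret cb: sigma_finite_measure "count_space (UNIV::bool set)"
    by (rule sigma_finite_measure_count_space_finite) simp
  interpret Rc: pair_sigma_finite R "count_space (UNIV::bool set)" ..
  interpret Mc: pair_sigma_finite M "R \<Otimes>\<^sub>M count_space (UNIV::bool set)" ..
  \<comment> \<open>Extended sample space: \<open>z\<close> is the fresh point and the boolean
    records acceptance. The density on top of counting measure gives acceptance the conditional
    probability \<open>a (Y \<omega>)\<close>.\<close>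
  define N where "N = density (M \<Otimes>\<^sub>M (R \<Otimes>\<^sub>M count_space (UNIV::bool set)))
    (\<lambda>(\<omega>, z, c). if c then a (Y \<omega>) else 1 - a (Y \<omega>))"
  define Z where "Z = (\<lambda>(\<omega>, z, c). (X \<omega>, if c then Y \<omega> else z))"
  have Z[measurable]: "Z \<in> measurable N (borel \<Otimes>\<^sub>M borel)"
    unfolding Z_def N_def by measurable
  define cpl where "cpl = distr N (borel \<Otimes>\<^sub>M borel) Z"
  have cpl_int: "(\<integral>\<^sup>+p. g p \<partial>cpl) = (\<integral>\<^sup>+\<omega>. a (Y \<omega>) * g (X \<omega>, Y \<omega>) \<partial>M) + (\<integral>\<^sup>+\<omega>. (1 - a (Y \<omega>)) * (\<integral>\<^sup>+z. g (X \<omega>, z) \<partial>R) \<partial>M)"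
    if g[measurable]: "g \<in> borel_measurable (borel \<Otimes>\<^sub>M borel)" for g :: "'a \<times> 'a \<Rightarrow> ennreal"
  proof -
    have "(\<integral>\<^sup>+p. g p \<partial>cpl) = (\<integral>\<^sup>+(\<omega>, z, c). (if c then a (Y \<omega>) else 1 - a (Y \<omega>)) * g (X \<omega>, if c then Y \<omega> else z)
        \<partial>(M \<Otimes>\<^sub>M (R \<Otimes>\<^sub>M count_space (UNIV::bool set))))"
    proof -
      have "(\<integral>\<^sup>+p. g p \<partial>cpl) = (\<integral>\<^sup>+p. g (Z p) \<partial>N)"
        unfolding cpl_def by (rule nn_integral_distr[OF Z]) simp
      also have "\<dots> = (\<integral>\<^sup>+p. (case p of (\<omega>, z, c) \<Rightarrow> if c then a (Y \<omega>) else 1 - a (Y \<omega>)) * g (Z p)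
          \<partial>(M \<Otimes>\<^sub>M (R \<Otimes>\<^sub>M count_space (UNIV::bool set))))"
        unfolding N_def
      proof (rule nn_integral_density)
        have "Z \<in> measurable (M \<Otimes>\<^sub>M (R \<Otimes>\<^sub>M count_space UNIV)) (borel \<Otimes>\<^sub>M borel)"
          using Z by (simp add: N_def)
        then show "(\<lambda>x. g (Z x)) \<in> borel_measurable (M \<Otimes>\<^sub>M (R \<Otimes>\<^sub>M count_space (UNIV::bool set)))"
          by measurable
      qed measurable
      finally show ?thesis
        by (simp add: Z_def case_prod_beta')
    qed
    also have "\<dots> = (\<integral>\<^sup>+\<omega>. \<integral>\<^sup>+z. \<integral>\<^sup>+c. (if c then a (Y \<omega>) else 1 - a (Y \<omega>)) * g (X \<omega>, if c then Y \<omega> else z)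
        \<partial>count_space UNIV \<partial>R \<partial>M)"
    proof (subst Rc.P.nn_integral_fst[symmetric])
      show "(\<integral>\<^sup>+\<omega>. \<integral>\<^sup>+q. (case (\<omega>, q) of (\<omega>, z, c) \<Rightarrow> (if c then a (Y \<omega>) else 1 - a (Y \<omega>)) * g (X \<omega>, if c then Y \<omega> else z))
          \<partial>(R \<Otimes>\<^sub>M count_space UNIV) \<partial>M)
        = (\<integral>\<^sup>+\<omega>. \<integral>\<^sup>+z. \<integral>\<^sup>+c. (if c then a (Y \<omega>) else 1 - a (Y \<omega>)) * g (X \<omega>, if c then Y \<omega> else z)
          \<partial>count_space UNIV \<partial>R \<partial>M)"
        by (intro nn_integral_cong, subst cb.nn_integral_fst[symmetric]) auto
    qed measurable
    also have "\<dots> = (\<integral>\<^sup>+\<omega>. \<integral>\<^sup>+z. a (Y \<omega>) * g (X \<omega>, Y \<omega>) + (1 - a (Y \<omega>)) * g (X \<omega>, z) \<partial>R \<partial>M)"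
      by (simp add: nn_integral_count_space_bool)
    also have "\<dots> = (\<integral>\<^sup>+\<omega>. a (Y \<omega>) * g (X \<omega>, Y \<omega>) + (1 - a (Y \<omega>)) * (\<integral>\<^sup>+z. g (X \<omega>, z) \<partial>R) \<partial>M)"
      by (intro nn_integral_cong) (simp add: nn_integral_add nn_integral_cmult R.emeasure_space_1)
    also have "\<dots> = (\<integral>\<^sup>+\<omega>. a (Y \<omega>) * g (X \<omega>, Y \<omega>) \<partial>M) + (\<integral>\<^sup>+\<omega>. (1 - a (Y \<omega>)) * (\<integral>\<^sup>+z. g (X \<omega>, z) \<partial>R) \<partial>M)"
      by (rule nn_integral_add) measurable
    finally show ?thesis .
  qed
  have sets_cpl[measurable_cong]: "sets cpl = sets (borel \<Otimes>\<^sub>M borel)"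
    by (simp add: cpl_def)
  have fst_int: "(\<integral>\<^sup>+p. f (fst p) \<partial>cpl) = (\<integral>\<^sup>+\<omega>. f (X \<omega>) \<partial>M)"
    if [measurable]: "f \<in> borel_measurable borel" for f
  proof -
    have "(\<integral>\<^sup>+p. f (fst p) \<partial>cpl) = (\<integral>\<^sup>+\<omega>. a (Y \<omega>) * f (X \<omega>) \<partial>M) + (\<integral>\<^sup>+\<omega>. (1 - a (Y \<omega>)) * f (X \<omega>) \<partial>M)"
      by (subst cpl_int) (auto simp: R.emeasure_space_1)
    also have "\<dots> = (\<integral>\<^sup>+\<omega>. a (Y \<omega>) * f (X \<omega>) + (1 - a (Y \<omega>)) * f (X \<omega>) \<partial>M)"
      by (rule nn_integral_add[symmetric]) measurable
    also have "\<dots> = (\<integral>\<^sup>+\<omega>. f (X \<omega>) \<partial>M)"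
      using a1 by (intro nn_integral_cong) (simp add: distrib_right[symmetric] add_diff_inverse_ennreal)
    finally show ?thesis .
  qed
  have snd_int: "(\<integral>\<^sup>+p. f (snd p) \<partial>cpl) = (\<integral>\<^sup>+x. f x \<partial>\<nu>)"
    if [measurable]: "f \<in> borel_measurable borel" for f
  proof -
    have "(\<integral>\<^sup>+p. f (snd p) \<partial>cpl) = (\<integral>\<^sup>+\<omega>. a (Y \<omega>) * f (Y \<omega>) \<partial>M) + (\<integral>\<^sup>+\<omega>. (1 - a (Y \<omega>)) * (\<integral>\<^sup>+z. f z \<partial>R) \<partial>M)"
      by (subst cpl_int) auto
    also have "\<dots> = (\<integral>\<^sup>+x. b x * f x \<partial>\<nu>) + (\<integral>\<^sup>+z. f z \<partial>R) * m"
      by (simp add: ab_int nn_integral_multc m_a) (simp add: mult.commute)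
    also have "\<dots> = (\<integral>\<^sup>+x. b x * f x + (1 - b x) * f x \<partial>\<nu>)"
      by (simp add: R_int nn_integral_add)
    also have "\<dots> = (\<integral>\<^sup>+x. f x \<partial>\<nu>)"
      using b1 by (intro nn_integral_cong) (simp add: distrib_right[symmetric] add_diff_inverse_ennreal)
    finally show ?thesis .
  qed
  show ?thesis
  proof (rule that[of cpl])
    have "emeasure cpl (space cpl) = 1"
      using fst_int[of "\<lambda>_. 1"] by (simp add: M.emeasure_space_1)
    then have "prob_space cpl" ..
    moreover have "distr cpl borel fst = distr M borel X"
    proof (rule measure_eqI)
      fix A assume "A \<in> sets (distr cpl borel fst)"
      then have [measurable]: "A \<in> sets borel" by simp
      have "emeasure (distr cpl borel fst) A = (\<integral>\<^sup>+p. indicator A (fst p) \<partial>cpl)"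
        by (rule emeasure_distr_eq_nn_integral) auto
      also have "\<dots> = (\<integral>\<^sup>+\<omega>. indicator A (X \<omega>) \<partial>M)"
        by (rule fst_int) measurable
      also have "\<dots> = emeasure (distr M borel X) A"
        by (rule emeasure_distr_eq_nn_integral[symmetric]) auto
      finally show "emeasure (distr cpl borel fst) A = emeasure (distr M borel X) A" .
    qed simp
    moreover have "distr cpl borel snd = \<nu>"
    proof (rule measure_eqI)
      fix A assume "A \<in> sets (distr cpl borel snd)"
      then have [measurable]: "A \<in> sets borel" by simp
      have "emeasure (distr cpl borel snd) A = (\<integral>\<^sup>+p. indicator A (snd p) \<partial>cpl)"
        by (rule emeasure_distr_eq_nn_integral) auto
      also have "\<dots> = (\<integral>\<^sup>+x. indicator A x \<partial>\<nu>)"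
        by (rule snd_int) measurable
      finally show "emeasure (distr cpl borel snd) A = emeasure \<nu> A"
        by (simp add: \<nu>)
    qed (simp add: \<nu>)
    ultimately show "coupling (distr M borel X) \<nu> cpl"
      by (simp add: coupling_def sets_cpl)
    have [measurable]: "(\<lambda>p. d (fst p) (snd p)) \<in> borel_measurable (borel \<Otimes>\<^sub>M borel)"
      using d(1) by (simp add: case_prod_beta')
    have "(\<integral>\<^sup>+p. ennreal (d (fst p) (snd p)) \<partial>cpl)
      = (\<integral>\<^sup>+\<omega>. a (Y \<omega>) * ennreal (d (X \<omega>) (Y \<omega>)) \<partial>M) + (\<integral>\<^sup>+\<omega>. (1 - a (Y \<omega>)) * (\<integral>\<^sup>+z. ennreal (d (X \<omega>) z) \<partial>R) \<partial>M)"
      by (subst cpl_int) auto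
    also have "\<dots> \<le> (\<integral>\<^sup>+\<omega>. ennreal (d (X \<omega>) (Y \<omega>)) \<partial>M) + (\<integral>\<^sup>+\<omega>. 1 - a (Y \<omega>) \<partial>M)"
    \<comment> \<open>After a rejection the cost is bounded by 1, so this event contributes at most
      \<open>m\<close>.\<close>
    proof (intro add_mono nn_integral_mono)
      show "a (Y \<omega>) * ennreal (d (X \<omega>) (Y \<omega>)) \<le> ennreal (d (X \<omega>) (Y \<omega>))" for \<omega>
        using mult_right_mono[OF a1, of "ennreal (d (X \<omega>) (Y \<omega>))"] by simp
      fix \<omega>
      have "(\<integral>\<^sup>+z. ennreal (d (X \<omega>) z) \<partial>R) \<le> (\<integral>\<^sup>+z. 1 \<partial>R)"
        using d by (intro nn_integral_mono) (simp add: ennreal_le_1)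
      then have "(\<integral>\<^sup>+z. ennreal (d (X \<omega>) z) \<partial>R) \<le> 1"
        by (simp add: R.emeasure_space_1)
      then show "(1 - a (Y \<omega>)) * (\<integral>\<^sup>+z. ennreal (d (X \<omega>) z) \<partial>R) \<le> 1 - a (Y \<omega>)"
        using mult_left_mono[of _ 1 "1 - a (Y \<omega>)"] by simp
    qed
    also have "(\<integral>\<^sup>+\<omega>. 1 - a (Y \<omega>) \<partial>M) \<le> ennreal (tv_dist \<mu> \<nu>)"
      unfolding m_a m_def by (rule tv)
    finally show "(\<integral>\<^sup>+p. ennreal (d (fst p) (snd p)) \<partial>cpl)
      \<le> (\<integral>\<^sup>+\<omega>. ennreal (d (X \<omega>) (Y \<omega>)) \<partial>M) + ennreal (tv_dist (distr M borel Y) \<nu>)"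
      unfolding \<mu>_def by (simp add: add_left_mono)
  qed
qed

section \<open>Limits of measures and the Wasserstein distance\<close>

text \<open>Summable terms tend to 0, so the truncation at 1 is eventually inactive and a summable
  series of distances remains.\<close>

lemma Cauchy_of_summable_bdist:
  fixes X :: "nat \<Rightarrow> 'a::metric_space"
  assumes "summable (\<lambda>n. bdist (X n) (X (Suc n)))"
  shows "Cauchy X"
proof -
  have "(\<lambda>n. bdist (X n) (X (Suc n))) \<longlonglongrightarrow> 0"
    using assms by (rule summable_LIMSEQ_zero)
  then have "\<forall>\<^sub>F n in sequentially. bdist (X n) (X (Suc n)) < 1"
    by (rule order_tendstoD) simp
  then have "\<forall>\<^sub>F n in sequentially. bdist (X n) (X (Suc n)) = dist (X n) (X (Suc n))"
    by eventually_elim auto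
  then have sm: "summable (\<lambda>n. dist (X n) (X (Suc n)))"
    using assms summable_cong by fastforce
  have le: "dist (X m) (X n) \<le> (\<Sum>i=m..<n. dist (X i) (X (Suc i)))" if "m \<le> n" for m n
    using that
  proof (induction n rule: dec_induct)
    case (step n)
    then show ?case
      using dist_triangle[of "X m" "X (Suc n)" "X n"] by simp
  qed simp
  show ?thesis
  proof (rule metric_CauchyI)
    fix e :: real assume "0 < e"
    then obtain N where N: "\<And>m n. m \<ge> N \<Longrightarrow> norm (\<Sum>i=m..<n. dist (X i) (X (Suc i))) < e"
      using sm unfolding summable_Cauchy by blast
    have "dist (X m) (X n) < e" if "N \<le> m" "m \<le> n" for m n
      using le[OF that(2)] N[OF that(1), of n] by simp
    then show "\<exists>M. \<forall>m\<ge>M. \<forall>n\<ge>M. dist (X m) (X n) < e"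
      by (metis dist_commute linear)
  qed
qed

text \<open>Successive measures are joined by the density couplings; these are kernels, so the
  Ionescu-Tulcea theorem realizes the whole sequence by almost surely convergent variables.\<close>
lemma weak_limit_of_dual_Cauchy:
  fixes \<mu> :: "nat \<Rightarrow> 'a::polish_space measure" and c :: "nat \<Rightarrow> real"
  assumes prob: "\<And>n. prob_space (\<mu> n)" and sets: "\<And>n. sets (\<mu> n) = sets borel"
    and dual: "\<And>n f. bdist_lipschitz f \<Longrightarrow> (\<integral>x. f x \<partial>\<mu> n) - (\<integral>x. f x \<partial>\<mu> (Suc n)) \<le> c n"
    and c: "\<And>n. 0 \<le> c n" "summable c"
  obtains \<pi> where "prob_space \<pi>" "sets \<pi> = sets borel"
    and "\<And>f :: 'a \<Rightarrow> real. continuous_on UNIV f \<Longrightarrow> bounded (range f) \<Longrightarrow> (\<lambda>n. \<integral>x. f x \<partial>\<mu> n) \<longlonglongrightarrow> (\<integral>x. f x \<partial>\<pi>)"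
proof -
  \<comment> \<open>\<open>\<Phi>\<close> bundles the properties of a density coupling of
    consecutive laws, so that one can be chosen for every \<open>n\<close>; the slack
    \<open>(1 / 2) ^ n\<close> keeps the costs summable.\<close>
  define \<Phi> where "\<Phi> n k \<longleftrightarrow> case_prod k \<in> borel_measurable (borel \<Otimes>\<^sub>M borel) \<and> (\<forall>x. (\<integral>\<^sup>+y. k x y \<partial>\<mu> (Suc n)) = 1) \<and>
    (AE y in \<mu> (Suc n). (\<integral>\<^sup>+x. k x y \<partial>\<mu> n) = 1) \<and>
    (\<integral>\<^sup>+x. \<integral>\<^sup>+y. k x y * ennreal (bdist x y) \<partial>\<mu> (Suc n) \<partial>\<mu> n) \<le> ennreal (c n + (1 / 2) ^ n)"
    for n and k :: "'a \<Rightarrow> 'a \<Rightarrow> ennreal"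
  have "\<exists>k. \<Phi> n k" for n :: nat
  proof -
    obtain k where "\<Phi> n k"
    proof (rule kantorovich_rubinstein_density[OF prob[of n] sets[of n] prob[of "Suc n"] sets[of "Suc n"], of "c n" "(1 / 2) ^ n"])
      fix k :: "'a \<Rightarrow> 'a \<Rightarrow> ennreal"
      assume that: "\<And>k. \<Phi> n k \<Longrightarrow> thesis"
      assume "case_prod k \<in> borel_measurable (borel \<Otimes>\<^sub>M borel)" "\<And>x. (\<integral>\<^sup>+y. k x y \<partial>\<mu> (Suc n)) = 1"
        "AE y in \<mu> (Suc n). (\<integral>\<^sup>+x. k x y \<partial>\<mu> n) = 1"
        "(\<integral>\<^sup>+x. \<integral>\<^sup>+y. k x y * ennreal (bdist x y) \<partial>\<mu> (Suc n) \<partial>\<mu> n) \<le> ennreal (c n + (1 / 2) ^ n)"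
      then have "\<Phi> n k" by (simp add: \<Phi>_def)
      then show thesis by (rule that)
    qed (auto intro: dual)
    then show ?thesis by blast
  qed
  then obtain k where "\<And>n. \<Phi> n (k n)"
    by metis
  then have k: "case_prod (k n) \<in> borel_measurable (borel \<Otimes>\<^sub>M borel)"
    and k1: "(\<integral>\<^sup>+y. k n x y \<partial>\<mu> (Suc n)) = 1"
    and k2: "AE y in \<mu> (Suc n). (\<integral>\<^sup>+x. k n x y \<partial>\<mu> n) = 1"
    and kc: "(\<integral>\<^sup>+x. \<integral>\<^sup>+y. k n x y * ennreal (bdist x y) \<partial>\<mu> (Suc n) \<partial>\<mu> n) \<le> ennreal (c n + (1 / 2) ^ n)" for n x
    by (simp_all add: \<Phi>_def)
  note [measurable_cong] = sets
  have [simp]: "space (\<mu> n) = UNIV" for n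
    using sets[of n] by (auto dest: sets_eq_imp_space_eq)
  have sf: "sigma_finite_measure (\<mu> n)" for n
    using prob[of n] by (simp add: prob_space_imp_sigma_finite)
  have k_meas[measurable (raw)]: "(\<lambda>x. k n (f x) (g x)) \<in> borel_measurable N"
    if "f \<in> measurable N borel" "g \<in> measurable N borel" for f g n and N :: "'z measure"
    using measurable_compose[OF measurable_Pair[OF that] k] by simp
  have ident: "(\<lambda>x. x) \<in> measurable (\<mu> n) borel" for n
    by (rule measurable_ident_sets[OF sets])
  have k_section[measurable]: "k n x \<in> borel_measurable (\<mu> m)" for n x m
  proof -
    have "(\<lambda>y. k n x y) \<in> borel_measurable (\<mu> m)" by measurable
    then show ?thesis by simp
  qed
  \<comment> \<open>Conditional law of the next state. It depends on the preceding state only, but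
    is written as a kernel on the whole past, the form the Ionescu-Tulcea construction
    takes.\<close>
  define \<kappa> where "\<kappa> n \<omega> = (case n of 0 \<Rightarrow> \<mu> 0 | Suc m \<Rightarrow> density (\<mu> (Suc m)) (k m (\<omega> m)))"
    for n and \<omega> :: "nat \<Rightarrow> 'a"
  have prob_\<kappa>: "prob_space (\<kappa> n \<omega>)" for n \<omega>
  proof (cases n)
    case 0 then show ?thesis by (simp add: \<kappa>_def prob)
  next
    case (Suc m)
    have "emeasure (density (\<mu> (Suc m)) (k m (\<omega> m))) (space (density (\<mu> (Suc m)) (k m (\<omega> m)))) = 1"
      by (subst emeasure_density) (auto simp: k1)
    then show ?thesis using Suc by (auto simp: \<kappa>_def intro: prob_spaceI)
  qed
  interpret IT: Ionescu_Tulcea \<kappa> "\<lambda>_. borel :: 'a measure"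
  proof (rule Ionescu_Tulcea.intro)
    fix i
    show "\<kappa> i \<in> measurable (PiM {0..<i} (\<lambda>_. borel)) (subprob_algebra borel)"
    proof (rule measurable_subprob_algebra)
      show "subprob_space (\<kappa> i \<omega>)" for \<omega>
        by (intro prob_space_imp_subprob_space prob_\<kappa>)
      show "sets (\<kappa> i \<omega>) = sets borel" for \<omega>
        by (simp add: \<kappa>_def sets split: nat.split)
      fix A :: "'a set" assume [measurable]: "A \<in> sets borel"
      show "(\<lambda>\<omega>. emeasure (\<kappa> i \<omega>) A) \<in> borel_measurable (PiM {0..<i} (\<lambda>_. borel))"
      proof (cases i)
        case (Suc m)
        interpret sigma_finite_measure "\<mu> (Suc m)" by (rule sf)
        have [measurable]: "(\<lambda>\<omega>. \<omega> m) \<in> measurable (PiM {0..<i} (\<lambda>_. borel :: 'a measure)) borel"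
          using Suc by (intro measurable_component_singleton) auto
        have "emeasure (\<kappa> i \<omega>) A = (\<integral>\<^sup>+y. k m (\<omega> m) y * indicator A y \<partial>\<mu> (Suc m))" for \<omega>
          unfolding Suc \<kappa>_def by (simp add: emeasure_density sets)
        then show ?thesis by simp
      qed (simp add: \<kappa>_def)
    qed
  qed (rule prob_\<kappa>)
  define Q where "Q = IT.PF.lim"
  let ?C = "\<lambda>n. IT.C 0 n (\<lambda>_. undefined)"
  have und: "(\<lambda>_. undefined) \<in> space (PiM {0..<0} (\<lambda>_. borel :: 'a measure))"
    by (simp add: space_PiM PiE_iff extensional_def)
  have sets_C[measurable_cong]: "sets (?C n) = sets (PiM {0..<n} (\<lambda>_. borel))" for n
    using IT.sets_C[OF und, of n] by simp
  have comp[measurable]: "(\<lambda>\<omega>. \<omega> n) \<in> measurable (PiM {0..<m} (\<lambda>_. borel :: 'a measure)) borel" if "n < m" for n m :: nat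
    using that by (intro measurable_component_singleton) auto
  have C_Suc: "(\<integral>\<^sup>+\<omega>. g \<omega> \<partial>(?C (Suc n))) = (\<integral>\<^sup>+\<omega>. \<integral>\<^sup>+y. g (fun_upd \<omega> n y) \<partial>\<kappa> n \<omega> \<partial>(?C n))"
    if [measurable]: "g \<in> borel_measurable (PiM {0..<Suc n} (\<lambda>_. borel))" for g n
  proof -
    have "(\<integral>\<^sup>+\<omega>. g \<omega> \<partial>(?C (Suc n))) = (\<integral>\<^sup>+\<omega>. \<integral>\<^sup>+\<omega>'. g \<omega>' \<partial>IT.eP n \<omega> \<partial>(?C n))"
      using IT.measurable_eP[of n] by (simp add: nn_integral_bind[where B="PiM {0..<Suc n} (\<lambda>_. borel)"] measurable_cong_sets[OF sets_C refl])
    also have "\<dots> = (\<integral>\<^sup>+\<omega>. \<integral>\<^sup>+y. g (fun_upd \<omega> n y) \<partial>\<kappa> n \<omega> \<partial>(?C n))"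
      by (intro nn_integral_cong IT.nn_integral_eP) (auto simp: IT.space_C[OF und])
    finally show ?thesis .
  qed
  have C2: "(\<integral>\<^sup>+\<omega>. h (\<omega> n) (\<omega> (Suc n)) \<partial>(?C (Suc (Suc n)))) = (\<integral>\<^sup>+\<omega>. \<integral>\<^sup>+y. k n (\<omega> n) y * h (\<omega> n) y \<partial>\<mu> (Suc n) \<partial>(?C (Suc n)))"
    if h: "case_prod h \<in> borel_measurable (borel \<Otimes>\<^sub>M borel)" for h :: "'a \<Rightarrow> 'a \<Rightarrow> ennreal" and n
  proof -
    have h'[measurable (raw)]: "(\<lambda>x. h (f x) (g x)) \<in> borel_measurable N"
      if "f \<in> measurable N borel" "g \<in> measurable N borel" for f g and N :: "'z measure"
      using measurable_compose[OF measurable_Pair[OF that] h] by simp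
    have [measurable]: "h x \<in> borel_measurable (\<mu> m)" for x m
      using h'[OF _ ident, of "\<lambda>_. x"] by simp
    show ?thesis
      by (subst C_Suc) (auto simp: \<kappa>_def nn_integral_density)
  qed
  \<comment> \<open>The density couplings have the right second marginals, so the laws
    \<open>\<mu> n\<close> persist along the chain. Normalization of almost every column suffices
    here.\<close>
  have C1: "(\<integral>\<^sup>+\<omega>. h (\<omega> n) \<partial>(?C (Suc n))) = (\<integral>\<^sup>+x. h x \<partial>\<mu> n)"
    if [measurable]: "h \<in> borel_measurable borel" for h :: "'a \<Rightarrow> ennreal" and n
    using that
  proof (induction n arbitrary: h)
    case 0
    note [measurable] = 0
    interpret C0: prob_space "?C 0" by (rule IT.prob_space_C[OF und])
    show ?case
      by (subst C_Suc) (auto simp: \<kappa>_def C0.emeasure_space_1 simp del: IT.C.simps)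
  next
    case (Suc n)
    note [measurable] = Suc.prems
    interpret m1: sigma_finite_measure "\<mu> n" by (rule sf)
    interpret m2: sigma_finite_measure "\<mu> (Suc n)" by (rule sf)
    interpret pair_sigma_finite "\<mu> n" "\<mu> (Suc n)" ..
    have "(\<integral>\<^sup>+\<omega>. h (\<omega> (Suc n)) \<partial>(?C (Suc (Suc n)))) = (\<integral>\<^sup>+\<omega>. \<integral>\<^sup>+y. k n (\<omega> n) y * h y \<partial>\<mu> (Suc n) \<partial>(?C (Suc n)))"
      by (rule C2) measurable
    also have "\<dots> = (\<integral>\<^sup>+x. \<integral>\<^sup>+y. k n x y * h y \<partial>\<mu> (Suc n) \<partial>\<mu> n)"
      by (rule Suc.IH) measurable
    also have "\<dots> = (\<integral>\<^sup>+y. \<integral>\<^sup>+x. k n x y * h y \<partial>\<mu> n \<partial>\<mu> (Suc n))"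
      by (rule Fubini'[symmetric]) measurable
    also have "\<dots> = (\<integral>\<^sup>+y. (\<integral>\<^sup>+x. k n x y \<partial>\<mu> n) * h y \<partial>\<mu> (Suc n))"
    proof (intro nn_integral_cong nn_integral_multc)
      fix y show "(\<lambda>x. k n x y) \<in> borel_measurable (\<mu> n)"
        by (rule k_meas[OF ident]) simp
    qed
    also have "\<dots> = (\<integral>\<^sup>+y. h y \<partial>\<mu> (Suc n))"
      by (intro nn_integral_cong_AE) (use k2[of n] in auto)
    finally show ?case .
  qed
  have up_to: "IT.up_to {0..<n} = n" for n
    using IT.up_to_iff_Ico[of "{0..<n}"] by (metis IT.up_to finite_atLeastLessThan ivl_subset le_antisym le_zero_eq order_refl)
  have QC: "distr Q (PiM {0..<n} (\<lambda>_. borel)) (\<lambda>\<omega>. restrict \<omega> {0..<n}) = ?C n" for n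
    unfolding Q_def IT.distr_lim[OF finite_atLeastLessThan] IT.CI_def up_to
    using IT.distr_C[OF order_refl und, of n] by simp
  have sets_Q[measurable_cong]: "sets Q = sets (PiM UNIV (\<lambda>_. borel))"
    by (simp add: Q_def)
  have compQ[measurable]: "(\<lambda>\<omega>. \<omega> n) \<in> measurable Q borel" for n
    unfolding measurable_cong_sets[OF sets_Q refl] by (rule measurable_component_singleton) simp
  have restrQ[measurable]: "(\<lambda>\<omega>. restrict \<omega> {0..<n}) \<in> measurable Q (PiM {0..<n} (\<lambda>_. borel))" for n
    by (rule measurable_restrict) simp
  have Q1: "(\<integral>\<^sup>+\<omega>. h (\<omega> n) \<partial>Q) = (\<integral>\<^sup>+x. h x \<partial>\<mu> n)" if [measurable]: "h \<in> borel_measurable borel" for h n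
  proof -
    have "(\<integral>\<^sup>+x. h x \<partial>\<mu> n) = (\<integral>\<^sup>+\<omega>. h (\<omega> n) \<partial>distr Q (PiM {0..<Suc n} (\<lambda>_. borel)) (\<lambda>\<omega>. restrict \<omega> {0..<Suc n}))"
      unfolding QC by (rule C1[symmetric]) simp
    also have "\<dots> = (\<integral>\<^sup>+\<omega>. h (\<omega> n) \<partial>Q)"
      by (subst nn_integral_distr[OF restrQ]) simp_all
    finally show ?thesis by simp
  qed
  have Q2: "(\<integral>\<^sup>+\<omega>. ennreal (bdist (\<omega> n) (\<omega> (Suc n))) \<partial>Q) \<le> ennreal (c n + (1 / 2) ^ n)" for n
  proof -
    have "(\<integral>\<^sup>+\<omega>. ennreal (bdist (\<omega> n) (\<omega> (Suc n))) \<partial>Q)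
      = (\<integral>\<^sup>+\<omega>. ennreal (bdist (\<omega> n) (\<omega> (Suc n))) \<partial>distr Q (PiM {0..<Suc (Suc n)} (\<lambda>_. borel)) (\<lambda>\<omega>. restrict \<omega> {0..<Suc (Suc n)}))"
      by (subst nn_integral_distr[OF restrQ]) simp_all
    also have "\<dots> = (\<integral>\<^sup>+\<omega>. \<integral>\<^sup>+y. k n (\<omega> n) y * ennreal (bdist (\<omega> n) y) \<partial>\<mu> (Suc n) \<partial>(?C (Suc n)))"
      unfolding QC by (rule C2) measurable
    also have "\<dots> = (\<integral>\<^sup>+x. \<integral>\<^sup>+y. k n x y * ennreal (bdist x y) \<partial>\<mu> (Suc n) \<partial>\<mu> n)"
    proof (rule C1)
      interpret sigma_finite_measure "\<mu> (Suc n)" by (rule sf)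
      show "(\<lambda>x. \<integral>\<^sup>+y. k n x y * ennreal (bdist x y) \<partial>\<mu> (Suc n)) \<in> borel_measurable borel"
        by measurable
    qed
    also have "\<dots> \<le> ennreal (c n + (1 / 2) ^ n)" by (rule kc)
    finally show ?thesis .
  qed
  have "emeasure Q (space Q) = 1"
    using Q1[of "\<lambda>_. 1" 0] prob_space.emeasure_space_1[OF prob, of 0] by simp
  then interpret Q: prob_space Q ..
  have law: "distr Q borel (\<lambda>\<omega>. \<omega> n) = \<mu> n" for n
  proof (rule measure_eqI)
    fix A assume "A \<in> sets (distr Q borel (\<lambda>\<omega>. \<omega> n))"
    then have [measurable]: "A \<in> sets borel" by simp
    have "emeasure (distr Q borel (\<lambda>\<omega>. \<omega> n)) A = (\<integral>\<^sup>+\<omega>. indicator A (\<omega> n) \<partial>Q)"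
      by (rule emeasure_distr_eq_nn_integral) auto
    also have "\<dots> = emeasure (\<mu> n) A"
      by (subst Q1) (auto simp: sets)
    finally show "emeasure (distr Q borel (\<lambda>\<omega>. \<omega> n)) A = emeasure (\<mu> n) A" .
  qed (simp add: sets)
  have "(\<integral>\<^sup>+\<omega>. (\<Sum>n. ennreal (bdist (\<omega> n) (\<omega> (Suc n)))) \<partial>Q) = (\<Sum>n. \<integral>\<^sup>+\<omega>. ennreal (bdist (\<omega> n) (\<omega> (Suc n))) \<partial>Q)"
    by (rule nn_integral_suminf) measurable
  also have "\<dots> \<le> (\<Sum>n. ennreal (c n + (1 / 2) ^ n))"
    by (intro suminf_le Q2) auto
  also have "\<dots> = ennreal (\<Sum>n. c n + (1 / 2) ^ n)"
    using c by (intro suminf_ennreal2 summable_add) (auto intro: summable_geometric)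
  also have "\<dots> < \<infinity>" by simp
  finally have "AE \<omega> in Q. (\<Sum>n. ennreal (bdist (\<omega> n) (\<omega> (Suc n)))) \<noteq> \<infinity>"
    by (intro nn_integral_PInf_AE) auto
  \<comment> \<open>The expected total length of the path in \<open>bdist\<close> is finite, so
    almost every path has finite length.\<close>
  then have AE_Cauchy: "AE \<omega> in Q. Cauchy \<omega>"
  proof eventually_elim
    case (elim \<omega>)
    then have "summable (\<lambda>n. bdist (\<omega> n) (\<omega> (Suc n)))"
      by (intro summable_suminf_not_top) auto
    then show ?case by (rule Cauchy_of_summable_bdist)
  qed
  \<comment> \<open>Paths that are not Cauchy are frozen at a constant, so that the limit exists at
    every \<open>\<omega>\<close> and \<open>Z\<close> is measurable as a pointwise limit.\<close>
  define W where "W i \<omega> = (if Cauchy \<omega> then \<omega> i else undefined)" for i and \<omega> :: "nat \<Rightarrow> 'a"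
  define Z where "Z \<omega> = lim (\<lambda>i. W i \<omega>)" for \<omega>
  have W_lim: "(\<lambda>i. W i \<omega>) \<longlonglongrightarrow> Z \<omega>" for \<omega>
  proof -
    have "convergent (\<lambda>i. W i \<omega>)"
      by (cases "Cauchy \<omega>") (auto simp: W_def convergent_const Cauchy_convergent)
    then show ?thesis
      by (simp add: Z_def convergent_LIMSEQ_iff)
  qed
  have [measurable]: "W i \<in> measurable Q borel" for i
  proof -
    have "{\<omega>\<in>space Q. Cauchy (\<lambda>i. \<omega> i)} \<in> sets Q"
      by (rule sets_Collect_Cauchy) simp
    then have [measurable]: "Measurable.pred Q (\<lambda>\<omega>. Cauchy \<omega>)"
      by (simp add: pred_def)
    show ?thesis unfolding W_def by measurable
  qed
  have [measurable]: "Z \<in> measurable Q borel"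
    by (rule borel_measurable_LIMSEQ_metric[OF _ W_lim]) simp
  show ?thesis
  proof (rule that[of "distr Q borel Z"])
    show "prob_space (distr Q borel Z)"
      by (rule Q.prob_space_distr) simp
    fix f :: "'a \<Rightarrow> real" assume f: "continuous_on UNIV f" "bounded (range f)"
    then obtain B where B: "\<And>x. \<bar>f x\<bar> \<le> B"
      by (auto simp: bounded_iff)
    have [measurable]: "f \<in> borel_measurable borel"
      using f(1) by (rule borel_measurable_continuous_onI)
    have "(\<lambda>n. \<integral>\<omega>. f (\<omega> n) \<partial>Q) \<longlonglongrightarrow> (\<integral>\<omega>. f (Z \<omega>) \<partial>Q)"
    proof (rule integral_dominated_convergence[where w="\<lambda>_. B"])
      show "AE \<omega> in Q. (\<lambda>n. f (\<omega> n)) \<longlonglongrightarrow> f (Z \<omega>)"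
        using AE_Cauchy
      proof eventually_elim
        case (elim \<omega>)
        then have "\<omega> \<longlonglongrightarrow> Z \<omega>"
          using W_lim[of \<omega>] by (simp add: W_def)
        then show ?case
          using f(1) continuous_on_tendsto_compose[of UNIV f \<omega> "Z \<omega>" sequentially] by simp
      qed
    qed (use B in auto)
    moreover have "(\<integral>x. f x \<partial>\<mu> n) = (\<integral>\<omega>. f (\<omega> n) \<partial>Q)" for n
      by (subst law[symmetric]) (simp add: integral_distr)
    ultimately show "(\<lambda>n. \<integral>x. f x \<partial>\<mu> n) \<longlonglongrightarrow> (\<integral>x. f x \<partial>distr Q borel Z)"
      by (simp add: integral_distr)
  qed simp
qed

section \<open>From dual information back to measures and couplings\<close>

text \<open>Closed sets are an intersection-stable generator, and the indicator of a closed set is a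
  pointwise limit of Lipschitz functions of the distance to it.\<close>

lemma measure_eq_of_bdist_lipschitz:
  fixes \<mu> \<nu> :: "'a::polish_space measure"
  assumes \<mu>: "prob_space \<mu>" "sets \<mu> = sets borel" and \<nu>: "prob_space \<nu>" "sets \<nu> = sets borel"
    and eq: "\<And>f. bdist_lipschitz f \<Longrightarrow> (\<integral>x. f x \<partial>\<mu>) = (\<integral>x. f x \<partial>\<nu>)"
  shows "\<mu> = \<nu>"
proof -
  interpret \<mu>: prob_space \<mu> by fact
  interpret \<nu>: prob_space \<nu> by fact
  note [measurable_cong] = \<mu>(2) \<nu>(2)
  have closed: "measure \<mu> C = measure \<nu> C" if C: "closed C" for C :: "'a set"
  \<comment> \<open>\<open>infdist\<close> to the empty set is 0 by convention, so the approximation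
    below would converge to 1 instead of 0.\<close>
  proof (cases "C = {}")
    case False
    define f where "f n x = max 0 (1 - real n * infdist x C)" for n x
    have f01: "0 \<le> f n x" "f n x \<le> 1" for n x
      by (auto simp: f_def infdist_nonneg)
    have fm[measurable]: "f n \<in> borel_measurable borel" for n
      unfolding f_def by (intro borel_measurable_continuous_onI continuous_intros)
    have lim: "(\<lambda>n. f n x) \<longlonglongrightarrow> indicator C x" for x
    proof (cases "x \<in> C")
      case True
      then have "f n x = 1" for n by (simp add: f_def)
      with True show ?thesis by simp
    next
      case False
      then have "infdist x C > 0"
        using C \<open>C \<noteq> {}\<close> by (metis in_closed_iff_infdist_zero infdist_nonneg less_eq_real_def)
      then obtain N where N: "1 < real N * infdist x C"
        using reals_Archimedean3 by blast
      have "\<forall>\<^sub>F n in sequentially. f n x = indicator C x"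
        unfolding eventually_sequentially
      proof (intro exI[of _ N] allI impI)
        fix n assume "N \<le> n"
        then have "real N * infdist x C \<le> real n * infdist x C"
          by (intro mult_right_mono) (auto simp: infdist_nonneg)
        with N False show "f n x = indicator C x"
          by (simp add: f_def)
      qed
      then show ?thesis by (rule tendsto_eventually)
    qed
    \<comment> \<open>Slope \<open>n\<close> and oscillation 1 are both at most
      \<open>n + 1\<close>; the extra 1 keeps the divisor positive at \<open>n = 0\<close>.\<close>
    have lip: "bdist_lipschitz (\<lambda>x. f n x / (real n + 1))" for n
      unfolding bdist_lipschitz_def
    proof (intro allI)
      fix x y
      have "infdist y C \<le> infdist x C + dist x y" "infdist x C \<le> infdist y C + dist x y"
        using infdist_triangle[of y C x] infdist_triangle[of x C y] by (auto simp: dist_commute)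
      then have "\<bar>infdist x C - infdist y C\<bar> \<le> dist x y" by linarith
      then have "real n * \<bar>infdist x C - infdist y C\<bar> \<le> real n * dist x y"
        by (intro mult_left_mono) auto
      then have "\<bar>real n * infdist x C - real n * infdist y C\<bar> \<le> real n * dist x y"
        by (simp add: abs_mult right_diff_distrib[symmetric])
      then have "\<bar>f n x - f n y\<bar> \<le> real n * dist x y"
        unfolding f_def by linarith
      also have "\<dots> \<le> (real n + 1) * dist x y"
        by (intro mult_right_mono) auto
      finally have 1: "\<bar>f n x - f n y\<bar> \<le> (real n + 1) * dist x y" .
      have "\<bar>f n x - f n y\<bar> \<le> 1"
        using f01[of n x] f01[of n y] by linarith
      then have 2: "\<bar>f n x - f n y\<bar> \<le> (real n + 1) * 1"
        by simp
      have "\<bar>f n x / (real n + 1) - f n y / (real n + 1)\<bar> = \<bar>f n x - f n y\<bar> / (real n + 1)"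
        by (simp add: diff_divide_distrib[symmetric])
      then show "\<bar>f n x / (real n + 1) - f n y / (real n + 1)\<bar> \<le> bdist x y"
        using 1 2 by (simp add: pos_divide_le_eq mult.commute)
    qed
    have int_eq: "(\<integral>x. f n x \<partial>\<mu>) = (\<integral>x. f n x \<partial>\<nu>)" for n
      using eq[OF lip[of n]] by simp
    have L: "(\<lambda>n. \<integral>x. f n x \<partial>M) \<longlonglongrightarrow> measure M C" if M: "prob_space M" "sets M = sets borel" for M
    proof -
      interpret M: prob_space M by fact
      note [measurable_cong] = M(2)
      have [measurable]: "C \<in> sets borel" using C by simp
      have "space M = UNIV" using M(2) by (auto dest: sets_eq_imp_space_eq)
      then have "(\<integral>x. indicator C x \<partial>M) = measure M C" by simp
      moreover have "(\<lambda>n. \<integral>x. f n x \<partial>M) \<longlonglongrightarrow> (\<integral>x. indicator C x \<partial>M)"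
        using C f01 lim by (intro integral_dominated_convergence[where w="\<lambda>_. 1"]) auto
      ultimately show ?thesis by simp
    qed
    show ?thesis
      using L[OF \<mu>] L[OF \<nu>] unfolding int_eq by (rule LIMSEQ_unique)
  qed simp
  show ?thesis
  proof (rule measure_eqI_generator_eq[where E="Collect closed" and \<Omega>=UNIV and A="\<lambda>_. UNIV"])
    show "Int_stable (Collect closed :: 'a set set)"
      by (auto simp: Int_stable_def)
    show "sets \<mu> = sigma_sets UNIV (Collect closed)" "sets \<nu> = sigma_sets UNIV (Collect closed)"
      by (simp_all add: \<mu> \<nu> borel_eq_closed)
    show "emeasure \<mu> X = emeasure \<nu> X" if "X \<in> Collect closed" for X
      using closed that by (simp add: \<mu>.emeasure_eq_measure \<nu>.emeasure_eq_measure)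
  qed auto
qed

text \<open>A density coupling costs at most \<open>c + e\<close>; since the distance is an infimum,
  letting \<open>e\<close> tend to 0 suffices and no optimal coupling is constructed.\<close>

lemma wasserstein_le_dual:
  fixes \<mu> \<nu> :: "'a::polish_space measure"
  assumes \<mu>: "prob_space \<mu>" "sets \<mu> = sets borel" and \<nu>: "prob_space \<nu>" "sets \<nu> = sets borel"
    and dual: "\<And>f. bdist_lipschitz f \<Longrightarrow> (\<integral>x. f x \<partial>\<mu>) - (\<integral>x. f x \<partial>\<nu>) \<le> c"
  shows "wasserstein (\<lambda>x y. min (dist x y) 1) \<mu> \<nu> \<le> ennreal c"
proof (rule ennreal_le_epsilon)
  fix e :: real assume e: "0 < e"
  interpret \<mu>: prob_space \<mu> by fact
  interpret \<nu>: prob_space \<nu> by fact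
  interpret \<mu>\<nu>: pair_sigma_finite \<mu> \<nu> ..
  note [measurable_cong] = \<mu>(2) \<nu>(2)
  have [simp]: "space \<mu> = UNIV" "space \<nu> = UNIV"
    using \<mu>(2) \<nu>(2) by (auto dest: sets_eq_imp_space_eq)
  have c: "c \<ge> 0"
    using dual[of "\<lambda>_. 0"] by (simp add: bdist_lipschitz_def)
  obtain k where k: "case_prod k \<in> borel_measurable (borel \<Otimes>\<^sub>M borel)"
    and k1: "\<And>x. (\<integral>\<^sup>+y. k x y \<partial>\<nu>) = 1" and k2: "AE y in \<nu>. (\<integral>\<^sup>+x. k x y \<partial>\<mu>) = 1"
    and kc: "(\<integral>\<^sup>+x. \<integral>\<^sup>+y. k x y * ennreal (bdist x y) \<partial>\<nu> \<partial>\<mu>) \<le> ennreal (c + e)"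
    using kantorovich_rubinstein_density[OF \<mu> \<nu> dual e] by blast
  have k_meas[measurable (raw)]: "(\<lambda>x. k (f x) (g x)) \<in> borel_measurable N"
    if "f \<in> measurable N borel" "g \<in> measurable N borel" for f g and N :: "'z measure"
    using measurable_compose[OF measurable_Pair[OF that] k] by simp
  define cpl where "cpl = density (\<mu> \<Otimes>\<^sub>M \<nu>) (case_prod k)"
  have sets_cpl[measurable_cong]: "sets cpl = sets (borel \<Otimes>\<^sub>M borel)"
    by (simp add: cpl_def \<mu> \<nu> cong: sets_pair_measure_cong)
  have int: "(\<integral>\<^sup>+p. g (fst p) (snd p) \<partial>cpl) = (\<integral>\<^sup>+x. \<integral>\<^sup>+y. k x y * g x y \<partial>\<nu> \<partial>\<mu>)"
    if g: "case_prod g \<in> borel_measurable (borel \<Otimes>\<^sub>M borel)" for g :: "'a \<Rightarrow> 'a \<Rightarrow> ennreal"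
  proof -
    have [measurable (raw)]: "(\<lambda>x. g (f x) (h x)) \<in> borel_measurable N"
      if "f \<in> measurable N borel" "h \<in> measurable N borel" for f h and N :: "'z measure"
      using measurable_compose[OF measurable_Pair[OF that] g] by simp
    have "(\<integral>\<^sup>+p. g (fst p) (snd p) \<partial>cpl) = (\<integral>\<^sup>+p. k (fst p) (snd p) * g (fst p) (snd p) \<partial>(\<mu> \<Otimes>\<^sub>M \<nu>))"
      unfolding cpl_def by (subst nn_integral_density) (auto simp: case_prod_beta')
    also have "\<dots> = (\<integral>\<^sup>+x. \<integral>\<^sup>+y. k x y * g x y \<partial>\<nu> \<partial>\<mu>)"
      by (subst \<nu>.nn_integral_fst[symmetric]) auto
    finally show ?thesis .
  qed
  have fst_int: "(\<integral>\<^sup>+p. f (fst p) \<partial>cpl) = (\<integral>\<^sup>+x. f x \<partial>\<mu>)" if [measurable]: "f \<in> borel_measurable borel" for f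
  proof -
    have "(\<integral>\<^sup>+p. f (fst p) \<partial>cpl) = (\<integral>\<^sup>+x. \<integral>\<^sup>+y. k x y * f x \<partial>\<nu> \<partial>\<mu>)"
      by (rule int) measurable
    also have "\<dots> = (\<integral>\<^sup>+x. f x \<partial>\<mu>)"
      by (intro nn_integral_cong) (simp add: nn_integral_multc k1)
    finally show ?thesis .
  qed
  have snd_int: "(\<integral>\<^sup>+p. f (snd p) \<partial>cpl) = (\<integral>\<^sup>+y. f y \<partial>\<nu>)" if [measurable]: "f \<in> borel_measurable borel" for f
  proof -
    have "(\<integral>\<^sup>+p. f (snd p) \<partial>cpl) = (\<integral>\<^sup>+x. \<integral>\<^sup>+y. k x y * f y \<partial>\<nu> \<partial>\<mu>)"
      by (rule int) measurable
    also have "\<dots> = (\<integral>\<^sup>+y. \<integral>\<^sup>+x. k x y * f y \<partial>\<mu> \<partial>\<nu>)"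
      by (rule \<mu>\<nu>.Fubini'[symmetric]) measurable
    also have "\<dots> = (\<integral>\<^sup>+y. (\<integral>\<^sup>+x. k x y \<partial>\<mu>) * f y \<partial>\<nu>)"
      by (intro nn_integral_cong nn_integral_multc) measurable
    also have "\<dots> = (\<integral>\<^sup>+y. f y \<partial>\<nu>)"
      by (intro nn_integral_cong_AE) (use k2 in auto)
    finally show ?thesis .
  qed
  have "emeasure cpl (space cpl) = 1"
    using fst_int[of "\<lambda>_. 1"] \<mu>.emeasure_space_1 by simp
  then have "prob_space cpl" ..
  moreover have "distr cpl borel fst = \<mu>"
    by (rule measure_eqI)
       (use fst_int[of "indicator _"] in \<open>auto simp: \<mu> emeasure_distr_eq_nn_integral measurable_cong_sets[OF sets_cpl refl]\<close>)
  moreover have "distr cpl borel snd = \<nu>"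
    by (rule measure_eqI)
       (use snd_int[of "indicator _"] in \<open>auto simp: \<nu> emeasure_distr_eq_nn_integral measurable_cong_sets[OF sets_cpl refl]\<close>)
  ultimately have "coupling \<mu> \<nu> cpl"
    by (simp add: coupling_def sets_cpl)
  then have "wasserstein (\<lambda>x y. min (dist x y) 1) \<mu> \<nu> \<le> (\<integral>\<^sup>+p. ennreal (bdist (fst p) (snd p)) \<partial>cpl)"
    unfolding wasserstein_def by (intro INF_lower) simp
  also have "\<dots> = (\<integral>\<^sup>+x. \<integral>\<^sup>+y. k x y * ennreal (bdist x y) \<partial>\<nu> \<partial>\<mu>)"
    by (rule int) measurable
  also have "\<dots> \<le> ennreal (c + e)" by (rule kc)
  also have "\<dots> = ennreal c + ennreal e"
    using c e by simp
  finally show "wasserstein (\<lambda>x y. min (dist x y) 1) \<mu> \<nu> \<le> ennreal c + ennreal e" .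
qed

section \<open>Semigroups with a Lyapunov function\<close>

text \<open>The class in which the contraction argument runs: every \<open>P t\<close> preserves it,
  whereas a Lipschitz test function may leave its own class.\<close>

definition bounded_borel :: "('a::topological_space \<Rightarrow> real) \<Rightarrow> bool" where
  "bounded_borel f \<longleftrightarrow> f \<in> borel_measurable borel \<and> (\<exists>B. \<forall>x. \<bar>f x\<bar> \<le> B)"

lemma bdist_lipschitz_bounded_borel: "bdist_lipschitz f \<Longrightarrow> bounded_borel f"
  unfolding bounded_borel_def using bdist_lipschitz_measurable bdist_lipschitz_bounded by blast

lemma integrable_bounded_borel':
  "prob_space M \<Longrightarrow> sets M = sets borel \<Longrightarrow> bounded_borel f \<Longrightarrow> integrable M f"
  unfolding bounded_borel_def using integrable_bounded_borel by blast

lemma ennreal_affine: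
  "0 \<le> a \<Longrightarrow> 0 \<le> b \<Longrightarrow> 0 \<le> c \<Longrightarrow> ennreal a * ennreal b + ennreal c = ennreal (a * b + c)"
  by (simp add: ennreal_mult)

locale markov_semigroup =
  fixes P :: "real \<Rightarrow> 'a::polish_space \<Rightarrow> 'a measure"
  assumes markov: "markov_transition P"
begin

lemma prob_P: "0 \<le> t \<Longrightarrow> prob_space (P t x)"
  and sets_P[simp]: "0 \<le> t \<Longrightarrow> sets (P t x) = sets borel"
  and P_0: "P 0 x = return borel x"
  using markov unfolding markov_transition_def by auto

lemma space_P[simp]: "0 \<le> t \<Longrightarrow> space (P t x) = UNIV"
  using sets_P[THEN sets_eq_imp_space_eq] by simp

lemma kernel_P: "0 \<le> t \<Longrightarrow> P t \<in> measurable borel (subprob_algebra borel)"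
  using markov prob_P unfolding markov_transition_def
  by (intro measurable_subprob_algebra) (auto intro: prob_space_imp_subprob_space)

lemma chapman_kolmogorov:
  assumes "0 \<le> s" "0 \<le> t"
  shows "P (s + t) x = P s x \<bind> P t"
proof (rule measure_eqI)
  have k: "P t \<in> measurable (P s x) (subprob_algebra borel)"
    using kernel_P[OF assms(2)] assms by (simp cong: measurable_cong_sets)
  show "sets (P (s + t) x) = sets (P s x \<bind> P t)"
    using assms by (subst sets_bind[where N=borel]) auto
  fix A assume "A \<in> sets (P (s + t) x)"
  then have "A \<in> sets borel" using assms by simp
  then show "emeasure (P (s + t) x) A = emeasure (P s x \<bind> P t) A"
    using markov assms unfolding markov_transition_def by (subst emeasure_bind[OF _ k]) auto
qed

lemma nn_integral_chapman:
  assumes "0 \<le> s" "0 \<le> t" "f \<in> borel_measurable borel"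
  shows "(\<integral>\<^sup>+y. f y \<partial>P (s + t) x) = (\<integral>\<^sup>+y. \<integral>\<^sup>+z. f z \<partial>P t y \<partial>P s x)"
  unfolding chapman_kolmogorov[OF assms(1,2)]
  using kernel_P[OF assms(2)] assms by (intro nn_integral_bind[where B=borel]) (auto cong: measurable_cong_sets)

lemma integrable_P: "0 \<le> t \<Longrightarrow> bounded_borel f \<Longrightarrow> integrable (P t x) f"
  by (intro integrable_bounded_borel' prob_P sets_P)

lemma abs_semigroup_le:
  assumes "0 \<le> t" "bounded_borel f" "\<And>y. \<bar>f y - a\<bar> \<le> B"
  shows "\<bar>semigroup P t f x - a\<bar> \<le> B"
proof -
  interpret prob_space "P t x" by (rule prob_P[OF assms(1)])
  note int = integrable_P[OF assms(1,2), of x]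
  have 1: "f y \<le> a + B" "a - B \<le> f y" for y
    using assms(3)[of y] by linarith+
  have "(\<integral>y. f y \<partial>P t x) \<le> a + B" "a - B \<le> (\<integral>y. f y \<partial>P t x)"
    by (rule integral_le_const integral_ge_const, use int 1 in auto)+
  then show ?thesis unfolding semigroup_def by linarith
qed

lemma semigroup_bounded_borel:
  assumes "0 \<le> t" "bounded_borel f"
  shows "bounded_borel (semigroup P t f)"
proof -
  obtain B where "\<And>x. \<bar>f x\<bar> \<le> B" using assms(2) unfolding bounded_borel_def by blast
  then have "\<bar>semigroup P t f x\<bar> \<le> B" for x
    using abs_semigroup_le[OF assms, of 0 B x] by simp
  moreover have "semigroup P t f \<in> borel_measurable borel"
    unfolding semigroup_def
    using assms kernel_P[OF assms(1)] by (intro measurable_compose[OF _ integral_measurable_subprob_algebra]) (auto simp: bounded_borel_def)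
  ultimately show ?thesis unfolding bounded_borel_def by blast
qed

text \<open>Adding the bound \<open>B\<close> makes all integrands nonnegative, which reduces the
  claim to disintegration of nonnegative integrals along \<open>\<bind>\<close>. All values are
  finite, so \<open>B\<close> cancels again.\<close>

lemma integral_bind_P:
  assumes \<mu>: "prob_space \<mu>" "sets \<mu> = sets borel" and t: "0 \<le> t" and f: "bounded_borel f"
  shows "(\<integral>y. f y \<partial>(\<mu> \<bind> P t)) = (\<integral>x. semigroup P t f x \<partial>\<mu>)"
proof -
  have k: "P t \<in> measurable \<mu> (subprob_algebra borel)"
    using kernel_P[OF t] \<mu>(2) by (simp cong: measurable_cong_sets)
  have sp: "space \<mu> = UNIV" using \<mu>(2) by (auto dest: sets_eq_imp_space_eq)
  have bind: "prob_space (\<mu> \<bind> P t)" "sets (\<mu> \<bind> P t) = sets borel"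
    using t sp \<mu> k prob_P by (auto intro!: prob_space.prob_space_bind[OF \<mu>(1), where S=borel] sets_bind[where N=borel])
  obtain B where B: "\<And>x. \<bar>f x\<bar> \<le> B" and fm[measurable]: "f \<in> borel_measurable borel"
    using f unfolding bounded_borel_def by blast
  have pos: "0 \<le> f x + B" for x
    using B[of x] by linarith
  have shift: "(\<integral>\<^sup>+y. ennreal (g y + B) \<partial>M) = ennreal ((\<integral>y. g y \<partial>M) + B)" "0 \<le> (\<integral>y. g y \<partial>M) + B"
    if M: "prob_space M" "sets M = sets borel" and g: "bounded_borel g" "\<And>y. 0 \<le> g y + B" for M g
  proof -
    interpret prob_space M by fact
    note int = integrable_bounded_borel'[OF M g(1)]
    have eq: "(\<integral>y. g y + B \<partial>M) = (\<integral>y. g y \<partial>M) + B"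
      using int prob_space by simp
    show "(\<integral>\<^sup>+y. ennreal (g y + B) \<partial>M) = ennreal ((\<integral>y. g y \<partial>M) + B)"
      using int g(2) unfolding eq[symmetric] by (intro nn_integral_eq_integral) auto
    have "0 \<le> (\<integral>y. g y + B \<partial>M)"
      using g(2) by (intro integral_nonneg_AE) auto
    then show "0 \<le> (\<integral>y. g y \<partial>M) + B" by (simp only: eq)
  qed
  have sg: "0 \<le> semigroup P t f y + B" for y
    using abs_semigroup_le[OF t f, of 0 B y] B by (simp add: abs_le_iff)
  have "ennreal ((\<integral>y. f y \<partial>(\<mu> \<bind> P t)) + B) = (\<integral>\<^sup>+y. ennreal (f y + B) \<partial>(\<mu> \<bind> P t))"
    by (rule shift(1)[OF bind f pos, symmetric])
  also have "\<dots> = (\<integral>\<^sup>+x. \<integral>\<^sup>+y. ennreal (f y + B) \<partial>P t x \<partial>\<mu>)"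
    by (rule nn_integral_bind[OF _ k]) simp
  also have "\<dots> = (\<integral>\<^sup>+x. ennreal (semigroup P t f x + B) \<partial>\<mu>)"
    unfolding semigroup_def by (intro nn_integral_cong shift(1) prob_P sets_P t f pos)
  also have "\<dots> = ennreal ((\<integral>x. semigroup P t f x \<partial>\<mu>) + B)"
    by (rule shift(1)[OF \<mu> semigroup_bounded_borel[OF t f] sg])
  finally show ?thesis
    using shift(2)[OF bind f pos] shift(2)[OF \<mu> semigroup_bounded_borel[OF t f] sg] by (simp add: ennreal_inj)
qed

lemma semigroup_add:
  assumes "0 \<le> s" "0 \<le> t" "bounded_borel f"
  shows "semigroup P (s + t) f x = semigroup P s (semigroup P t f) x"
  using integral_bind_P[OF prob_P sets_P assms(2,3), of s x] assms(1)
  unfolding semigroup_def[of P "s + t"] semigroup_def[of P s] chapman_kolmogorov[OF assms(1,2)] by simp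

lemma semigroup_0: "bounded_borel f \<Longrightarrow> semigroup P 0 f x = f x"
  unfolding semigroup_def P_0 bounded_borel_def by (subst integral_return) auto

end

text \<open>The drift is stated with extended nonnegative integrals; finiteness of the mean of
  \<open>V\<close> is then a consequence of the finite right-hand side.\<close>

locale lyapunov_semigroup = markov_semigroup P
  for P :: "real \<Rightarrow> 'a::polish_space \<Rightarrow> 'a measure" +
  fixes V :: "'a \<Rightarrow> real" and \<gamma> K :: real
  assumes V_meas[measurable]: "V \<in> borel_measurable borel" and V_nonneg: "0 \<le> V x"
    and \<gamma>_pos: "\<gamma> > 0" and K_pos: "K > 0"
    and lyap: "0 \<le> t \<Longrightarrow> (\<integral>\<^sup>+ y. ennreal (V y) \<partial>P t x)
                 + ennreal \<gamma> * (\<integral>\<^sup>+ s\<in>{0..t}. (\<integral>\<^sup>+ y. ennreal (V y) \<partial>P s x) \<partial>lborel)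
               \<le> ennreal (V x + K * t)"
begin

definition PV :: "real \<Rightarrow> 'a \<Rightarrow> ennreal" where
  "PV t x = (\<integral>\<^sup>+ y. ennreal (V y) \<partial>P t x)"

lemma PV_le_add: "0 \<le> t \<Longrightarrow> PV t x \<le> ennreal (V x + K * t)"
  unfolding PV_def by (rule order_trans[OF add_increasing2[OF zero_le order_refl] lyap])

text \<open>By Chapman-Kolmogorov an affine bound at time \<open>t\<close> may be averaged over the
  state at time \<open>s\<close>. Slope 1 gives the monotonicity of \<open>PV t - K t\<close>, slope
  below 1 the geometric iteration.\<close>

lemma PV_affine_bound:
  assumes "0 \<le> s" "0 \<le> t" and q: "0 \<le> q" "0 \<le> b" and le: "\<And>y. PV t y \<le> ennreal (q * V y + b)"
  shows "PV (s + t) x \<le> ennreal q * PV s x + ennreal b"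
proof -
  interpret prob_space "P s x" by (rule prob_P[OF assms(1)])
  have [measurable_cong]: "sets (P s x) = sets borel" using assms by simp
  have "PV (s + t) x = (\<integral>\<^sup>+y. PV t y \<partial>P s x)"
    unfolding PV_def using assms by (intro nn_integral_chapman) auto
  also have "\<dots> \<le> (\<integral>\<^sup>+y. ennreal (q * V y + b) \<partial>P s x)"
    by (intro nn_integral_mono le)
  also have "\<dots> = (\<integral>\<^sup>+y. ennreal q * ennreal (V y) + ennreal b \<partial>P s x)"
    using q V_nonneg by (intro nn_integral_cong) (simp add: ennreal_mult)
  also have "\<dots> = ennreal q * PV s x + ennreal b"
    unfolding PV_def by (subst nn_integral_add) (auto simp: nn_integral_cmult emeasure_space_1)
  finally show ?thesis .
qed

text \<open>No regularity in time is assumed, so the time integral is only a lower integral; since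
  \<open>PV t - K t\<close> is nonincreasing in \<open>t\<close>, it is bounded below by its integrand at the endpoint.\<close>
lemma PV_step:
  assumes h: "0 < h"
  shows "PV h x \<le> ennreal (V x / (1 + \<gamma> * h) + K * h)"
proof -
  have "PV h x < \<infinity>"
    using PV_le_add[of h x] h by (auto intro: le_less_trans)
  then obtain v where v: "0 \<le> v" "PV h x = ennreal v"
    by (cases "PV h x") auto
  have gh: "0 < \<gamma> * h" using h \<gamma>_pos by simp
  have "v \<le> V x / (1 + \<gamma> * h) + K * h"
  proof (cases "v \<le> K * h")
    case True
    then show ?thesis using V_nonneg[of x] gh by (simp add: add_increasing)
  next
    case False
    have low: "ennreal (v - K * h) \<le> PV s x" if s: "s \<in> {0..h}" for s
    proof -
      have "PV h x \<le> ennreal 1 * PV s x + ennreal (K * (h - s))"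
        using PV_affine_bound[of s "h - s" 1 "K * (h - s)" x] PV_le_add[of "h - s"] s K_pos by simp
      also have "\<dots> \<le> PV s x + ennreal (K * h)"
        using s K_pos by (intro add_mono ennreal_leI mult_left_mono) auto
      finally have *: "ennreal v \<le> PV s x + ennreal (K * h)"
        by (simp add: v)
      show ?thesis
      proof (cases "PV s x")
        case (real w)
        then have "v \<le> w + K * h"
          using * K_pos h by (simp flip: ennreal_plus)
        then show ?thesis using real by (simp add: ennreal_leI)
      qed simp
    qed
    have "ennreal (v - K * h) * ennreal h = (\<integral>\<^sup>+s\<in>{0..h}. ennreal (v - K * h) \<partial>lborel)"
      using h by (simp add: nn_integral_cmult_indicator)
    also have "\<dots> \<le> (\<integral>\<^sup>+s\<in>{0..h}. PV s x \<partial>lborel)"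
      using low by (intro nn_integral_mono) (auto split: split_indicator)
    finally have "ennreal v + ennreal \<gamma> * (ennreal (v - K * h) * ennreal h) \<le> ennreal (V x + K * h)"
      using lyap[of h x] h unfolding PV_def[symmetric] v(2)
      by (meson add_left_mono mult_left_mono order_trans zero_le less_imp_le)
    moreover have "ennreal v + ennreal \<gamma> * (ennreal (v - K * h) * ennreal h) = ennreal (v + \<gamma> * ((v - K * h) * h))"
      using v h \<gamma>_pos False by (simp add: ennreal_mult ennreal_plus)
    ultimately have "ennreal (v + \<gamma> * ((v - K * h) * h)) \<le> ennreal (V x + K * h)"
      by (simp only:)
    then have "v + \<gamma> * ((v - K * h) * h) \<le> V x + K * h"
      by (subst (asm) ennreal_le_iff) (use V_nonneg[of x] K_pos h in auto)
    \<comment> \<open>An implicit Euler step: dissipation is evaluated at the endpoint, whence the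
      factor \<open>1 / (1 + \<gamma> * h)\<close>.\<close>
    then have "(v - K * h) * (1 + \<gamma> * h) \<le> V x"
      by (simp add: algebra_simps)
    then have "v - K * h \<le> V x / (1 + \<gamma> * h)"
      using gh by (simp add: pos_le_divide_eq)
    then show ?thesis by simp
  qed
  then show ?thesis unfolding v(2) by (rule ennreal_leI)
qed

text \<open>\<open>K / \<gamma> * (1 + \<gamma> * h)\<close> is the fixed point of the affine map in
  \<open>PV_step\<close>; it is reproduced at each step while the remainder contracts
  geometrically.\<close>

lemma PV_iterate:
  assumes h: "0 < h"
  shows "PV (real n * h) x \<le> ennreal (V x / (1 + \<gamma> * h) ^ n + K / \<gamma> * (1 + \<gamma> * h))"
proof (induction n)
  case 0
  have "PV 0 x = ennreal (V x)"
    unfolding PV_def P_0 by (simp add: nn_integral_return)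
  also have "\<dots> \<le> ennreal (V x + K / \<gamma> * (1 + \<gamma> * h))"
    using h \<gamma>_pos K_pos by (intro ennreal_leI) simp
  finally show ?case by simp
next
  case (Suc n)
  have q: "0 < 1 + \<gamma> * h" using h \<gamma>_pos by (simp add: add_pos_pos)
  have "PV (real (Suc n) * h) x = PV (real n * h + h) x"
    by (simp add: algebra_simps)
  also have "\<dots> \<le> ennreal (1 / (1 + \<gamma> * h)) * PV (real n * h) x + ennreal (K * h)"
    using h K_pos q PV_step[OF h] by (intro PV_affine_bound) auto
  also have "\<dots> \<le> ennreal (1 / (1 + \<gamma> * h)) * ennreal (V x / (1 + \<gamma> * h) ^ n + K / \<gamma> * (1 + \<gamma> * h)) + ennreal (K * h)"
    by (intro add_right_mono mult_left_mono Suc.IH) simp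
  also have "\<dots> = ennreal (1 / (1 + \<gamma> * h) * (V x / (1 + \<gamma> * h) ^ n + K / \<gamma> * (1 + \<gamma> * h)) + K * h)"
    using q V_nonneg[of x] K_pos \<gamma>_pos h by (intro ennreal_affine add_nonneg_nonneg) auto
  also have "1 / (1 + \<gamma> * h) * (V x / (1 + \<gamma> * h) ^ n + K / \<gamma> * (1 + \<gamma> * h)) + K * h
    = V x / (1 + \<gamma> * h) ^ Suc n + K / \<gamma> * (1 + \<gamma> * h)"
  proof -
    have "1 / Q * (V x / Q ^ n + K / \<gamma> * Q) = V x / Q ^ Suc n + K / \<gamma>" if "0 < Q" for Q
      using that by (simp add: distrib_left)
    note this[OF q]
    moreover have "K / \<gamma> * (1 + \<gamma> * h) = K / \<gamma> + K * h"
      using \<gamma>_pos by (simp add: distrib_left)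
    ultimately show ?thesis by linarith
  qed
  finally show ?case .
qed

text \<open>A single step of length \<open>T\<close> would leave the term \<open>K * T\<close>.
  Subdividing makes the additive constant independent of \<open>T\<close>, and Bernoulli's
  inequality retains the factor \<open>1 / (1 + \<gamma> * T)\<close>.\<close>

lemma PV_drift:
  assumes T: "0 < T"
  shows "PV T x \<le> ennreal (V x / (1 + \<gamma> * T) + 5 * K / (4 * \<gamma>))"
proof -
  \<comment> \<open>Steps of length at most \<open>1 / (4 * \<gamma>)\<close> bound the fixed point
    of the iteration by \<open>5 / 4 * K / \<gamma>\<close>.\<close>
  obtain m :: nat where m: "4 * \<gamma> * T < real m"
    using reals_Archimedean2 by blast
  have m0: "0 < real m"
    using m T \<gamma>_pos by (smt (verit) mult_pos_pos)
  define h where "h = T / real m"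
  have h: "0 < h" "real m * h = T" "\<gamma> * h \<le> 1 / 4"
    using m m0 T by (auto simp: h_def field_simps)
  have "1 + \<gamma> * T \<le> (1 + \<gamma> * h) ^ m"
    using Bernoulli_inequality[of "\<gamma> * h" m] h \<gamma>_pos by (simp add: mult.left_commute[of _ \<gamma>] order_trans[of _ 0])
  then have 1: "V x / (1 + \<gamma> * h) ^ m \<le> V x / (1 + \<gamma> * T)"
    using V_nonneg[of x] \<gamma>_pos T by (intro divide_left_mono) (auto intro!: mult_pos_pos add_pos_pos zero_less_power simp: h(1))
  have 2: "K / \<gamma> * (1 + \<gamma> * h) \<le> 5 * K / (4 * \<gamma>)"
  proof -
    have "K / \<gamma> * (1 + \<gamma> * h) \<le> K / \<gamma> * (5 / 4)"
      using h K_pos \<gamma>_pos by (intro mult_left_mono) auto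
    then show ?thesis by (simp add: mult.commute)
  qed
  show ?thesis
    using PV_iterate[OF h(1), of m x] unfolding h(2)
    by (rule order_trans) (intro ennreal_leI add_mono 1 2)
qed

lemma PV_bound:
  assumes "0 \<le> T"
  shows "PV T x \<le> ennreal (V x + 5 * K / (4 * \<gamma>))"
proof (cases "T = 0")
  case True
  have "PV 0 x = ennreal (V x)"
    unfolding PV_def P_0 by (simp add: nn_integral_return)
  with True show ?thesis using K_pos \<gamma>_pos by (simp add: ennreal_leI)
next
  case False
  with assms have "0 < T" by simp
  then show ?thesis
    using divide_left_mono[of 1 "1 + \<gamma> * T" "V x"] V_nonneg[of x] add_pos_pos[OF zero_less_one mult_pos_pos[OF \<gamma>_pos]] \<gamma>_pos
    by (intro order_trans[OF PV_drift] ennreal_leI) auto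
qed

end

section \<open>Estimates along a coupling\<close>

text \<open>A cylinder with the single entry \<open>(t, A)\<close> is the event that the process
  lies in \<open>A\<close> at time \<open>t\<close>.\<close>

lemma law_is_markov_distr:
  assumes "markov_semigroup P" "law_is_markov P x M X" "0 \<le> t"
  shows "distr M borel (X t) = P t x"
proof (rule measure_eqI)
  interpret markov_semigroup P by fact
  show "sets (distr M borel (X t)) = sets (P t x)" using assms(3) by simp
  have X: "X t \<in> measurable M borel"
    using assms unfolding law_is_markov_def by blast
  fix A assume "A \<in> sets (distr M borel (X t))"
  then have A: "A \<in> sets borel" by simp
  have "emeasure M {\<omega>\<in>space M. \<forall>i<length [(t, A)]. X (\<Sum>j\<le>i. fst ([(t, A)] ! j)) \<omega> \<in> snd ([(t, A)] ! i)}
      = markov_cyl P [(t, A)] x"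
    using assms(2)[unfolded law_is_markov_def, THEN conjunct2, THEN spec[of _ "[(t, A)]"]] A assms(3) by simp
  then have "emeasure M {\<omega>\<in>space M. X t \<omega> \<in> A} = (\<integral>\<^sup>+y. indicator A y \<partial>P t x)"
    by simp
  then show "emeasure (distr M borel (X t)) A = emeasure (P t x) A"
    using X A assms(3) by (simp add: emeasure_distr vimage_def Int_def conj_commute)
qed

text \<open>Cauchy-Schwarz along the coupling, in the linear form of the arithmetic-geometric mean
  inequality with a parameter \<open>s\<close>. Upper bounds on the means of \<open>d\<close> and
  \<open>V\<close> can then be inserted directly.\<close>

lemma coupling_dual_bound:
  fixes V :: "'a::polish_space \<Rightarrow> real" and d :: "'a \<Rightarrow> 'a \<Rightarrow> real"
  assumes cpl: "coupling \<mu> \<nu> cpl" and f: "bounded_borel f"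
    and V[measurable]: "V \<in> borel_measurable borel" and V0: "\<And>x. 0 \<le> V x"
    and d: "case_prod d \<in> borel_measurable (borel \<Otimes>\<^sub>M borel)" "\<And>x y. 0 \<le> d x y"
    and c: "0 \<le> c" and \<beta>: "0 \<le> \<beta>"
    and osc: "\<And>x y. \<bar>f x - f y\<bar> \<le> c * sqrt (d x y * (1 + \<beta> * V x + \<beta> * V y))"
    and w: "0 < w" "(\<integral>\<^sup>+p. ennreal (d (fst p) (snd p)) \<partial>cpl) \<le> ennreal w"
    and A: "0 \<le> A" "(\<integral>\<^sup>+x. ennreal (V x) \<partial>\<mu>) \<le> ennreal A" and B: "0 \<le> B" "(\<integral>\<^sup>+x. ennreal (V x) \<partial>\<nu>) \<le> ennreal B"
  shows "\<bar>(\<integral>x. f x \<partial>\<mu>) - (\<integral>x. f x \<partial>\<nu>)\<bar> \<le> c * sqrt (w * (1 + \<beta> * A + \<beta> * B))"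
proof -
  interpret C: prob_space cpl using cpl by (simp add: coupling_def)
  have sets_cpl[measurable_cong]: "sets cpl = sets (borel \<Otimes>\<^sub>M borel)"
    and mu: "\<mu> = distr cpl borel fst" and nu: "\<nu> = distr cpl borel snd"
    using cpl by (auto simp: coupling_def)
  have [measurable]: "f \<in> borel_measurable borel"
    using f by (simp add: bounded_borel_def)
  have [measurable]: "fst \<in> measurable cpl borel" "snd \<in> measurable cpl borel"
    by measurable
  have [measurable]: "(\<lambda>p. d (fst p) (snd p)) \<in> borel_measurable cpl"
    using d(1) by (simp add: case_prod_beta' measurable_cong_sets[OF sets_cpl refl])
  define U where "U = 1 + \<beta> * A + \<beta> * B"
  have U: "1 \<le> U" using \<beta> A B by (simp add: U_def)
  \<comment> \<open>This choice makes \<open>s * w\<close> and \<open>U / s\<close> both equal to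
    \<open>sqrt (w * U)\<close>; it is the reason for requiring \<open>w\<close> positive.\<close>
  define s where "s = sqrt (U / w)"
  have s: "0 < s" using U w by (simp add: s_def)
  have amgm: "sqrt (u * v) \<le> (s * u + v / s) / 2" if "0 \<le> u" "0 \<le> v" for u v
  proof -
    have "sqrt (u * v) = sqrt ((s * u) * (v / s))" using s by simp
    also have "\<dots> \<le> (s * u + v / s) / 2"
      using that s by (intro arith_geo_mean_sqrt) auto
    finally show ?thesis .
  qed
  have affine: "ennreal (a * u + b * (1 + \<beta> * v + \<beta> * v')) = ennreal a * ennreal u + ennreal b * (1 + ennreal \<beta> * ennreal v + ennreal \<beta> * ennreal v')"
    if "0 \<le> a" "0 \<le> b" "0 \<le> u" "0 \<le> v" "0 \<le> v'" for a b u v v'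
    using that \<beta> by (simp add: ennreal_mult)
  obtain F where F: "\<And>x. \<bar>f x\<bar> \<le> F" using f unfolding bounded_borel_def by blast
  have int1: "integrable cpl (\<lambda>p. f (fst p))" and int2: "integrable cpl (\<lambda>p. f (snd p))"
    by (rule C.integrable_const_bound[of _ F], use F in auto)+
  have "(\<integral>\<^sup>+p. ennreal \<bar>f (fst p) - f (snd p)\<bar> \<partial>cpl)
      \<le> (\<integral>\<^sup>+p. ennreal (c * s / 2) * ennreal (d (fst p) (snd p)) + ennreal (c / (2 * s)) * (1 + ennreal \<beta> * ennreal (V (fst p)) + ennreal \<beta> * ennreal (V (snd p))) \<partial>cpl)"
  proof (intro nn_integral_mono)
    fix p
    have V1: "0 \<le> 1 + \<beta> * V (fst p) + \<beta> * V (snd p)"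
      using \<beta> V0 by (simp add: add_nonneg_nonneg)
    have "\<bar>f (fst p) - f (snd p)\<bar> \<le> c * sqrt (d (fst p) (snd p) * (1 + \<beta> * V (fst p) + \<beta> * V (snd p)))"
      by (rule osc)
    also have "\<dots> \<le> c * ((s * d (fst p) (snd p) + (1 + \<beta> * V (fst p) + \<beta> * V (snd p)) / s) / 2)"
      using c d V1 by (intro mult_left_mono amgm)
    also have "\<dots> = c * s / 2 * d (fst p) (snd p) + c / (2 * s) * (1 + \<beta> * V (fst p) + \<beta> * V (snd p))"
      using s by (simp add: field_simps)
    finally have "ennreal \<bar>f (fst p) - f (snd p)\<bar> \<le> ennreal (c * s / 2 * d (fst p) (snd p) + c / (2 * s) * (1 + \<beta> * V (fst p) + \<beta> * V (snd p)))"
      by (rule ennreal_leI)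
    also have "\<dots> = ennreal (c * s / 2) * ennreal (d (fst p) (snd p)) + ennreal (c / (2 * s)) * (1 + ennreal \<beta> * ennreal (V (fst p)) + ennreal \<beta> * ennreal (V (snd p)))"
      using c s d V0 by (intro affine) auto
    finally show "ennreal \<bar>f (fst p) - f (snd p)\<bar> \<le> \<dots>" .
  qed
  also have "\<dots> = ennreal (c * s / 2) * (\<integral>\<^sup>+p. ennreal (d (fst p) (snd p)) \<partial>cpl)
      + ennreal (c / (2 * s)) * (1 + ennreal \<beta> * (\<integral>\<^sup>+p. ennreal (V (fst p)) \<partial>cpl) + ennreal \<beta> * (\<integral>\<^sup>+p. ennreal (V (snd p)) \<partial>cpl))"
    by (simp add: nn_integral_add nn_integral_cmult C.emeasure_space_1)
  also have "(\<integral>\<^sup>+p. ennreal (V (fst p)) \<partial>cpl) = (\<integral>\<^sup>+x. ennreal (V x) \<partial>\<mu>)"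
    unfolding mu by (subst nn_integral_distr) auto
  also have "(\<integral>\<^sup>+p. ennreal (V (snd p)) \<partial>cpl) = (\<integral>\<^sup>+x. ennreal (V x) \<partial>\<nu>)"
    unfolding nu by (subst nn_integral_distr) auto
  also have "ennreal (c * s / 2) * (\<integral>\<^sup>+p. ennreal (d (fst p) (snd p)) \<partial>cpl)
      + ennreal (c / (2 * s)) * (1 + ennreal \<beta> * (\<integral>\<^sup>+x. ennreal (V x) \<partial>\<mu>) + ennreal \<beta> * (\<integral>\<^sup>+x. ennreal (V x) \<partial>\<nu>))
      \<le> ennreal (c * s / 2) * ennreal w + ennreal (c / (2 * s)) * (1 + ennreal \<beta> * ennreal A + ennreal \<beta> * ennreal B)"
    by (intro add_mono mult_left_mono w A B order_refl) auto
  also have "\<dots> = ennreal (c * s / 2 * w + c / (2 * s) * U)"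
    unfolding U_def using c s w A B by (intro affine[symmetric]) auto
  also have "c * s / 2 * w + c / (2 * s) * U = c * ((s * w + U / s) / 2)"
    using s by (simp add: field_simps)
  also have "(s * w + U / s) / 2 = sqrt (w * U)"
  proof -
    have "s * w = sqrt (w * U)"
      unfolding s_def using w U by (simp add: real_sqrt_divide real_sqrt_mult field_simps)
    moreover have "U / s = sqrt (w * U)"
      unfolding s_def using w U by (simp add: real_sqrt_divide real_sqrt_mult field_simps)
    ultimately show ?thesis by simp
  qed
  finally have *: "(\<integral>\<^sup>+p. ennreal \<bar>f (fst p) - f (snd p)\<bar> \<partial>cpl) \<le> ennreal (c * sqrt (w * U))" .
  have "(\<integral>x. f x \<partial>\<mu>) - (\<integral>x. f x \<partial>\<nu>) = (\<integral>p. f (fst p) - f (snd p) \<partial>cpl)"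
    unfolding mu nu using int1 int2 by (simp add: integral_distr)
  then have "ennreal \<bar>(\<integral>x. f x \<partial>\<mu>) - (\<integral>x. f x \<partial>\<nu>)\<bar> \<le> (\<integral>\<^sup>+p. ennreal \<bar>f (fst p) - f (snd p)\<bar> \<partial>cpl)"
    using integral_norm_bound_ennreal[of cpl "\<lambda>p. f (fst p) - f (snd p)"] int1 int2 by simp
  also note *
  finally show ?thesis
    unfolding U_def using c w \<beta> A B by (subst (asm) ennreal_le_iff) (auto intro!: mult_nonneg_nonneg add_nonneg_nonneg)
qed

section \<open>Dual contraction\<close>

lemma product_coupling:
  fixes \<mu> \<nu> :: "'a::polish_space measure"
  assumes "prob_space \<mu>" "sets \<mu> = sets borel" "prob_space \<nu>" "sets \<nu> = sets borel"
  shows "coupling \<mu> \<nu> (\<mu> \<Otimes>\<^sub>M \<nu>)"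
proof -
  interpret \<mu>: prob_space \<mu> by fact
  interpret \<nu>: prob_space \<nu> by fact
  interpret pair_prob_space \<mu> \<nu> ..
  have sp: "space \<mu> = UNIV" "space \<nu> = UNIV"
    using assms by (auto dest: sets_eq_imp_space_eq)
  have sets: "sets (\<mu> \<Otimes>\<^sub>M \<nu>) = sets (borel \<Otimes>\<^sub>M borel)"
    using assms by (intro sets_pair_measure_cong)
  have m: "fst \<in> measurable (\<mu> \<Otimes>\<^sub>M \<nu>) borel" "snd \<in> measurable (\<mu> \<Otimes>\<^sub>M \<nu>) borel"
    unfolding measurable_cong_sets[OF sets refl] by measurable
  have "distr (\<mu> \<Otimes>\<^sub>M \<nu>) borel fst = \<mu>"
  proof (rule measure_eqI)
    fix A assume "A \<in> sets (distr (\<mu> \<Otimes>\<^sub>M \<nu>) borel fst)"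
    then have A: "A \<in> sets \<mu>" using assms by simp
    have "fst -` A \<inter> space (\<mu> \<Otimes>\<^sub>M \<nu>) = A \<times> space \<nu>"
      by (auto simp: space_pair_measure sp)
    then show "emeasure (distr (\<mu> \<Otimes>\<^sub>M \<nu>) borel fst) A = emeasure \<mu> A"
      using A m assms \<nu>.emeasure_pair_measure_Times[OF A sets.top] \<nu>.emeasure_space_1 by (simp add: emeasure_distr)
  qed (simp add: assms)
  moreover have "distr (\<mu> \<Otimes>\<^sub>M \<nu>) borel snd = \<nu>"
  proof (rule measure_eqI)
    fix A assume "A \<in> sets (distr (\<mu> \<Otimes>\<^sub>M \<nu>) borel snd)"
    then have A: "A \<in> sets \<nu>" using assms by simp
    have "snd -` A \<inter> space (\<mu> \<Otimes>\<^sub>M \<nu>) = space \<mu> \<times> A"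
      by (auto simp: space_pair_measure sp)
    then show "emeasure (distr (\<mu> \<Otimes>\<^sub>M \<nu>) borel snd) A = emeasure \<nu> A"
      using A m assms \<nu>.emeasure_pair_measure_Times[OF sets.top[of \<mu>] A] \<mu>.emeasure_space_1 by (simp add: emeasure_distr)
  qed (simp add: assms)
  ultimately show ?thesis
    by (simp add: coupling_def sets prob_space_axioms)
qed

text \<open>Roles of the constants: \<open>7 \<le> \<gamma> * T\<close> makes the drift factor at
  most \<open>1 / 8\<close>. Weight growth of at most \<open>3 / 2\<close> over \<open>k\<close>
  steps leaves \<open>3 / 4\<close> after the halving in \<open>contract\<close>. The last condition
  on \<open>\<beta>\<close> keeps the additive weight at most \<open>\<epsilon> / 2\<close>, and
  \<open>(1 - \<epsilon>) * (1 + \<epsilon> / 2) \<le> 1 - \<epsilon> / 2\<close>.\<close>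

locale weak_harris = lyapunov_semigroup P V \<gamma> K
  for P :: "real \<Rightarrow> 'a::polish_space \<Rightarrow> 'a measure" and V \<gamma> K +
  fixes d :: "'a \<Rightarrow> 'a \<Rightarrow> real" and t1 T \<beta> \<epsilon> :: real and k :: nat
  assumes d_meas: "case_prod d \<in> borel_measurable (borel \<Otimes>\<^sub>M borel)"
    and d_le_1: "d x y \<le> 1" and bdist_le_d: "bdist x y \<le> d x y"
    and t1: "0 < t1" and k: "0 < k" and T_eq: "T = real k * t1" and T_large: "7 \<le> \<gamma> * T"
    and \<epsilon>: "0 < \<epsilon>" "\<epsilon> < 1"
    and \<beta>: "0 < \<beta>" "\<beta> \<le> 1" "(1 + 2 * \<beta> * K * t1) ^ k \<le> 3 / 2" "5 * \<beta> * K / (2 * \<gamma>) \<le> \<epsilon> / 2"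
    and contract: "d x y < 1 \<Longrightarrow>
      \<exists>cpl. coupling (P t1 x) (P t1 y) cpl \<and> (\<integral>\<^sup>+p. ennreal (d (fst p) (snd p)) \<partial>cpl) \<le> ennreal (d x y / 2)"
    and small: "V x \<le> 4 * K / \<gamma> \<Longrightarrow> V y \<le> 4 * K / \<gamma> \<Longrightarrow>
      \<exists>cpl. coupling (P T x) (P T y) cpl \<and> (\<integral>\<^sup>+p. ennreal (d (fst p) (snd p)) \<partial>cpl) \<le> ennreal (1 - \<epsilon>)"
begin

lemma d_nonneg: "0 \<le> d x y"
  using bdist_le_d[of x y] by (meson min.boundedI order_trans zero_le_dist zero_le_one)

lemma d_pos: "x \<noteq> y \<Longrightarrow> 0 < d x y"
  using bdist_le_d[of x y] by (smt (verit) zero_less_dist_iff)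

lemma T_pos: "0 < T"
  using t1 k by (simp add: T_eq)

text \<open>In general not a metric: a premetric need be neither symmetric nor satisfy the triangle
  inequality, and \<open>d\<close> inherits this. The dual estimates only bound increments pair by
  pair.\<close>

definition wdist :: "'a \<Rightarrow> 'a \<Rightarrow> real" where
  "wdist x y = sqrt (d x y * (1 + \<beta> * V x + \<beta> * V y))"

lemma weight_ge_1: "1 \<le> 1 + \<beta> * V x + \<beta> * V y"
  using \<beta> V_nonneg[of x] V_nonneg[of y] by simp

lemma wdist_nonneg: "0 \<le> wdist x y"
  unfolding wdist_def using d_nonneg[of x y] weight_ge_1[of x y] by simp

definition wlip :: "real \<Rightarrow> ('a \<Rightarrow> real) \<Rightarrow> bool" where
  "wlip c f \<longleftrightarrow> bounded_borel f \<and> (\<forall>x y. \<bar>f x - f y\<bar> \<le> c * wdist x y)"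

text \<open>Reduces each case of the contraction to the numerical inequality \<open>bound\<close>:
  cost after the step times mean weight, against \<open>q\<close> times the squared
  \<open>wdist\<close> before it.\<close>

lemma coupling_step:
  assumes t: "0 \<le> t" and f: "wlip c f" and c: "0 \<le> c"
    and cpl: "coupling (P t x) (P t y) cpl" "(\<integral>\<^sup>+p. ennreal (d (fst p) (snd p)) \<partial>cpl) \<le> ennreal w" and w: "0 < w"
    and A: "\<And>z. PV t z \<le> ennreal (a * V z + b)" and ab: "0 \<le> a" "0 \<le> b"
    and bound: "w * (1 + 2 * \<beta> * b + a * (\<beta> * V x + \<beta> * V y)) \<le> q * (d x y * (1 + \<beta> * V x + \<beta> * V y))"
    and q: "0 \<le> q"
  shows "\<bar>semigroup P t f x - semigroup P t f y\<bar> \<le> c * sqrt q * wdist x y"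
proof -
  have "\<bar>(\<integral>z. f z \<partial>P t x) - (\<integral>z. f z \<partial>P t y)\<bar> \<le> c * sqrt (w * (1 + \<beta> * (a * V x + b) + \<beta> * (a * V y + b)))"
  proof (rule coupling_dual_bound[OF cpl(1) _ V_meas V_nonneg d_meas d_nonneg c _ _ w cpl(2)])
    show "bounded_borel f" "\<And>x y. \<bar>f x - f y\<bar> \<le> c * sqrt (d x y * (1 + \<beta> * V x + \<beta> * V y))"
      using f by (auto simp: wlip_def wdist_def)
    show "0 \<le> a * V x + b" "0 \<le> a * V y + b" "0 \<le> \<beta>"
      using ab V_nonneg \<beta> by auto
    show "(\<integral>\<^sup>+z. ennreal (V z) \<partial>P t x) \<le> ennreal (a * V x + b)" "(\<integral>\<^sup>+z. ennreal (V z) \<partial>P t y) \<le> ennreal (a * V y + b)"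
      using A unfolding PV_def by auto
  qed
  also have "\<dots> \<le> c * sqrt (q * (d x y * (1 + \<beta> * V x + \<beta> * V y)))"
    using bound c by (intro mult_left_mono real_sqrt_le_mono) (auto simp: algebra_simps)
  also have "\<dots> = c * sqrt q * wdist x y"
    by (simp add: wdist_def real_sqrt_mult)
  finally show ?thesis by (simp add: semigroup_def)
qed

text \<open>For pairs with \<open>d x y = 1\<close> independence already gives a cost that does not
  exceed the initial one.\<close>

lemma trivial_coupling:
  assumes "0 \<le> t"
  shows "\<exists>cpl. coupling (P t x) (P t y) cpl \<and> (\<integral>\<^sup>+p. ennreal (d (fst p) (snd p)) \<partial>cpl) \<le> ennreal 1"
proof (intro exI conjI)
  show cpl: "coupling (P t x) (P t y) (P t x \<Otimes>\<^sub>M P t y)"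
    using assms by (intro product_coupling prob_P sets_P)
  then interpret prob_space "P t x \<Otimes>\<^sub>M P t y" by (simp add: coupling_def)
  have "(\<integral>\<^sup>+p. ennreal (d (fst p) (snd p)) \<partial>(P t x \<Otimes>\<^sub>M P t y)) \<le> (\<integral>\<^sup>+p. 1 \<partial>(P t x \<Otimes>\<^sub>M P t y))"
    using d_le_1 by (intro nn_integral_mono) (simp add: ennreal_le_1)
  then show "(\<integral>\<^sup>+p. ennreal (d (fst p) (snd p)) \<partial>(P t x \<Otimes>\<^sub>M P t y)) \<le> ennreal 1"
    by (simp add: emeasure_space_1)
qed

abbreviation g1 :: real where "g1 \<equiv> 1 + 2 * \<beta> * K * t1"

lemma g1_ge_1: "1 \<le> g1"
  using \<beta> K_pos t1 by simp

lemma weight_growth: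
  "1 + 2 * \<beta> * (K * t1) + 1 * (\<beta> * V x + \<beta> * V y) \<le> g1 * (1 + \<beta> * V x + \<beta> * V y)"
proof -
  have "0 \<le> (2 * \<beta> * K * t1) * (\<beta> * V x + \<beta> * V y)"
    using \<beta> K_pos t1 V_nonneg by simp
  then show ?thesis by (simp add: algebra_simps)
qed

text \<open>In terms of squared distances the cost halves while the weight grows by at most the
  factor \<open>g1\<close>.\<close>

lemma t1_step_near:
  assumes f: "wlip c f" "0 \<le> c" and near: "d x y < 1"
  shows "\<bar>semigroup P t1 f x - semigroup P t1 f y\<bar> \<le> c * sqrt (g1 / 2) * wdist x y"
\<comment> \<open>Off the diagonal \<open>d x y / 2\<close> is positive, as
  \<open>coupling_step\<close> demands of the cost bound.\<close>
proof (cases "x = y")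
  case True
  then show ?thesis using f(2) wdist_nonneg[of x y] g1_ge_1 by simp
next
  case False
  obtain cpl where cpl: "coupling (P t1 x) (P t1 y) cpl" "(\<integral>\<^sup>+p. ennreal (d (fst p) (snd p)) \<partial>cpl) \<le> ennreal (d x y / 2)"
    using contract[OF near] by blast
  show ?thesis
  proof (rule coupling_step[OF _ f cpl])
    show "PV t1 z \<le> ennreal (1 * V z + K * t1)" for z
      using PV_le_add[of t1 z] t1 by simp
    have "d x y / 2 * (1 + 2 * \<beta> * (K * t1) + 1 * (\<beta> * V x + \<beta> * V y)) \<le> d x y / 2 * (g1 * (1 + \<beta> * V x + \<beta> * V y))"
      using d_nonneg[of x y] by (intro mult_left_mono weight_growth) auto
    then show "d x y / 2 * (1 + 2 * \<beta> * (K * t1) + 1 * (\<beta> * V x + \<beta> * V y)) \<le> g1 / 2 * (d x y * (1 + \<beta> * V x + \<beta> * V y))"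
      by (simp add: mult_ac)
  qed (use d_pos[OF False] t1 K_pos g1_ge_1 in auto)
qed

text \<open>Far pairs need not contract at time \<open>t1\<close>. The factor \<open>sqrt g1\<close>
  is at least 1, but its powers up to \<open>k\<close> are controlled by the choice of
  \<open>\<beta>\<close>.\<close>

lemma t1_step:
  assumes f: "wlip c f" "0 \<le> c"
  shows "wlip (c * sqrt g1) (semigroup P t1 f)"
  unfolding wlip_def
proof (intro conjI allI)
  show "bounded_borel (semigroup P t1 f)"
    using f t1 by (intro semigroup_bounded_borel) (auto simp: wlip_def)
  fix x y
  show "\<bar>semigroup P t1 f x - semigroup P t1 f y\<bar> \<le> c * sqrt g1 * wdist x y"
  proof (cases "d x y < 1")
    case True
    have "\<bar>semigroup P t1 f x - semigroup P t1 f y\<bar> \<le> c * sqrt (g1 / 2) * wdist x y"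
      by (rule t1_step_near[OF f True])
    also have "\<dots> \<le> c * sqrt g1 * wdist x y"
      using f(2) g1_ge_1 wdist_nonneg by (intro mult_right_mono mult_left_mono real_sqrt_le_mono) auto
    finally show ?thesis .
  next
    case False
    then have d1: "d x y = 1" using d_le_1[of x y] by simp
    obtain cpl where cpl: "coupling (P t1 x) (P t1 y) cpl" "(\<integral>\<^sup>+p. ennreal (d (fst p) (snd p)) \<partial>cpl) \<le> ennreal 1"
      using trivial_coupling[of t1] t1 by fastforce
    show ?thesis
    proof (rule coupling_step[OF _ f cpl])
      show "PV t1 z \<le> ennreal (1 * V z + K * t1)" for z
        using PV_le_add[of t1 z] t1 by simp
      show "1 * (1 + 2 * \<beta> * (K * t1) + 1 * (\<beta> * V x + \<beta> * V y)) \<le> g1 * (d x y * (1 + \<beta> * V x + \<beta> * V y))"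
        using weight_growth[of x y] by (simp add: d1)
    qed (use t1 K_pos g1_ge_1 in auto)
  qed
qed

lemma t1_iterate:
  assumes f: "wlip c f" "0 \<le> c"
  shows "wlip (c * sqrt g1 ^ j) (semigroup P (real j * t1) f)"
proof (induction j)
  case 0
  have "bounded_borel f" using f by (simp add: wlip_def)
  then have "semigroup P 0 f = f" by (intro ext semigroup_0)
  then show ?case using f by simp
next
  case (Suc j)
  have b: "bounded_borel f" using f by (simp add: wlip_def)
  have "semigroup P (real (Suc j) * t1) f = semigroup P t1 (semigroup P (real j * t1) f)"
    using semigroup_add[of t1 "real j * t1" f] t1 b by (intro ext) (simp add: algebra_simps)
  moreover have "wlip (c * sqrt g1 ^ j * sqrt g1) (semigroup P t1 (semigroup P (real j * t1) f))"
    using Suc f g1_ge_1 by (intro t1_step) auto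
  ultimately show ?case by (simp add: mult_ac)
qed

text \<open>The worst of the three factors in \<open>T_step\<close>: near pairs, far pairs inside
  the small set, and far pairs with large \<open>V x + V y\<close>.\<close>

definition \<alpha> :: real where
  "\<alpha> = max (3 / 4) (max (1 - \<epsilon> / 2) ((1 + 3 * (\<beta> * K / \<gamma>)) / (1 + 4 * (\<beta> * K / \<gamma>))))"

lemma \<alpha>_bounds: "0 < \<alpha>" "\<alpha> < 1"
proof -
  have "(1 + 3 * m) / (1 + 4 * m) < 1" if "0 < m" for m :: real
    using that by (simp add: divide_less_eq)
  moreover have "0 < \<beta> * K / \<gamma>" using \<beta> K_pos \<gamma>_pos by simp
  ultimately have "(1 + 3 * (\<beta> * K / \<gamma>)) / (1 + 4 * (\<beta> * K / \<gamma>)) < 1"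
    by blast
  then show "\<alpha> < 1" using \<epsilon> by (simp add: \<alpha>_def)
qed (simp add: \<alpha>_def)

text \<open>Near points contract by iterating the time \<open>t1\<close> coupling, whose expansion on far points is
  absorbed by a small weight \<open>\<beta>\<close>; far points contract at time \<open>T\<close> either because both lie in the
  small set or because the Lyapunov function strictly decreases.\<close>
lemma T_step:
  assumes f: "wlip c f" "0 \<le> c"
  shows "wlip (c * sqrt \<alpha>) (semigroup P T f)"
  unfolding wlip_def
proof (intro conjI allI)
  have b: "bounded_borel f" using f by (simp add: wlip_def)
  show "bounded_borel (semigroup P T f)"
    using b T_pos by (intro semigroup_bounded_borel) auto
  have drift: "PV T z \<le> ennreal (1 / 8 * V z + 5 * K / (4 * \<gamma>))" for z
  proof -
    have "V z / (1 + \<gamma> * T) \<le> V z / 8"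
      using T_large V_nonneg[of z] by (intro divide_left_mono) auto
    then show ?thesis
      by (intro order_trans[OF PV_drift[OF T_pos]] ennreal_leI) simp
  qed
  define m where "m = \<beta> * K / \<gamma>"
  have m: "0 < m" "2 * \<beta> * (5 * K / (4 * \<gamma>)) = 5 / 2 * m" "5 / 2 * m \<le> \<epsilon> / 2"
    using \<beta> K_pos \<gamma>_pos by (auto simp: m_def field_simps)
  fix x y
  define z where "z = \<beta> * V x + \<beta> * V y"
  have z: "0 \<le> z" using \<beta> V_nonneg by (simp add: z_def)
  have far: "\<bar>semigroup P T f x - semigroup P T f y\<bar> \<le> c * sqrt \<alpha> * wdist x y"
    if cpl: "coupling (P T x) (P T y) cpl" "(\<integral>\<^sup>+p. ennreal (d (fst p) (snd p)) \<partial>cpl) \<le> ennreal w"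
      and w: "0 < w" "w * (1 + 5 / 2 * m + 1 / 8 * z) \<le> \<alpha> * (1 + z)" and d1: "d x y = 1" for cpl w
  proof (rule coupling_step[OF _ f cpl w(1) drift])
    show "w * (1 + 2 * \<beta> * (5 * K / (4 * \<gamma>)) + 1 / 8 * (\<beta> * V x + \<beta> * V y)) \<le> \<alpha> * (d x y * (1 + \<beta> * V x + \<beta> * V y))"
      using w(2) unfolding m(2) d1 z_def by (simp add: add.assoc)
  qed (use T_pos K_pos \<gamma>_pos \<alpha>_bounds in auto)
  \<comment> \<open>If one of the points lies outside the small set, nonnegativity of
    \<open>V\<close> makes the sum exceed the threshold.\<close>
  consider "d x y < 1" | "d x y = 1" "V x \<le> 4 * K / \<gamma>" "V y \<le> 4 * K / \<gamma>"
    | "d x y = 1" "4 * K / \<gamma> < V x + V y"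
    using d_le_1[of x y] V_nonneg[of x] V_nonneg[of y] by linarith
  then show "\<bar>semigroup P T f x - semigroup P T f y\<bar> \<le> c * sqrt \<alpha> * wdist x y"
  proof cases
    case 1
    \<comment> \<open>Only the outermost of the \<open>k\<close> operators uses that the pair is
      near; the inner \<open>j\<close> act on the function and may enlarge its seminorm.\<close>
    obtain j where j: "k = Suc j" using k by (cases k) auto
    have "semigroup P T f u = semigroup P t1 (semigroup P (real j * t1) f) u" for u
      using semigroup_add[of t1 "real j * t1" f u] t1 b by (simp add: T_eq j algebra_simps)
    then have "\<bar>semigroup P T f x - semigroup P T f y\<bar> \<le> c * sqrt g1 ^ j * sqrt (g1 / 2) * wdist x y"
      using t1_step_near[OF t1_iterate[OF f, of j] _ 1] f(2) g1_ge_1 by simp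
    also have "\<dots> = c * sqrt (g1 ^ k / 2) * wdist x y"
      by (simp add: j real_sqrt_mult real_sqrt_divide real_sqrt_power mult_ac)
    also have "\<dots> \<le> c * sqrt \<alpha> * wdist x y"
    proof (intro mult_right_mono mult_left_mono real_sqrt_le_mono f(2) wdist_nonneg)
      have "g1 ^ k / 2 \<le> 3 / 4" using \<beta>(3) by simp
      also have "\<dots> \<le> \<alpha>" unfolding \<alpha>_def by (rule max.cobounded1)
      finally show "g1 ^ k / 2 \<le> \<alpha>" .
    qed
    finally show ?thesis .
  next
    case 2
    obtain cpl where cpl: "coupling (P T x) (P T y) cpl" "(\<integral>\<^sup>+p. ennreal (d (fst p) (snd p)) \<partial>cpl) \<le> ennreal (1 - \<epsilon>)"
      using small[OF 2(2,3)] by blast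
    have "(1 - \<epsilon>) * (1 + 5 / 2 * m + 1 / 8 * z) \<le> (1 - \<epsilon>) * ((1 + \<epsilon> / 2) * (1 + z))"
    proof (intro mult_left_mono)
      have "0 \<le> \<epsilon> / 2 * z" using \<epsilon> z by simp
      moreover have "(1 + \<epsilon> / 2) * (1 + z) = 1 + \<epsilon> / 2 + z + \<epsilon> / 2 * z"
        by (simp add: distrib_left distrib_right)
      ultimately show "1 + 5 / 2 * m + 1 / 8 * z \<le> (1 + \<epsilon> / 2) * (1 + z)"
        using m(3) z by linarith
    qed (use \<epsilon> in auto)
    also have "\<dots> = ((1 - \<epsilon>) * (1 + \<epsilon> / 2)) * (1 + z)" by simp
    also have "\<dots> \<le> \<alpha> * (1 + z)"
    proof (intro mult_right_mono)
      have "(1 - \<epsilon>) * (1 + \<epsilon> / 2) = 1 - \<epsilon> / 2 - \<epsilon> * \<epsilon> / 2" by (simp add: field_simps)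
      also have "\<dots> \<le> 1 - \<epsilon> / 2" by simp
      also have "\<dots> \<le> \<alpha>" by (simp add: \<alpha>_def)
      finally show "(1 - \<epsilon>) * (1 + \<epsilon> / 2) \<le> \<alpha>" .
    qed (use z in simp)
    finally show ?thesis
      using 2 \<epsilon> by (intro far[OF cpl]) auto
  next
    case 3
    obtain cpl where cpl: "coupling (P T x) (P T y) cpl" "(\<integral>\<^sup>+p. ennreal (d (fst p) (snd p)) \<partial>cpl) \<le> ennreal 1"
      using trivial_coupling[of T] T_pos by fastforce
    have "\<beta> * (4 * K / \<gamma>) \<le> \<beta> * (V x + V y)"
      using 3 \<beta> by (intro mult_left_mono) auto
    then have z4: "4 * m \<le> z"
      by (simp add: z_def m_def algebra_simps)
    define q where "q = (1 + 3 * m) / (1 + 4 * m)"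
    have q34: "3 / 4 \<le> q" using m by (simp add: q_def field_simps)
    have q4: "q * (1 + 4 * m) = 1 + 3 * m" using m by (simp add: q_def)
    \<comment> \<open>The drift bound is split at \<open>z = 4 * m\<close>: there
      \<open>5 / 2 + 4 / 8 = 3\<close>, and the excess carries the factor \<open>1 / 8\<close>,
      which is below \<open>q\<close>.\<close>
    have "1 + 5 / 2 * m + 1 / 8 * z = (1 + 3 * m) + 1 / 8 * (z - 4 * m)"
      by (simp add: algebra_simps)
    also have "\<dots> \<le> q * (1 + 4 * m) + q * (z - 4 * m)"
      unfolding q4 using q34 z4 by (intro add_left_mono mult_right_mono) auto
    also have "\<dots> = q * (1 + z)" by (simp add: algebra_simps)
    also have "\<dots> \<le> \<alpha> * (1 + z)"
      using z by (intro mult_right_mono) (auto simp: \<alpha>_def q_def m_def)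
    finally show ?thesis
      using 3 by (intro far[OF cpl]) auto
  qed
qed

lemma T_iterate:
  assumes f: "wlip c f" "0 \<le> c"
  shows "wlip (c * sqrt \<alpha> ^ n) (semigroup P (real n * T) f)"
proof (induction n)
  case 0
  have "bounded_borel f" using f by (simp add: wlip_def)
  then have "semigroup P 0 f = f" by (intro ext semigroup_0)
  then show ?case using f by simp
next
  case (Suc n)
  have b: "bounded_borel f" using f by (simp add: wlip_def)
  have "semigroup P (real (Suc n) * T) f = semigroup P T (semigroup P (real n * T) f)"
    using semigroup_add[of T "real n * T" f] T_pos b by (intro ext) (simp add: algebra_simps)
  moreover have "wlip (c * sqrt \<alpha> ^ n * sqrt \<alpha>) (semigroup P T (semigroup P (real n * T) f))"
    using Suc f \<alpha>_bounds by (intro T_step) auto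
  ultimately show ?case by (simp add: mult_ac)
qed

text \<open>Since \<open>d \<le> 1\<close>, it is at most its own square root; with
  \<open>bdist_le_d\<close> this brings the original test functions into the weighted
  seminorm.\<close>

lemma wlip_of_bdist_lipschitz:
  assumes "bdist_lipschitz f"
  shows "wlip 1 f"
  unfolding wlip_def
proof (intro conjI allI bdist_lipschitz_bounded_borel[OF assms])
  fix x y
  have "\<bar>f x - f y\<bar> \<le> d x y"
    using assms bdist_le_d[of x y] unfolding bdist_lipschitz_def by (meson order_trans)
  also have "d x y = sqrt (d x y * d x y)"
    using d_nonneg[of x y] by simp
  also have "\<dots> \<le> wdist x y"
    unfolding wdist_def using d_nonneg[of x y] d_le_1[of x y] weight_ge_1[of x y]
    by (intro real_sqrt_le_mono mult_left_mono) auto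
  finally show "\<bar>f x - f y\<bar> \<le> 1 * wdist x y" by simp
qed

text \<open>Gives up the square root in exchange for a bound linear in \<open>V\<close>, which can
  be integrated with the Lyapunov estimate.\<close>

lemma wdist_le: "wdist x y \<le> 1 + V x + V y"
proof -
  have "d x y * (1 + \<beta> * V x + \<beta> * V y) \<le> 1 * (1 + \<beta> * V x + \<beta> * V y)"
    using d_le_1 weight_ge_1[of x y] by (intro mult_right_mono) auto
  also have "\<dots> \<le> 1 + V x + V y"
    using \<beta> V_nonneg[of x] V_nonneg[of y] by (simp add: add_mono mult_left_le_one_le)
  also have "\<dots> \<le> (1 + V x + V y)\<^sup>2"
    using V_nonneg[of x] V_nonneg[of y] by (intro self_le_power) auto
  finally have "d x y * (1 + \<beta> * V x + \<beta> * V y) \<le> (1 + V x + V y)\<^sup>2" .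
  then show ?thesis
    unfolding wdist_def using V_nonneg[of x] V_nonneg[of y] by (intro real_le_lsqrt) auto
qed

lemma dual_contraction:
  assumes "bdist_lipschitz f"
  shows "\<bar>semigroup P (real n * T) f x - semigroup P (real n * T) f y\<bar> \<le> sqrt \<alpha> ^ n * (1 + V x + V y)"
proof -
  have "\<bar>semigroup P (real n * T) f x - semigroup P (real n * T) f y\<bar> \<le> sqrt \<alpha> ^ n * wdist x y"
    using T_iterate[OF wlip_of_bdist_lipschitz[OF assms], of n] by (simp add: wlip_def)
  also have "\<dots> \<le> sqrt \<alpha> ^ n * (1 + V x + V y)"
    using \<alpha>_bounds by (intro mult_left_mono wdist_le) auto
  finally show ?thesis .
qed

end

section \<open>Ergodicity\<close>

text \<open>A deviation bound that grows linearly in \<open>V\<close> survives averaging, with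
  \<open>V\<close> replaced by a bound for its mean.\<close>

lemma (in lyapunov_semigroup) abs_semigroup_diff_le:
  assumes s: "0 \<le> s" and g: "bounded_borel g" "\<And>y. \<bar>g y - a\<bar> \<le> b + b' * V y"
    and b': "0 \<le> b'" and A: "0 \<le> A" "PV s x \<le> ennreal A"
  shows "\<bar>semigroup P s g x - a\<bar> \<le> b + b' * A"
proof -
  interpret prob_space "P s x" by (rule prob_P[OF s])
  have Vm: "V \<in> borel_measurable (P s x)" using s by (simp cong: measurable_cong_sets)
  have fin: "(\<integral>\<^sup>+y. ennreal (V y) \<partial>P s x) \<le> ennreal A"
    using A(2) by (simp add: PV_def)
  then have Vi: "integrable (P s x) V"
    using Vm V_nonneg by (intro integrableI_nonneg) (auto intro: le_less_trans)
  have "ennreal (\<integral>y. V y \<partial>P s x) \<le> ennreal A"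
    using fin V_nonneg by (subst nn_integral_eq_integral[OF Vi, symmetric]) auto
  then have VA: "(\<integral>y. V y \<partial>P s x) \<le> A"
    using A(1) by (subst (asm) ennreal_le_iff)
  note gi = integrable_P[OF s g(1), of x]
  have le: "g y \<le> (a + b) + b' * V y" "(a - b) - b' * V y \<le> g y" for y
    using g(2)[of y] by linarith+
  have "(\<integral>y. g y \<partial>P s x) \<le> (\<integral>y. (a + b) + b' * V y \<partial>P s x)"
    using gi Vi le by (intro integral_mono) auto
  also have "\<dots> = (a + b) + b' * (\<integral>y. V y \<partial>P s x)"
    using Vi prob_space s by simp
  also have "\<dots> \<le> (a + b) + b' * A"
    using VA b' by (intro add_left_mono mult_left_mono)
  finally have 1: "(\<integral>y. g y \<partial>P s x) \<le> (a + b) + b' * A" .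
  have "(a - b) - b' * A \<le> (a - b) - b' * (\<integral>y. V y \<partial>P s x)"
    using VA b' by (intro diff_left_mono mult_left_mono)
  also have "\<dots> = (\<integral>y. (a - b) - b' * V y \<partial>P s x)"
    using Vi prob_space s by simp
  also have "\<dots> \<le> (\<integral>y. g y \<partial>P s x)"
    using gi Vi le by (intro integral_mono) auto
  finally show ?thesis
    using 1 unfolding semigroup_def by linarith
qed

context weak_harris
begin

definition B0 :: real where "B0 = 5 * K / (4 * \<gamma>)"

lemma B0_nonneg: "0 \<le> B0"
  using K_pos \<gamma>_pos by (simp add: B0_def)

text \<open>The process is first run for time \<open>s\<close>, and the contraction is averaged over
  the state reached. By \<open>PV_bound\<close> the estimate is uniform in \<open>s\<close>; this
  yields both the Cauchy property of the skeleton and the passage to its limit.\<close>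

lemma dual_contraction_shifted:
  assumes f: "bdist_lipschitz f" and s: "0 \<le> s"
  shows "\<bar>semigroup P (s + real n * T) f z - semigroup P (real n * T) f x\<bar> \<le> sqrt \<alpha> ^ n * (1 + V x + V z + B0)"
proof -
  have T: "0 \<le> real n * T" using T_pos by simp
  have b: "bounded_borel f" by (rule bdist_lipschitz_bounded_borel[OF f])
  have "\<bar>semigroup P s (semigroup P (real n * T) f) z - semigroup P (real n * T) f x\<bar>
      \<le> sqrt \<alpha> ^ n * (1 + V x) + sqrt \<alpha> ^ n * (V z + B0)"
  proof (rule abs_semigroup_diff_le[OF s semigroup_bounded_borel[OF T b]])
    show "\<bar>semigroup P (real n * T) f y - semigroup P (real n * T) f x\<bar> \<le> sqrt \<alpha> ^ n * (1 + V x) + sqrt \<alpha> ^ n * V y" for y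
      using dual_contraction[OF f, of n y x] by (simp add: algebra_simps)
    show "PV s z \<le> ennreal (V z + B0)"
      using PV_bound[OF s] by (simp add: B0_def)
  qed (use V_nonneg[of z] B0_nonneg \<alpha>_bounds in auto)
  then show ?thesis
    unfolding semigroup_add[OF s T b] by (simp only: distrib_left add.assoc)
qed

text \<open>Convergence for all bounded continuous functions is exported beside the rate, which
  covers Lipschitz functions only: the invariance proof tests with \<open>P s f\<close>, which need
  not be Lipschitz.\<close>

lemma ergodic_limit:
  obtains \<pi> C c where "prob_space \<pi>" "sets \<pi> = sets borel" "0 < C" "0 < c"
    and "\<And>f :: 'a \<Rightarrow> real. continuous_on UNIV f \<Longrightarrow> bounded (range f) \<Longrightarrow>
      (\<lambda>n. semigroup P (real n * T) f undefined) \<longlonglongrightarrow> (\<integral>x. f x \<partial>\<pi>)"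
    and "\<And>f x t. bdist_lipschitz f \<Longrightarrow> 0 \<le> t \<Longrightarrow> \<bar>semigroup P t f x - (\<integral>x. f x \<partial>\<pi>)\<bar> \<le> C * (1 + V x) * exp (- c * t)"
proof -
  define q where "q = sqrt \<alpha>"
  have q: "0 < q" "q < 1" using \<alpha>_bounds by (auto simp: q_def)
  define x0 :: 'a where "x0 = undefined"
  have T0: "0 \<le> real n * T" for n using T_pos by simp
  obtain \<pi> where \<pi>: "prob_space \<pi>" "sets \<pi> = sets borel"
    and lim: "\<And>f :: 'a \<Rightarrow> real. continuous_on UNIV f \<Longrightarrow> bounded (range f) \<Longrightarrow>
      (\<lambda>n. \<integral>x. f x \<partial>P (real n * T) x0) \<longlonglongrightarrow> (\<integral>x. f x \<partial>\<pi>)"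
  \<comment> \<open>Consecutive skeleton laws started at \<open>x0\<close>: the shift
    \<open>s = T\<close> gives geometrically small dual differences.\<close>
  proof (rule weak_limit_of_dual_Cauchy[of "\<lambda>n. P (real n * T) x0" "\<lambda>n. q ^ n * (1 + V x0 + V x0 + B0)"])
    show "prob_space (P (real n * T) x0)" "sets (P (real n * T) x0) = sets borel" for n
      using T0 by (auto intro: prob_P)
    fix n f assume f: "bdist_lipschitz (f :: 'a \<Rightarrow> real)"
    have "\<bar>semigroup P (T + real n * T) f x0 - semigroup P (real n * T) f x0\<bar> \<le> q ^ n * (1 + V x0 + V x0 + B0)"
      unfolding q_def using T_pos by (intro dual_contraction_shifted[OF f]) simp
    then have "semigroup P (real n * T) f x0 - semigroup P (real (Suc n) * T) f x0 \<le> q ^ n * (1 + V x0 + V x0 + B0)"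
      by (simp add: algebra_simps)
    then show "(\<integral>x. f x \<partial>P (real n * T) x0) - (\<integral>x. f x \<partial>P (real (Suc n) * T) x0) \<le> q ^ n * (1 + V x0 + V x0 + B0)"
      by (simp add: semigroup_def)
  next
    show "0 \<le> q ^ n * (1 + V x0 + V x0 + B0)" for n
      using q V_nonneg[of x0] B0_nonneg by simp
    show "summable (\<lambda>n. q ^ n * (1 + V x0 + V x0 + B0))"
      using q by (intro summable_mult2 summable_geometric) simp
  qed blast
  \<comment> \<open>The shift \<open>s = m * T\<close> with \<open>m\<close> tending to infinity
    replaces one side by \<open>\<pi>\<close>.\<close>
  have skel: "\<bar>semigroup P (real n * T) f x - (\<integral>x. f x \<partial>\<pi>)\<bar> \<le> q ^ n * (1 + V x + V x0 + B0)"
    if f: "bdist_lipschitz f" for f n x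
  proof -
    have bnd: "bounded (range f)"
      using bdist_lipschitz_bounded[OF f] by (auto simp: bounded_iff)
    have "(\<lambda>m. semigroup P (real (m + n) * T) f x0) \<longlonglongrightarrow> (\<integral>x. f x \<partial>\<pi>)"
      using LIMSEQ_ignore_initial_segment[OF lim[OF bdist_lipschitz_continuous[OF f] bnd], of n]
      by (simp add: semigroup_def)
    then have "(\<lambda>m. \<bar>semigroup P (real (m + n) * T) f x0 - semigroup P (real n * T) f x\<bar>)
        \<longlonglongrightarrow> \<bar>(\<integral>x. f x \<partial>\<pi>) - semigroup P (real n * T) f x\<bar>"
      by (intro tendsto_intros)
    moreover have "\<bar>semigroup P (real (m + n) * T) f x0 - semigroup P (real n * T) f x\<bar> \<le> q ^ n * (1 + V x + V x0 + B0)" for m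
      using dual_contraction_shifted[OF f T0[of m], of n x0 x] by (simp add: q_def algebra_simps)
    ultimately have "\<bar>(\<integral>x. f x \<partial>\<pi>) - semigroup P (real n * T) f x\<bar> \<le> q ^ n * (1 + V x + V x0 + B0)"
      by (intro LIMSEQ_le_const2) auto
    then show ?thesis by (simp add: abs_minus_commute)
  qed
  define D where "D = 1 + V x0 + 2 * B0"
  have D: "1 \<le> D" using V_nonneg[of x0] B0_nonneg by (simp add: D_def)
  \<comment> \<open>\<open>q ^ n\<close> is \<open>exp (- c * n * T)\<close>; rounding
    \<open>t / T\<close> down to \<open>n\<close> costs the factor \<open>1 / q\<close>.\<close>
  define c where "c = - ln q / T"
  have c: "0 < c" using q T_pos by (simp add: c_def divide_neg_pos)
  have main: "\<bar>semigroup P t f x - (\<integral>x. f x \<partial>\<pi>)\<bar> \<le> D / q * (1 + V x) * exp (- c * t)"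
    if f: "bdist_lipschitz f" and t: "0 \<le> t" for f x t
  proof -
    define n where "n = nat \<lfloor>t / T\<rfloor>"
    define s where "s = t - real n * T"
    have n_eq: "real n = of_int \<lfloor>t / T\<rfloor>"
      using t T_pos by (simp add: n_def)
    have "real n \<le> t / T" unfolding n_eq by (rule of_int_floor_le)
    then have s: "0 \<le> s" using T_pos by (simp add: s_def pos_le_divide_eq)
    have n1: "t / T - 1 \<le> real n" unfolding n_eq by linarith
    have b: "bounded_borel f" by (rule bdist_lipschitz_bounded_borel[OF f])
    have "\<bar>semigroup P s (semigroup P (real n * T) f) x - (\<integral>x. f x \<partial>\<pi>)\<bar>
        \<le> q ^ n * (1 + V x0 + B0) + q ^ n * (V x + B0)"
    proof (rule abs_semigroup_diff_le[OF s semigroup_bounded_borel[OF T0 b]])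
      show "\<bar>semigroup P (real n * T) f y - (\<integral>x. f x \<partial>\<pi>)\<bar> \<le> q ^ n * (1 + V x0 + B0) + q ^ n * V y" for y
        using skel[OF f, of n y] by (simp add: algebra_simps)
      show "PV s x \<le> ennreal (V x + B0)"
        using PV_bound[OF s] by (simp add: B0_def)
    qed (use V_nonneg[of x] B0_nonneg q in auto)
    moreover have "semigroup P s (semigroup P (real n * T) f) x = semigroup P t f x"
      using semigroup_add[OF s T0 b, of n x] by (simp add: s_def)
    ultimately have "\<bar>semigroup P t f x - (\<integral>x. f x \<partial>\<pi>)\<bar> \<le> q ^ n * (D + V x)"
      by (simp add: D_def algebra_simps)
    also have "\<dots> \<le> q ^ n * (D * (1 + V x))"
      using D V_nonneg[of x] q mult_right_mono[of 1 D "V x"] by (intro mult_left_mono) (auto simp: algebra_simps)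
    also have "q ^ n \<le> exp (- c * t) / q"
    proof -
      have "q ^ n = exp (ln q * real n)"
        using q by (simp add: exp_of_nat2_mult)
      also have "\<dots> \<le> exp (ln q * (t / T - 1))"
        using q n1 by (intro iffD2[OF exp_le_cancel_iff] mult_left_mono_neg) auto
      also have "ln q * (t / T - 1) = - c * t - ln q"
        by (simp add: c_def algebra_simps)
      also have "exp (- c * t - ln q) = exp (- c * t) / q"
        using q by (simp add: exp_diff)
      finally show ?thesis .
    qed
    finally show ?thesis
      using D V_nonneg[of x] by (simp add: mult_ac mult_right_mono)
  qed
  show ?thesis
  proof (rule that[OF \<pi>, of "D / q" c])
    show "0 < D / q" using D q by simp
    show "(\<lambda>n. semigroup P (real n * T) f undefined) \<longlonglongrightarrow> (\<integral>x. f x \<partial>\<pi>)"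
      if "continuous_on UNIV f" "bounded (range f)" for f :: "'a \<Rightarrow> real"
      using lim[OF that] by (simp add: semigroup_def x0_def)
  qed (fact c main)+
qed

text \<open>For invariance, the limit of \<open>P (n T) (P s f)\<close> is found once by weak
  convergence, where the Feller property makes \<open>P s f\<close> continuous, and once from the
  rate for \<open>f\<close> at the times \<open>n T + s\<close>. For uniqueness, an invariant law
  gives \<open>f\<close> and \<open>P (n T) f\<close> equal integrals, and the latter converges
  boundedly to a constant.\<close>

lemma ergodic:
  assumes feller: "feller P"
  obtains \<pi> C c where "invariant_measure P \<pi>" "\<And>\<pi>'. invariant_measure P \<pi>' \<Longrightarrow> \<pi>' = \<pi>" "0 < C" "0 < c"
    and "\<And>f x t. bdist_lipschitz f \<Longrightarrow> 0 \<le> t \<Longrightarrow> \<bar>semigroup P t f x - (\<integral>x. f x \<partial>\<pi>)\<bar> \<le> C * (1 + V x) * exp (- c * t)"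
proof -
  obtain \<pi> C c where \<pi>: "prob_space \<pi>" "sets \<pi> = sets borel" and C: "0 < C" and c: "0 < c"
    and lim: "\<And>f :: 'a \<Rightarrow> real. continuous_on UNIV f \<Longrightarrow> bounded (range f) \<Longrightarrow>
      (\<lambda>n. semigroup P (real n * T) f undefined) \<longlonglongrightarrow> (\<integral>x. f x \<partial>\<pi>)"
    and rate: "\<And>f x t. bdist_lipschitz f \<Longrightarrow> 0 \<le> t \<Longrightarrow> \<bar>semigroup P t f x - (\<integral>x. f x \<partial>\<pi>)\<bar> \<le> C * (1 + V x) * exp (- c * t)"
    by (rule ergodic_limit) blast
  have T0: "0 \<le> real n * T" for n using T_pos by simp
  have conv: "(\<lambda>n. semigroup P (real n * T + s) f x) \<longlonglongrightarrow> (\<integral>x. f x \<partial>\<pi>)"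
    if f: "bdist_lipschitz f" and s: "0 \<le> s" for f x s
  proof -
    have "(\<lambda>n. C * (1 + V x) * exp (- c * s) * exp (- c * T) ^ n) \<longlonglongrightarrow> C * (1 + V x) * exp (- c * s) * 0"
      using c T_pos by (intro tendsto_mult tendsto_const LIMSEQ_power_zero) auto
    then have "(\<lambda>n. C * (1 + V x) * exp (- c * s) * exp (- c * T) ^ n) \<longlonglongrightarrow> 0"
      by simp
    moreover have "C * (1 + V x) * exp (- c * (real n * T + s)) = C * (1 + V x) * exp (- c * s) * exp (- c * T) ^ n" for n
      by (simp add: exp_add[symmetric] exp_of_nat_mult[symmetric] algebra_simps)
    ultimately have z: "(\<lambda>n. C * (1 + V x) * exp (- c * (real n * T + s))) \<longlonglongrightarrow> 0"
      by (simp only:)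
    have "(\<lambda>n. semigroup P (real n * T + s) f x - (\<integral>x. f x \<partial>\<pi>)) \<longlonglongrightarrow> 0"
    proof (rule Lim_null_comparison[OF _ z])
      show "\<forall>\<^sub>F n in sequentially. norm (semigroup P (real n * T + s) f x - (\<integral>x. f x \<partial>\<pi>)) \<le> C * (1 + V x) * exp (- c * (real n * T + s))"
        using rate[OF f] s T0 by (intro always_eventually) (auto simp: add_nonneg_nonneg)
    qed
    then show ?thesis by (simp add: LIM_zero_iff)
  qed
  have bnd: "bounded (range f)" if "bdist_lipschitz f" for f :: "'a \<Rightarrow> real"
    using bdist_lipschitz_bounded[OF that] by (auto simp: bounded_iff)
  have kernel: "P s \<in> measurable M (subprob_algebra borel)" if "sets M = sets borel" "0 \<le> s" for M :: "'a measure" and s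
    using kernel_P[OF that(2)] that(1) by (simp cong: measurable_cong_sets)
  have sp: "space M \<noteq> {}" if "sets M = sets borel" for M :: "'a measure"
    using that by (auto dest!: sets_eq_imp_space_eq)
  have bind: "prob_space (M \<bind> P s)" "sets (M \<bind> P s) = sets borel"
    if "prob_space M" "sets M = sets borel" "0 \<le> s" for M :: "'a measure" and s
    using that kernel[OF that(2,3)] prob_P sp
    by (auto intro!: prob_space.prob_space_bind[OF that(1), where S=borel] sets_bind[where N=borel])
  have inv_iff: "invariant_measure P M \<longleftrightarrow> prob_space M \<and> sets M = sets borel \<and> (\<forall>s\<ge>0. M \<bind> P s = M)" for M
  proof
    assume M: "invariant_measure P M"
    then have *: "prob_space M" "sets M = sets borel" by (auto simp: invariant_measure_def)
    have "M \<bind> P s = M" if s: "0 \<le> s" for s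
    proof (rule measure_eqI)
      show "sets (M \<bind> P s) = sets M" using bind(2)[OF * s] * by simp
      fix A assume "A \<in> sets (M \<bind> P s)"
      then have "A \<in> sets borel" using bind(2)[OF * s] by simp
      then show "emeasure (M \<bind> P s) A = emeasure M A"
        using M s unfolding invariant_measure_def by (subst emeasure_bind[OF sp[OF *(2)] kernel[OF *(2) s]]) auto
    qed
    with * show "prob_space M \<and> sets M = sets borel \<and> (\<forall>s\<ge>0. M \<bind> P s = M)" by blast
  next
    assume M: "prob_space M \<and> sets M = sets borel \<and> (\<forall>s\<ge>0. M \<bind> P s = M)"
    then have *: "sets M = sets borel" by blast
    have "emeasure M A = (\<integral>\<^sup>+x. emeasure (P s x) A \<partial>M)" if "0 \<le> s" "A \<in> sets borel" for s A
      using M that emeasure_bind[OF sp[OF *] kernel[OF * that(1)] that(2)] by auto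
    with M show "invariant_measure P M" by (auto simp: invariant_measure_def)
  qed
  have inv: "\<pi> \<bind> P s = \<pi>" if s: "0 \<le> s" for s
  proof (rule measure_eq_of_bdist_lipschitz[OF bind[OF \<pi> s] \<pi>])
    fix f :: "'a \<Rightarrow> real" assume f: "bdist_lipschitz f"
    have b: "bounded_borel f" by (rule bdist_lipschitz_bounded_borel[OF f])
    have "continuous_on UNIV (semigroup P s f)" "bounded (range (semigroup P s f))"
      using feller s bdist_lipschitz_continuous[OF f] bnd[OF f] unfolding feller_def by blast+
    then have "(\<lambda>n. semigroup P (real n * T) (semigroup P s f) undefined) \<longlonglongrightarrow> (\<integral>x. semigroup P s f x \<partial>\<pi>)"
      by (rule lim)
    moreover have "(\<lambda>n. semigroup P (real n * T) (semigroup P s f) undefined) \<longlonglongrightarrow> (\<integral>x. f x \<partial>\<pi>)"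
      using conv[OF f s, of undefined] by (simp add: semigroup_add[OF T0 s b])
    ultimately have "(\<integral>x. semigroup P s f x \<partial>\<pi>) = (\<integral>x. f x \<partial>\<pi>)"
      by (rule LIMSEQ_unique)
    then show "(\<integral>x. f x \<partial>(\<pi> \<bind> P s)) = (\<integral>x. f x \<partial>\<pi>)"
      by (simp add: integral_bind_P[OF \<pi> s b])
  qed
  have uniq: "\<pi>' = \<pi>" if "invariant_measure P \<pi>'" for \<pi>'
  proof -
    have \<pi>': "prob_space \<pi>'" "sets \<pi>' = sets borel" and inv': "\<And>s. 0 \<le> s \<Longrightarrow> \<pi>' \<bind> P s = \<pi>'"
      using that unfolding inv_iff by auto
    interpret \<pi>': prob_space \<pi>' by fact
    show ?thesis
    proof (rule measure_eq_of_bdist_lipschitz[OF \<pi>' \<pi>])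
      fix f :: "'a \<Rightarrow> real" assume f: "bdist_lipschitz f"
      have b: "bounded_borel f" by (rule bdist_lipschitz_bounded_borel[OF f])
      have eq: "(\<integral>x. semigroup P (real n * T) f x \<partial>\<pi>') = (\<integral>x. f x \<partial>\<pi>')" for n
        using integral_bind_P[OF \<pi>' T0[of n] b] inv'[OF T0[of n]] by simp
      have meas: "semigroup P (real n * T) f \<in> borel_measurable \<pi>'" for n
        using semigroup_bounded_borel[OF T0 b, of n] \<pi>'(2) by (simp add: bounded_borel_def cong: measurable_cong_sets)
      have "(\<lambda>n. \<integral>x. semigroup P (real n * T) f x \<partial>\<pi>') \<longlonglongrightarrow> (\<integral>x. (\<integral>x. f x \<partial>\<pi>) \<partial>\<pi>')"
      proof (rule integral_dominated_convergence[where w="\<lambda>_. \<bar>f undefined\<bar> + 1"])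
        show "AE x in \<pi>'. (\<lambda>n. semigroup P (real n * T) f x) \<longlonglongrightarrow> (\<integral>x. f x \<partial>\<pi>)"
          using conv[OF f, of 0] by simp
        show "AE x in \<pi>'. norm (semigroup P (real n * T) f x) \<le> \<bar>f undefined\<bar> + 1" for n
          using abs_semigroup_le[OF T0 b, of 0 "\<bar>f undefined\<bar> + 1"] bdist_lipschitz_bounded[OF f] by simp
      qed (use meas in auto)
      then have "(\<lambda>n. \<integral>x. f x \<partial>\<pi>') \<longlonglongrightarrow> (\<integral>x. f x \<partial>\<pi>)"
        by (simp add: eq \<pi>'.prob_space)
      then show "(\<integral>x. f x \<partial>\<pi>') = (\<integral>x. f x \<partial>\<pi>)"
        using LIMSEQ_unique tendsto_const by blast
    qed
  qed
  have "invariant_measure P \<pi>"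
    unfolding inv_iff using \<pi> inv by blast
  from that[OF this uniq C c rate] show ?thesis by blast
qed

end

section \<open>From the processes of the assumptions to couplings\<close>

text \<open>Lower semicontinuity says that sublevel sets are closed in the product topology, whose
  Borel sets form the product sigma-algebra by second countability.\<close>

lemma premetric_measurable:
  fixes \<theta> :: "'a::polish_space \<Rightarrow> 'a \<Rightarrow> real"
  assumes "premetric \<theta>"
  shows "case_prod \<theta> \<in> borel_measurable (borel \<Otimes>\<^sub>M borel)"
  unfolding borel_prod borel_measurable_iff_le
proof
  fix a
  have "closed {p::'a \<times> 'a. \<theta> (fst p) (snd p) \<le> a}"
    using assms unfolding premetric_def by blast
  then show "{w \<in> space borel. case_prod \<theta> w \<le> a} \<in> sets borel"
    by (simp add: case_prod_beta')
qed

text \<open>The generalized coupling at time \<open>t\<close> has first law \<open>P t x\<close>.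
  Truncation of the cost at 1 is what lets the total variation defect of \<open>Y\<close> enter
  additively as \<open>a\<close>.\<close>

lemma coupling_of_processes:
  fixes \<theta> :: "'a::polish_space \<Rightarrow> 'a \<Rightarrow> real"
  assumes P: "markov_semigroup P" and \<theta>: "premetric \<theta>" and N: "0 \<le> N" and t: "0 \<le> t"
    and M: "prob_space M" "law_is_markov P x M X" "Y \<in> measurable M borel"
    and tv: "tv_dist (distr M borel Y) (P t y) \<le> a" and cost: "(\<integral>\<^sup>+\<omega>. ennreal (\<theta> (X t \<omega>) (Y \<omega>)) \<partial>M) \<le> ennreal b"
    and ab: "0 \<le> a" "0 \<le> b"
  shows "\<exists>cpl. coupling (P t x) (P t y) cpl \<and> (\<integral>\<^sup>+p. ennreal (min (N * \<theta> (fst p) (snd p)) 1) \<partial>cpl) \<le> ennreal (N * b + a)"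
proof -
  interpret markov_semigroup P by fact
  have \<theta>0: "0 \<le> \<theta> u v" for u v using \<theta> by (simp add: premetric_def)
  have X[measurable]: "X t \<in> measurable M borel"
    using M(2) t unfolding law_is_markov_def by blast
  note Y[measurable] = M(3)
  have \<theta>m[measurable]: "case_prod \<theta> \<in> borel_measurable (borel \<Otimes>\<^sub>M borel)"
    by (rule premetric_measurable[OF \<theta>])
  have dm: "(\<lambda>(u, v). min (N * \<theta> u v) 1) \<in> borel_measurable (borel \<Otimes>\<^sub>M borel)"
    using \<theta>m by (simp add: case_prod_beta')
  have XYm: "(\<lambda>\<omega>. \<theta> (X t \<omega>) (Y \<omega>)) \<in> borel_measurable M"
    using measurable_compose[OF measurable_Pair[OF X Y] \<theta>m] by simp
  obtain cpl where cpl: "coupling (distr M borel (X t)) (P t y) cpl"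
    and le: "(\<integral>\<^sup>+p. ennreal (min (N * \<theta> (fst p) (snd p)) 1) \<partial>cpl)
      \<le> (\<integral>\<^sup>+\<omega>. ennreal (min (N * \<theta> (X t \<omega>) (Y \<omega>)) 1) \<partial>M) + ennreal (tv_dist (distr M borel Y) (P t y))"
    using coupling_of_generalized_coupling[OF M(1) X Y prob_P[OF t] sets_P[OF t] dm] N \<theta>0 by auto
  note le
  also have "(\<integral>\<^sup>+\<omega>. ennreal (min (N * \<theta> (X t \<omega>) (Y \<omega>)) 1) \<partial>M) \<le> (\<integral>\<^sup>+\<omega>. ennreal N * ennreal (\<theta> (X t \<omega>) (Y \<omega>)) \<partial>M)"
    using N \<theta>0 by (intro nn_integral_mono) (simp add: ennreal_leI flip: ennreal_mult)
  also have "\<dots> = ennreal N * (\<integral>\<^sup>+\<omega>. ennreal (\<theta> (X t \<omega>) (Y \<omega>)) \<partial>M)"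
    using XYm by (intro nn_integral_cmult) simp
  also have "\<dots> \<le> ennreal N * ennreal b"
    by (intro mult_left_mono cost) simp
  also have "ennreal (tv_dist (distr M borel Y) (P t y)) \<le> ennreal a"
    using tv by (rule ennreal_leI)
  also have "ennreal N * ennreal b + ennreal a = ennreal (N * b + a)"
    using N ab by (intro ennreal_affine)
  finally show ?thesis
    using cpl law_is_markov_distr[OF P M(2) t] by (auto simp: add_mono)
qed

section \<open>The explicit rate\<close>

text \<open>The integral is oriented, so the antiderivative \<open>ln u / \<gamma>\<close> serves on
  both sides of 1. The resulting injectivity on positive arguments is what the definite description
  in \<open>H_phi_inv\<close> relies on.\<close>

lemma H_phi_eq:
  assumes "0 < \<gamma>" "0 < x"
  shows "H_phi \<gamma> x = ln x / \<gamma>"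
proof -
  have pos: "0 < u" if "min 1 x \<le> u" for u using that assms by linarith
  have "(LBINT u=ereal 1..ereal x. 1 / phi \<gamma> u) = ln x / \<gamma> - ln 1 / \<gamma>"
  proof (rule interval_integral_FTC_finite)
    show "continuous_on {min 1 x..max 1 x} (\<lambda>u. 1 / phi \<gamma> u)"
      unfolding phi_def using assms pos by (intro continuous_intros) force
    fix u assume "min 1 x \<le> u" "u \<le> max 1 x"
    then have "0 < u" by (intro pos)
    then have "((\<lambda>u. ln u / \<gamma>) has_real_derivative 1 / phi \<gamma> u) (at u within {min 1 x..max 1 x})"
      using assms unfolding phi_def by (auto intro!: derivative_eq_intros simp: field_simps)
    then show "((\<lambda>u. ln u / \<gamma>) has_vector_derivative 1 / phi \<gamma> u) (at u within {min 1 x..max 1 x})"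
      by (simp add: has_real_derivative_iff_has_vector_derivative)
  qed
  then show ?thesis by (simp add: H_phi_def)
qed

lemma H_phi_inv_eq:
  assumes "0 < \<gamma>"
  shows "H_phi_inv \<gamma> y = exp (\<gamma> * y)"
  unfolding H_phi_inv_def
proof (rule the_equality)
  show "0 < exp (\<gamma> * y) \<and> H_phi \<gamma> (exp (\<gamma> * y)) = y"
    using assms by (simp add: H_phi_eq)
  fix x assume "0 < x \<and> H_phi \<gamma> x = y"
  then show "x = exp (\<gamma> * y)"
    using assms by (auto simp: H_phi_eq field_simps)
qed

text \<open>Interpolation with the trivial bound: below 1 the smaller exponent increases
  \<open>z\<close>, and above 1 the power is at least 1.\<close>

lemma min_1_powr_bound:
  fixes z \<delta> :: real
  assumes "0 < z" "0 < \<delta>" "\<delta> < 1"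
  shows "min 1 z \<le> z powr \<delta>"
proof (cases "1 \<le> z")
  case True
  then show ?thesis using ge_one_powr_ge_zero[of z \<delta>] assms by simp
next
  case False
  then have "z powr 1 \<le> z powr \<delta>"
    using assms by (intro powr_mono') auto
  then show ?thesis using assms False by simp
qed

text \<open>The factor 2 comes from
  \<open>(1 + v) powr \<delta> \<le> 2 * (1 + v powr \<delta>)\<close>; the maximum pays for
  replacing \<open>v\<close> by \<open>\<gamma> * v\<close>.\<close>

lemma powr_rate_bound:
  fixes C c \<gamma> v \<delta> t :: real
  assumes "0 < C" "0 < \<gamma>" "0 \<le> v" "0 < \<delta>" "\<delta> < 1"
  shows "(C * (1 + v) * exp (- c * t)) powr \<delta>
    \<le> (2 * C powr \<delta> * max 1 (\<gamma> powr \<delta>)) * (1 + (\<gamma> * v) powr \<delta>) / (\<gamma> * exp (c * t)) powr \<delta>"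
proof -
  define g where "g = \<gamma> powr \<delta>"
  define w where "w = v powr \<delta>"
  define E where "E = exp (c * t) powr \<delta>"
  have pos: "0 < g" "0 \<le> w" "0 < E" "0 < C powr \<delta>" using assms by (auto simp: g_def w_def E_def)
  have "(1 + v) powr \<delta> \<le> (2 * max 1 v) powr \<delta>"
    using assms by (intro powr_mono2) auto
  also have "\<dots> = 2 powr \<delta> * max 1 v powr \<delta>"
    by (simp add: powr_mult)
  also have "\<dots> \<le> 2 * (1 + w)"
  proof (intro mult_mono)
    show "2 powr \<delta> \<le> (2::real)" using powr_mono[of \<delta> 1 2] assms by simp
    show "max 1 v powr \<delta> \<le> 1 + w" by (auto simp: w_def max_def)
  qed auto
  finally have 1: "(1 + v) powr \<delta> \<le> 2 * (1 + w)" .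
  have 2: "g * (1 + w) \<le> max 1 g * (1 + g * w)"
  proof -
    have "g \<le> max 1 g" by simp
    moreover have "1 * (g * w) \<le> max 1 g * (g * w)"
      using pos by (intro mult_right_mono) auto
    ultimately show ?thesis by (simp only: distrib_left mult_1 mult_1_right)
  qed
  have "(C * (1 + v) * exp (- c * t)) powr \<delta> = C powr \<delta> * (1 + v) powr \<delta> / E"
    using assms by (simp add: powr_mult E_def exp_minus powr_divide divide_inverse inverse_powr)
  also have "\<dots> \<le> C powr \<delta> * (2 * (1 + w)) / E"
    using pos 1 by (intro divide_right_mono mult_left_mono) auto
  also have "\<dots> = 2 * C powr \<delta> * (g * (1 + w)) / (g * E)"
    using pos by (simp add: field_simps)
  also have "\<dots> \<le> 2 * C powr \<delta> * (max 1 g * (1 + g * w)) / (g * E)"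
    using pos 2 by (intro divide_right_mono mult_left_mono) auto
  also have "\<dots> = (2 * C powr \<delta> * max 1 (\<gamma> powr \<delta>)) * (1 + (\<gamma> * v) powr \<delta>) / (\<gamma> * exp (c * t)) powr \<delta>"
    using assms by (simp add: g_def w_def E_def powr_mult mult_ac)
  finally show ?thesis .
qed

section \<open>Choice of the parameters and conclusion\<close>

theorem theorem2p8:
  fixes P :: "real \<Rightarrow> 'a::polish_space \<Rightarrow> 'a measure"
    and V :: "'a \<Rightarrow> real" and \<gamma> K :: real
    and \<theta> :: "'a \<Rightarrow> 'a \<Rightarrow> real"
    and r L R :: "real \<Rightarrow> real" and \<epsilon> :: real
  assumes markov: "markov_transition P"
    and feller: "feller P"
    and V_meas: "V \<in> borel_measurable borel" and V_nonneg: "\<forall>x. V x \<ge> 0"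
    and \<gamma>_pos: "\<gamma> > 0" and K_pos: "K > 0"
    and lyap: "\<forall>t\<ge>0. \<forall>x. (\<integral>\<^sup>+ y. ennreal (V y) \<partial>P t x)
                 + ennreal \<gamma> * (\<integral>\<^sup>+ s\<in>{0..t}. (\<integral>\<^sup>+ y. ennreal (V y) \<partial>P s x) \<partial>lborel)
               \<le> ennreal (V x + K * t)"
    and prem: "premetric \<theta>"
    and dom: "\<forall>x y. min (dist x y) 1 \<le> \<theta> x y"
    and A: "assumption_A P \<theta> r L TYPE('b)"
    and B2: "assumption_B2 P \<theta> {x. V x \<le> 4 * K / \<gamma>} R \<epsilon> TYPE('c)"
    and \<epsilon>_pos: "\<epsilon> > 0"
  shows "\<exists>\<pi>. invariant_measure P \<pi> \<and> (\<forall>\<pi>'. invariant_measure P \<pi>' \<longrightarrow> \<pi>' = \<pi>) \<and>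
           (\<forall>\<delta>. 0 < \<delta> \<and> \<delta> < 1 \<longrightarrow>
              (\<exists>C1 C2. C1 > 0 \<and> C2 > 0 \<and>
                 (\<forall>x. \<forall>t\<ge>0. wasserstein (\<lambda>x y. min (dist x y) 1) (P t x) \<pi>
                    \<le> ennreal (C1 * (1 + phi \<gamma> (V x) powr \<delta>)
                               / phi \<gamma> (H_phi_inv \<gamma> (C2 * t)) powr \<delta>))))"
proof -
  interpret lyapunov_semigroup P V \<gamma> K
    using markov V_meas V_nonneg \<gamma>_pos K_pos lyap by unfold_locales auto
  have \<theta>: "0 \<le> \<theta> x y" for x y
    using prem by (auto simp: premetric_def)
  have r: "(r \<longlongrightarrow> 0) at_top" "\<forall>t\<ge>0. r t \<ge> 0" and L: "\<forall>t\<ge>0. L t \<ge> 0"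
    and cA: "\<forall>x y. \<exists>(M::'b measure) X Y. prob_space M \<and> law_is_markov P x M X \<and>
        (\<forall>t\<ge>0. Y t \<in> measurable M borel) \<and>
        (\<forall>t\<ge>0. tv_dist (distr M borel (Y t)) (P t y) \<le> L t * \<theta> x y) \<and>
        (\<forall>t\<ge>0. (\<integral>\<^sup>+ \<omega>. ennreal (\<theta> (X t \<omega>) (Y t \<omega>)) \<partial>M) \<le> ennreal (r t * \<theta> x y))"
    using A unfolding assumption_A_def by - (elim conjE, assumption)+
  have R: "(R \<longlongrightarrow> 0) at_top" "\<forall>t\<ge>0. R t \<ge> 0"
    and cB: "\<forall>x\<in>{x. V x \<le> 4 * K / \<gamma>}. \<forall>y\<in>{x. V x \<le> 4 * K / \<gamma>}. \<exists>(M::'c measure) X Y. prob_space M \<and> law_is_markov P x M X \<and>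
        (\<forall>t\<ge>0. Y t \<in> measurable M borel) \<and>
        (\<forall>t\<ge>0. tv_dist (distr M borel (Y t)) (P t y) \<le> 1 - \<epsilon>) \<and>
        (\<forall>t\<ge>0. (\<integral>\<^sup>+ \<omega>. ennreal (\<theta> (X t \<omega>) (Y t \<omega>)) \<partial>M) \<le> ennreal (R t))"
    using B2 unfolding assumption_B2_def by - (elim conjE, assumption)+
  have "\<forall>\<^sub>F t in at_top. r t < 1 / 4 \<and> 1 \<le> t"
    using order_tendstoD(2)[OF r(1), of "1 / 4"] eventually_ge_at_top[of 1] by (simp add: eventually_conj)
  then obtain t1 where t1: "r t1 < 1 / 4" "1 \<le> t1"
    by (auto dest!: eventually_happens)
  \<comment> \<open>\<open>r t1 < 1 / 4\<close> and \<open>4 * L t1 \<le> N\<close> contribute a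
    quarter of \<open>N * \<theta>\<close> each, together half of \<open>d\<close>. The bound
    \<open>1 \<le> N\<close> keeps \<open>d\<close> above \<open>bdist\<close>.\<close>
  define N where "N = max 1 (4 * L t1)"
  have N: "1 \<le> N" "4 * L t1 \<le> N" by (auto simp: N_def)
  \<comment> \<open>Truncation keeps \<open>1 - e\<close> nonnegative. Half of \<open>e\<close> is
    spent on \<open>N * R T\<close>, so \<open>e / 2\<close> becomes the \<open>\<epsilon>\<close>
    of \<open>weak_harris\<close>.\<close>
  define e where "e = min \<epsilon> 1"
  have e: "0 < e" "e \<le> 1" "e \<le> \<epsilon>" using \<epsilon>_pos by (auto simp: e_def)
  have "\<forall>\<^sub>F t in at_top. R t < e / (2 * N) \<and> 7 / \<gamma> \<le> t"
    using order_tendstoD(2)[OF R(1), of "e / (2 * N)"] eventually_ge_at_top[of "7 / \<gamma>"] e N by (simp add: eventually_conj)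
  \<comment> \<open>The bounds are kept for all later times, since \<open>T\<close> must also be a
    multiple of \<open>t1\<close>.\<close>
  then obtain T0 where T0: "\<And>t. T0 \<le> t \<Longrightarrow> R t < e / (2 * N)" "\<And>t. T0 \<le> t \<Longrightarrow> 7 / \<gamma> \<le> t"
    by (auto simp: eventually_at_top_linorder)
  \<comment> \<open>Exceeding 1 as well as \<open>T0\<close> forces \<open>k\<close> to be
    positive.\<close>
  obtain k :: nat where k: "max T0 1 < real k * t1"
    using ex_less_of_nat_mult[of t1 "max T0 1"] t1 by auto
  define T where "T = real k * t1"
  have T: "0 < T" "R T < e / (2 * N)" "7 \<le> \<gamma> * T"
    using k T0[of T] \<gamma>_pos by (auto simp: T_def field_simps)
  have "\<forall>\<^sub>F b in at_right 0. (1 + 2 * b * K * t1) ^ k < 3 / 2"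
  proof (rule order_tendstoD)
    show "((\<lambda>b. (1 + 2 * b * K * t1) ^ k) \<longlongrightarrow> (1 + 2 * 0 * K * t1) ^ k) (at_right 0)"
      by (intro tendsto_intros)
  qed simp
  moreover have "\<forall>\<^sub>F b in at_right 0. 5 * b * K / (2 * \<gamma>) < e / 4"
  proof (rule order_tendstoD)
    show "((\<lambda>b. 5 * b * K / (2 * \<gamma>)) \<longlongrightarrow> 5 * 0 * K / (2 * \<gamma>)) (at_right 0)"
      using \<gamma>_pos by (intro tendsto_intros) auto
  qed (use e in simp)
  moreover have "\<forall>\<^sub>F b in at_right (0::real). 0 < b \<and> b < 1"
    by (auto simp: eventually_at_right_field intro!: exI[of _ 1])
  ultimately have "\<forall>\<^sub>F b in at_right 0. (1 + 2 * b * K * t1) ^ k < 3 / 2 \<and> 5 * b * K / (2 * \<gamma>) < e / 4 \<and> 0 < b \<and> b < 1"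
    by eventually_elim auto
  \<comment> \<open>With \<open>k\<close> fixed, both expressions have limits strictly inside their
    bounds as \<open>b\<close> decreases to 0. The bound \<open>e / 4\<close> is half of
    \<open>e / 2\<close>.\<close>
  then obtain \<beta> where \<beta>: "(1 + 2 * \<beta> * K * t1) ^ k < 3 / 2" "5 * \<beta> * K / (2 * \<gamma>) < e / 4" "0 < \<beta>" "\<beta> < 1"
    by (auto dest!: eventually_happens)
  define d where "d x y = min (N * \<theta> x y) 1" for x y
  interpret weak_harris P V \<gamma> K d t1 T \<beta> "e / 2" k
  proof
    show "case_prod d \<in> borel_measurable (borel \<Otimes>\<^sub>M borel)"
      using premetric_measurable[OF prem] by (simp add: d_def case_prod_beta')
    show "bdist x y \<le> d x y" for x y
    proof -
      have "\<theta> x y \<le> N * \<theta> x y" using N \<theta>[of x y] by (simp add: mult_le_cancel_right1)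
      then show ?thesis using dom[rule_format, of x y] by (simp add: d_def)
    qed
    show "\<exists>cpl. coupling (P t1 x) (P t1 y) cpl \<and> (\<integral>\<^sup>+p. ennreal (d (fst p) (snd p)) \<partial>cpl) \<le> ennreal (d x y / 2)"
      if "d x y < 1" for x y
    proof -
      have dxy: "d x y = N * \<theta> x y" using that by (simp add: d_def min_def split: if_splits)
      obtain M :: "'b measure" and X Y where M: "prob_space M" "law_is_markov P x M X" "\<forall>t\<ge>0. Y t \<in> measurable M borel"
        "\<forall>t\<ge>0. tv_dist (distr M borel (Y t)) (P t y) \<le> L t * \<theta> x y"
        "\<forall>t\<ge>0. (\<integral>\<^sup>+ \<omega>. ennreal (\<theta> (X t \<omega>) (Y t \<omega>)) \<partial>M) \<le> ennreal (r t * \<theta> x y)"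
        using cA by blast
      have "\<exists>cpl. coupling (P t1 x) (P t1 y) cpl \<and>
          (\<integral>\<^sup>+p. ennreal (min (N * \<theta> (fst p) (snd p)) 1) \<partial>cpl) \<le> ennreal (N * (r t1 * \<theta> x y) + L t1 * \<theta> x y)"
        using M t1 N \<theta> r(2) L
        by (intro coupling_of_processes[OF markov_semigroup_axioms prem, of N t1 M x X "Y t1"]) auto
      moreover have "N * (r t1 * \<theta> x y) + L t1 * \<theta> x y \<le> d x y / 2"
      proof -
        have "(N * r t1 + L t1) * \<theta> x y \<le> (N / 2) * \<theta> x y"
        proof (rule mult_right_mono)
          have "N * r t1 \<le> N * (1 / 4)" using t1 N by (intro mult_left_mono) auto
          then show "N * r t1 + L t1 \<le> N / 2" using N by linarith
        qed (rule \<theta>)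
        then show ?thesis by (simp add: dxy algebra_simps)
      qed
      ultimately show ?thesis
        unfolding d_def[of "fst _"] by (meson ennreal_leI order_trans)
    qed
    show "\<exists>cpl. coupling (P T x) (P T y) cpl \<and> (\<integral>\<^sup>+p. ennreal (d (fst p) (snd p)) \<partial>cpl) \<le> ennreal (1 - e / 2)"
      if "V x \<le> 4 * K / \<gamma>" "V y \<le> 4 * K / \<gamma>" for x y
    proof -
      have xy: "x \<in> {x. V x \<le> 4 * K / \<gamma>}" "y \<in> {x. V x \<le> 4 * K / \<gamma>}"
        using that by auto
      obtain M :: "'c measure" and X Y where M: "prob_space M" "law_is_markov P x M X" "\<forall>t\<ge>0. Y t \<in> measurable M borel"
        "\<forall>t\<ge>0. tv_dist (distr M borel (Y t)) (P t y) \<le> 1 - \<epsilon>"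
        "\<forall>t\<ge>0. (\<integral>\<^sup>+ \<omega>. ennreal (\<theta> (X t \<omega>) (Y t \<omega>)) \<partial>M) \<le> ennreal (R t)"
        using bspec[OF bspec[OF cB xy(1)] xy(2)] by (elim exE conjE)
      have "tv_dist (distr M borel (Y T)) (P T y) \<le> 1 - e"
        using M(4)[rule_format, of T] T(1) e(3) by linarith
      then have "\<exists>cpl. coupling (P T x) (P T y) cpl \<and>
          (\<integral>\<^sup>+p. ennreal (min (N * \<theta> (fst p) (snd p)) 1) \<partial>cpl) \<le> ennreal (N * R T + (1 - e))"
        using M T N e R(2)
        by (intro coupling_of_processes[OF markov_semigroup_axioms prem, of N T M x X "Y T"]) auto
      moreover have "N * R T + (1 - e) \<le> 1 - e / 2"
        using T(2) N by (simp add: field_simps)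
      ultimately show ?thesis
        unfolding d_def[of "fst _"] by (meson ennreal_leI order_trans)
    qed
  qed (use t1 k T e \<beta> in \<open>auto simp: d_def \<theta> T_def intro: Nat.gr0I\<close>)
  obtain \<pi> C c where \<pi>: "invariant_measure P \<pi>" "\<And>\<pi>'. invariant_measure P \<pi>' \<Longrightarrow> \<pi>' = \<pi>" and C: "0 < C" and c: "0 < c"
    and rate: "\<And>f x t. bdist_lipschitz f \<Longrightarrow> 0 \<le> t \<Longrightarrow> \<bar>semigroup P t f x - (\<integral>x. f x \<partial>\<pi>)\<bar> \<le> C * (1 + V x) * exp (- c * t)"
    using ergodic[OF feller] by blast
  have prob_\<pi>: "prob_space \<pi>" "sets \<pi> = sets borel" using \<pi>(1) by (auto simp: invariant_measure_def)
  \<comment> \<open>The test functions oscillate by at most 1, which supplies the trivial bound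
    beside the exponential one.\<close>
  have W: "wasserstein (\<lambda>x y. min (dist x y) 1) (P t x) \<pi> \<le> ennreal (min 1 (C * (1 + V x) * exp (- c * t)))" if t: "0 \<le> t" for x t
  proof (rule wasserstein_le_dual[OF prob_P[OF t] sets_P[OF t] prob_\<pi>])
    fix f :: "'a \<Rightarrow> real" assume f: "bdist_lipschitz f"
    have b: "bounded_borel f" by (rule bdist_lipschitz_bounded_borel[OF f])
    interpret \<pi>: prob_space \<pi> by (rule prob_\<pi>)
    have osc: "\<bar>f y - f z\<bar> \<le> 1" for y z
      using f[unfolded bdist_lipschitz_def, rule_format, of y z] by simp
    have "semigroup P t f x - 1 \<le> f z" for z
      using abs_semigroup_le[OF t b osc, of x z] by linarith
    then have "semigroup P t f x - 1 \<le> (\<integral>z. f z \<partial>\<pi>)"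
      using integrable_bounded_borel'[OF prob_\<pi> b] by (intro \<pi>.integral_ge_const) auto
    then show "(\<integral>x. f x \<partial>P t x) - (\<integral>x. f x \<partial>\<pi>) \<le> min 1 (C * (1 + V x) * exp (- c * t))"
      using rate[OF f t, of x] by (simp add: semigroup_def)
  qed
  show ?thesis
  proof (intro exI[of _ \<pi>] conjI allI impI)
    show "invariant_measure P \<pi>" by (rule \<pi>(1))
    show "\<pi>' = \<pi>" if "invariant_measure P \<pi>'" for \<pi>' using that by (rule \<pi>(2))
    fix \<delta> :: real assume \<delta>: "0 < \<delta> \<and> \<delta> < 1"
    define C1 where "C1 = 2 * C powr \<delta> * max 1 (\<gamma> powr \<delta>)"
    show "\<exists>C1 C2. C1 > 0 \<and> C2 > 0 \<and>
      (\<forall>x. \<forall>t\<ge>0. wasserstein (\<lambda>x y. min (dist x y) 1) (P t x) \<pi>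
        \<le> ennreal (C1 * (1 + phi \<gamma> (V x) powr \<delta>) / phi \<gamma> (H_phi_inv \<gamma> (C2 * t)) powr \<delta>))"
    \<comment> \<open>\<open>H_phi_inv \<gamma> y\<close> is \<open>exp (\<gamma> * y)\<close>, so
      \<open>C2 = c / \<gamma>\<close> turns the denominator into
      \<open>(\<gamma> * exp (c * t)) powr \<delta>\<close>.\<close>
    proof (rule exI[of _ C1], rule exI[of _ "c / \<gamma>"], intro conjI allI impI)
      show "0 < C1" using C by (auto simp: C1_def)
      show "0 < c / \<gamma>" using c \<gamma>_pos by simp
      fix x :: 'a and t :: real assume t: "0 \<le> t"
      have pos: "0 < C * (1 + V x) * exp (- c * t)"
        using C V_nonneg[rule_format, of x] by (simp add: add_pos_nonneg)
      have "min 1 (C * (1 + V x) * exp (- c * t)) \<le> (C * (1 + V x) * exp (- c * t)) powr \<delta>"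
        using pos \<delta> by (intro min_1_powr_bound) auto
      also have "\<dots> \<le> C1 * (1 + (\<gamma> * V x) powr \<delta>) / (\<gamma> * exp (c * t)) powr \<delta>"
        unfolding C1_def using C \<gamma>_pos V_nonneg[rule_format, of x] \<delta> by (intro powr_rate_bound) auto
      also have "\<gamma> * exp (c * t) = phi \<gamma> (H_phi_inv \<gamma> (c / \<gamma> * t))"
        using \<gamma>_pos by (simp add: phi_def H_phi_inv_eq)
      finally have "min 1 (C * (1 + V x) * exp (- c * t)) \<le> C1 * (1 + phi \<gamma> (V x) powr \<delta>) / phi \<gamma> (H_phi_inv \<gamma> (c / \<gamma> * t)) powr \<delta>"
        by (simp only: phi_def)
      then show "wasserstein (\<lambda>x y. min (dist x y) 1) (P t x) \<pi>
        \<le> ennreal (C1 * (1 + phi \<gamma> (V x) powr \<delta>) / phi \<gamma> (H_phi_inv \<gamma> (c / \<gamma> * t)) powr \<delta>)"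
        by (intro order_trans[OF W[OF t]] ennreal_leI)
    qed
  qed
qed

end
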